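(* Let $g\ge1$ and let $f_\tau$ be the density of the distribution of the trace $\tau(m)=\mathrm{Trace}\, m$ on $G=\mathrm{USp}_{2g}$. If $x\in\mathbb{R}$ and $|x|<2g$, then $$f_\tau(x)=\int_{V_x}\nu_g(x,s_2,\dots,s_g)\,ds_2\cdots ds_g,$$ where $V_x=\{s=(s_1,\dots,s_g)\in U : s_1=x\}$ is identified with a subset of $\mathbb{R}^{g-1}$ via the coordinates $(s_2,\dots,s_g)$ (for $g=1$ the integral is the value $\nu_1(x)$).
   Context: $\mathrm{USp}_{2g}=\{m\in \mathrm{GL}_{2g}(\mathbb{C}) : {}^t m J m=J,\ {}^t m\,\bar m=I_{2g}\}$ with $J=\begin{pmatrix}0&I_g\\-I_g&0\end{pmatrix}$; $dm$ is the Haar measure of total mass $1$. The trace $\tau$ takes values in $[-2g,2g]$; its distribution is the image of $dm$ under $\tau$, and $f_\tau$ is the continuous density of this distribution: $\int_G\varphi(\tau(m))\,dm=\int_{-2g}^{2g}\varphi(x)f_\tau(x)\,dx$ for every continuous $\varphi$. The Viète map is $\mathsf{s}(t)=(s_1(t),\dots,s_g(t))$ for $t=(t_1,\dots,t_g)$, where $s_n(t)$ is the elementary symmetric polynomial of degree $n$. Let $A_g=\{t\in\mathbb{R}^g : -2<t_1<t_2<\dots<t_g<2\}$ and $U=\mathsf{s}(A_g)\subset\mathbb{R}^g$. Let $d_0,d_1\in\mathbb{Z}[s_1,\dots,s_g]$ be the unique polynomials with $d_0(\mathsf{s}(t))=\prod_{j<k}(t_k-t_j)^2$ and $d_1(\mathsf{s}(t))=\prod_{j=1}^g(4-t_j^2)$,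 and put $\nu_g(s)=\frac{1}{(2\pi)^g}\sqrt{d_0(s)d_1(s)}$ for $s \in U$. *)

theory Defs
  imports "HOL-Probability.Probability" "HOL-Library.Poly_Mapping"
begin

section \<open>The compact symplectic group and its trace\<close>

text \<open>
  The rank is \<open>g = CARD('g)\<close>.  Rows and columns of a \<open>2g\<close> by \<open>2g\<close> matrix are indexed by
  \<open>'g + 'g\<close>, so that \<open>Inl\<close> and \<open>Inr\<close> pick out the two blocks of size \<open>g\<close>.
\<close>

type_synonym 'g cmat2 = "complex ^ ('g + 'g) ^ ('g + 'g)"

definition sympJ :: "('g::finite) cmat2" where
  "sympJ = (\<chi> i j. case (i, j) of
      (Inl a, Inr b) \<Rightarrow> if a = b then 1 else 0
    | (Inr a, Inl b) \<Rightarrow> if a = b then - 1 else 0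
    | _ \<Rightarrow> 0)"

definition USp :: "('g::finite) cmat2 set" where
  "USp = {m. invertible m \<and> transpose m ** sympJ ** m = sympJ
             \<and> transpose m ** map_matrix cnj m = mat 1}"

text \<open>
  On the compact group \<open>USp\<close>, a Borel probability measure is automatically a Radon measure, so
  left invariance characterises the normalised Haar measure.
\<close>

definition is_normalized_Haar :: "('g::finite) cmat2 measure \<Rightarrow> bool" where
  "is_normalized_Haar \<mu> \<longleftrightarrow>
     sets \<mu> = sets (restrict_space borel USp) \<and> prob_space \<mu> \<and>
     (\<forall>h\<in>USp. distr \<mu> \<mu> (\<lambda>m. h ** m) = \<mu>)"

text \<open>The real part only serves to get a real type, by the lemma below.\<close>

definition trace_USp :: "('g::finite) cmat2 \<Rightarrow> real" where
  "trace_USp m = Re (trace m)"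

lemma trace_USp:
  fixes m :: "('g::finite) cmat2"
  assumes "m \<in> USp"
  shows "trace m = complex_of_real (trace_USp m)"
proof -
  let ?J = "sympJ :: 'g cmat2" and ?c = "map_matrix cnj m"
  have sym: "transpose m ** ?J ** m = ?J" and uni: "transpose m ** ?c = mat 1"
    using assms by (auto simp: USp_def)
  have uni': "?c ** transpose m = mat 1"
    using uni by (simp add: matrix_left_right_inverse)
  have JJ: "?J ** ?J = - mat 1"
  proof -
    have "(?J ** ?J) $ i $ j = (- mat 1 :: 'g cmat2) $ i $ j" for i j
      by (cases i; cases j)
         (simp_all add: matrix_matrix_mult_def sympJ_def mat_def UNIV_Plus_UNIV[symmetric]
            sum.Plus if_distrib if_distribR cong: if_cong del: UNIV_Plus_UNIV)
    then show ?thesis by (simp add: vec_eq_iff)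
  qed
  have "?J ** m = ?c ** ?J"
    using sym uni' by (metis matrix_mul_assoc matrix_mul_lid)
  then have "trace (?J ** (?J ** m)) = trace (?J ** (?c ** ?J))" by simp
  moreover have "trace (?J ** (?J ** m)) = - trace m"
    unfolding matrix_mul_assoc JJ
    by (simp add: trace_def matrix_matrix_mult_def mat_def if_distrib if_distribR sum_negf
        cong: if_cong)
  moreover have "trace (?J ** (?c ** ?J)) = - trace ?c"
  proof -
    have "trace (?J ** (?c ** ?J)) = trace (?c ** (?J ** ?J))"
      by (metis matrix_mul_assoc trace_mul_sym)
    then show ?thesis
      unfolding JJ
      by (simp add: trace_def matrix_matrix_mult_def mat_def if_distrib if_distribR sum_negf
          cong: if_cong)
  qed
  moreover have "trace ?c = cnj (trace m)"
    by (simp add: trace_def map_matrix_def)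
  ultimately have "cnj (trace m) = trace m" by simp
  then show ?thesis
    by (simp add: trace_USp_def complex_eq_iff)
qed

text \<open>
  The values of \<open>f\<close> outside \<open>[-2g, 2g]\<close> are irrelevant.  Continuity makes \<open>f\<close> unique
  on that interval.
\<close>

definition is_trace_density :: "('g::finite) cmat2 measure \<Rightarrow> (real \<Rightarrow> real) \<Rightarrow> bool" where
  "is_trace_density \<mu> f \<longleftrightarrow>
     (let r = 2 * real CARD('g) in
        continuous_on {- r..r} f \<and>
        (\<forall>\<phi>::real \<Rightarrow> real. continuous_on UNIV \<phi> \<longrightarrow>
           (\<integral>m. \<phi> (trace_USp m) \<partial>\<mu>) = (LBINT x:{- r..r}. \<phi> x * f x)))"

section \<open>The Viete map\<close>

text \<open>
  A point \<open>(t\<^sub>1, \<dots>, t\<^sub>g)\<close> is a function \<open>t :: nat \<Rightarrow> real\<close> on \<open>{1..g}\<close>.  As a point of a product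
  space it is \<open>undefined\<close> outside \<open>{1..g}\<close>, the convention of \<open>PiE\<close> and \<open>PiM\<close>.
\<close>

definition elem_sym :: "nat \<Rightarrow> nat \<Rightarrow> (nat \<Rightarrow> real) \<Rightarrow> real" where
  "elem_sym g n t = (\<Sum>X | X \<subseteq> {1..g} \<and> card X = n. \<Prod>i\<in>X. t i)"

definition viete :: "nat \<Rightarrow> (nat \<Rightarrow> real) \<Rightarrow> nat \<Rightarrow> real" where
  "viete g t = (\<lambda>n\<in>{1..g}. elem_sym g n t)"

definition alcove :: "nat \<Rightarrow> (nat \<Rightarrow> real) set" where
  "alcove g = {t \<in> {1..g} \<rightarrow>\<^sub>E {-2<..<2}. \<forall>j\<in>{1..g}. \<forall>k\<in>{1..g}. j < k \<longrightarrow> t j < t k}"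

definition viete_domain :: "nat \<Rightarrow> (nat \<Rightarrow> real) set" where
  "viete_domain g = viete g ` alcove g"

definition viete_slice :: "nat \<Rightarrow> real \<Rightarrow> (nat \<Rightarrow> real) set" where
  "viete_slice g x = {s \<in> viete_domain g. s 1 = x}"

section \<open>The polynomials d0, d1 and the density on the Viete domain\<close>

text \<open>
  Integer polynomials in variables \<open>s\<^sub>i\<close>, \<open>i :: nat\<close>: finitely supported maps from monomials
  (themselves finitely supported exponent maps) to coefficients.
\<close>

type_synonym ipoly = "(nat \<Rightarrow>\<^sub>0 nat) \<Rightarrow>\<^sub>0 int"

definition vars_in :: "nat set \<Rightarrow> ipoly \<Rightarrow> bool" where
  "vars_in I p \<longleftrightarrow> (\<forall>a\<in>Poly_Mapping.keys p. Poly_Mapping.keys a \<subseteq> I)"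

definition eval_ipoly :: "ipoly \<Rightarrow> (nat \<Rightarrow> real) \<Rightarrow> real" where
  "eval_ipoly p s = (\<Sum>a\<in>Poly_Mapping.keys p. of_int (Poly_Mapping.lookup p a) *
                       (\<Prod>i\<in>Poly_Mapping.keys a. s i ^ Poly_Mapping.lookup a i))"

text \<open>Each of the next two predicates determines the polynomial uniquely.\<close>

definition is_d0 :: "nat \<Rightarrow> ipoly \<Rightarrow> bool" where
  "is_d0 g p \<longleftrightarrow> vars_in {1..g} p \<and>
     (\<forall>t. eval_ipoly p (viete g t) =
          (\<Prod>(j, k)\<in>{(j, k). j \<in> {1..g} \<and> k \<in> {1..g} \<and> j < k}. (t k - t j)\<^sup>2))"

definition is_d1 :: "nat \<Rightarrow> ipoly \<Rightarrow> bool" where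
  "is_d1 g p \<longleftrightarrow> vars_in {1..g} p \<and>
     (\<forall>t. eval_ipoly p (viete g t) = (\<Prod>j\<in>{1..g}. 4 - (t j)\<^sup>2))"

definition nu :: "nat \<Rightarrow> ipoly \<Rightarrow> ipoly \<Rightarrow> (nat \<Rightarrow> real) \<Rightarrow> real" where
  "nu g d0 d1 s = 1 / (2 * pi) ^ g * sqrt (eval_ipoly d0 s * eval_ipoly d1 s)"

text \<open>
  The slice is carried to the coordinates \<open>s\<^sub>2, \<dots>, s\<^sub>g\<close> by restriction to \<open>{2..g}\<close>, with inverse
  \<open>v \<mapsto> v(1 := x)\<close>.  For \<open>g = 1\<close> the product measure is the unit mass at the only point of
  \<open>\<real>\<^sup>0\<close>.
\<close>

definition slice_integral :: "nat \<Rightarrow> ((nat \<Rightarrow> real) \<Rightarrow> real) \<Rightarrow> real \<Rightarrow> real" where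
  "slice_integral g h x =
     (LINT v : (\<lambda>s. restrict s {2..g}) ` viete_slice g x | PiM {2..g} (\<lambda>_. lborel). h (v(1 := x)))"

end

(* Write h = m + m^-1 for m in USp(2g).  Its eigenvalues t_1, ..., t_g in [-2, 2] are real and of
   even multiplicity, and q_k = tr (h^k) / 2 is their k-th power sum.  Invariance of Haar measure
   under one-parameter subgroups exp(sX), summed over a frame of the Lie algebra, gives the loop
   (Schwinger-Dyson) equations for the expectations of monomials in the q_k.  Integration by parts
   gives the same equations for the Weyl measure with density
   prod_{j<k} (t_k - t_j)^2 prod_j sqrt (4 - t_j^2).  These equations have a unique normalised
   solution, because the radial Laplacian is symmetric and nonpositive for the Weyl measure, with
   only constants in its kernel.  Hence the trace of m is distributed as t_1 + ... + t_g under the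
   normalised Weyl measure, without any use of the Weyl integration formula on the group.

   The total mass g! (2 pi)^g follows by expanding the Vandermonde determinant in Chebyshev
   polynomials of the second kind.  The Viete map is injective on the alcove, with Jacobian
   the Vandermonde determinant, so one of the two Vandermonde factors is absorbed by the change of
   variables and the rest of the density becomes nu_g.  Fubini gives the formula for almost every x,
   and both sides are continuous, since nu_g vanishes on the boundary of its domain. *)

theory Submission
  imports Defs
begin

text \<open>For an eigenvalue t = 2 cos(theta) of h, the factor 4 - t^2 is the square of dt/dtheta.
  On the group it appears as -(m - m^-1)^2 = 4 - h^2; on the cube it is the coefficient of the
  radial Laplacian. There it also removes the boundary terms, because (4 - t^2)^(3/2), extended by
  0, is continuously differentiable across t = 2 and t = -2. Uniqueness rests on a degree count: if
  q_k has weight k, the Laplacian does not raise the weight, so everything happens in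
  finite-dimensional spaces of polynomials and no spectral theory is required. Eigenvalues are only
  shown to exist for each single m. No measurable choice of them is made, since the equations
  involve them through power sums alone. The passage from moments to the density goes through
  polynomial test functions: the trace density and the slice integral are continuous on [-2g, 2g]
  and have the same integral against every polynomial.\<close>

section \<open>The semicircle weight on the cube\<close>

text \<open>The common core of both integrations by parts. \<open>H s\<close> is a function
  transported for time \<open>s\<close> by a flow that preserves \<open>M\<close>: translations for
  Lebesgue measure, left multiplication by a one-parameter subgroup for Haar measure. Its integral
  is constant in \<open>s\<close>, and dominated convergence moves the derivative inside.\<close>

lemma integral_flow_derivative_zero:
  fixes H D :: "real \<Rightarrow> 'a \<Rightarrow> real"
  assumes inv: "\<And>s. s \<in> {0..1} \<Longrightarrow> integral\<^sup>L M (H s) = integral\<^sup>L M (H 0)"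
    and int: "\<And>s. s \<in> {0..1} \<Longrightarrow> integrable M (H s)"
    and der: "\<And>s m. s \<in> {0..1} \<Longrightarrow> m \<in> space M \<Longrightarrow> ((\<lambda>s. H s m) has_real_derivative D s m) (at s)"
    and bound: "\<And>s m. s \<in> {0..1} \<Longrightarrow> m \<in> space M \<Longrightarrow> \<bar>D s m\<bar> \<le> B m"
    and B: "integrable M B"
  shows "integral\<^sup>L M (D 0) = 0"
proof -
  define s where "s n = 1 / real (Suc n)" for n
  have s: "s n \<in> {0..1}" "s n > 0" for n by (auto simp: s_def)
  define f where "f n m = (H (s n) m - H 0 m) / s n" for n m
  have f_int: "integrable M (f n)" "integral\<^sup>L M (f n) = 0" for n
    unfolding f_def using s[of n] int[of "s n"] int[of 0] inv[of "s n"] by auto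
  have s0: "s \<longlonglongrightarrow> 0"
    unfolding s_def using LIMSEQ_inverse_real_of_nat by (simp add: inverse_eq_divide)
  have lim: "(\<lambda>n. f n m) \<longlonglongrightarrow> D 0 m" if "m \<in> space M" for m
  proof -
    have "((\<lambda>h. (H h m - H 0 m) / h) \<longlongrightarrow> D 0 m) (at 0)"
      using der[OF _ that, of 0] by (simp add: has_field_derivative_iff)
    moreover have "filterlim s (at 0) sequentially"
      using s0 s(2) by (auto simp: filterlim_at intro!: always_eventually less_imp_neq[symmetric])
    ultimately show ?thesis
      unfolding f_def by (rule filterlim_compose)
  qed
  \<comment> \<open>By the mean value theorem a difference quotient is a value of \<open>D\<close>
    at an intermediate time, so \<open>B\<close> dominates the quotients as well.\<close>
  have bd: "norm (f n m) \<le> B m" if "m \<in> space M" for n m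
  proof -
    have "\<exists>z. z > 0 \<and> z < s n \<and> H (s n) m - H 0 m = (s n - 0) * D z m"
      using s[of n] by (intro MVT2 der[OF _ that]) auto
    then obtain z where "z > 0" "z < s n" "H (s n) m - H 0 m = s n * D z m" by auto
    then show ?thesis
      using s[of n] bound[OF _ that, of z] by (simp add: f_def)
  qed
  have meas: "D 0 \<in> borel_measurable M"
    by (rule borel_measurable_LIMSEQ_real[OF lim]) (use f_int in auto)
  have "(\<lambda>n. integral\<^sup>L M (f n)) \<longlonglongrightarrow> integral\<^sup>L M (D 0)"
    by (rule integral_dominated_convergence[OF meas _ B]) (use f_int lim bd in auto)
  then show ?thesis
    by (simp add: f_int(2) LIMSEQ_const_iff)
qed

text \<open>The truncation makes the weight continuous on the whole line and zero outside [-2, 2].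
  Integrals over the cube become integrals over the whole space, on which translations act.\<close>

definition semic :: "real \<Rightarrow> real" where
  "semic u = sqrt (max 0 (4 - u\<^sup>2))"

lemma semic_eq: "\<bar>u\<bar> \<le> 2 \<Longrightarrow> semic u = sqrt (4 - u\<^sup>2)"
  by (simp add: semic_def max_def abs_le_square_iff[of u 2, simplified])

lemma semic_nonneg [simp]: "semic u \<ge> 0"
  by (simp add: semic_def)

lemma semic_eq_0_iff: "semic u = 0 \<longleftrightarrow> \<bar>u\<bar> \<ge> 2"
  using abs_le_square_iff[of 2 u] by (auto simp: semic_def max_def)

lemma continuous_on_semic [continuous_intros]:
  "continuous_on A f \<Longrightarrow> continuous_on A (\<lambda>x. semic (f x))"
  unfolding semic_def by (intro continuous_intros)

text \<open>The function is the positive part of \<open>v\<close> raised to the power 3/2. The extra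
  factor \<open>v\<close> repairs the failure of \<open>sqrt (max 0 v)\<close> to be differentiable
  at 0.\<close>

lemma has_real_derivative_max_sqrt:
  "((\<lambda>v::real. v * sqrt (max 0 v)) has_real_derivative 3 / 2 * sqrt (max 0 u)) (at u)"
proof (cases u "0::real" rule: linorder_cases)
  case less
  have "((\<lambda>v::real. 0) has_real_derivative 0) (at u)" by simp
  then have "((\<lambda>v::real. v * sqrt (max 0 v)) has_real_derivative 0) (at u)"
    by (rule has_field_derivative_transform_within_open[of _ _ _ "{..<0}"]) (use less in auto)
  with less show ?thesis by simp
next
  case equal
  have "((\<lambda>v. sqrt (max 0 v)) \<longlongrightarrow> sqrt (max 0 0)) (at (0::real))"
    by (intro tendsto_intros)
  then have "((\<lambda>v. sqrt (max 0 v)) \<longlongrightarrow> 0) (at (0::real))" by simp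
  then have "((\<lambda>h. (h * sqrt (max 0 h) - 0) / h) \<longlongrightarrow> 0) (at (0::real))"
    by (rule Lim_transform_eventually) (auto simp: eventually_at_filter)
  then show ?thesis using equal by (simp add: has_field_derivative_iff)
next
  case greater
  have "((\<lambda>v::real. v * sqrt v) has_real_derivative (u * (inverse (sqrt u) / 2) + sqrt u)) (at u)"
    using greater by (auto intro!: derivative_eq_intros)
  moreover have "u * (inverse (sqrt u) / 2) + sqrt u = 3 / 2 * sqrt u"
    using greater by (simp add: field_simps)
  ultimately have "((\<lambda>v::real. v * sqrt v) has_real_derivative 3 / 2 * sqrt u) (at u)" by simp
  then have "((\<lambda>v::real. v * sqrt (max 0 v)) has_real_derivative 3 / 2 * sqrt u) (at u)"
    by (rule has_field_derivative_transform_within_open[of _ _ _ "{0<..}"]) (use greater in auto)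
  with greater show ?thesis by simp
qed

text \<open>Valid at \<open>u = 2\<close> and \<open>u = - 2\<close> too: this is what lets
  integration by parts proceed without boundary terms.\<close>

lemma has_real_derivative_semic:
  "((\<lambda>u. (4 - u\<^sup>2) * semic u) has_real_derivative - 3 * u * semic u) (at u)"
proof -
  have "((\<lambda>u. 4 - u\<^sup>2) has_real_derivative - 2 * u) (at u)"
    by (auto intro!: derivative_eq_intros)
  from DERIV_chain2[OF has_real_derivative_max_sqrt this]
  have "((\<lambda>u. (4 - u\<^sup>2) * sqrt (max 0 (4 - u\<^sup>2))) has_real_derivative
      3 / 2 * sqrt (max 0 (4 - u\<^sup>2)) * (- 2 * u)) (at u)" .
  then show ?thesis
    unfolding semic_def by (rule DERIV_cong) simp
qed

definition semics :: "real ^ 'n \<Rightarrow> real" where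
  "semics y = (\<Prod>i\<in>UNIV. semic (y $ i))"

lemma semics_nonneg [simp]: "semics y \<ge> 0"
  by (simp add: semics_def prod_nonneg)

lemma continuous_on_semics [continuous_intros]: "continuous_on A semics"
  unfolding semics_def by (intro continuous_intros)

definition cube :: "(real ^ 'n) set" where
  "cube = {y. \<forall>i. \<bar>y $ i\<bar> \<le> 2}"

lemma cube_eq_cbox: "cube = cbox (- vec 2) (vec 2)"
  by (auto simp: cube_def mem_box_cart abs_le_iff minus_le_iff)

lemma compact_cube: "compact cube"
  by (simp add: cube_eq_cbox)

lemma semics_outside: "y \<notin> cube \<Longrightarrow> semics y = 0"
  unfolding cube_def semics_def
  by (auto simp: not_le semic_eq_0_iff intro: less_imp_le)

lemma integrable_semics:
  assumes "continuous_on UNIV F"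
  shows "integrable lborel (\<lambda>y. F y * semics y)"
proof -
  have "continuous_on cube (\<lambda>y. F y * semics y)"
    by (intro continuous_intros continuous_on_subset[OF assms]) auto
  from borel_integrable_compact[OF compact_cube this]
  show ?thesis
    by (rule Bochner_Integration.integrable_cong[THEN iffD1, rotated 2])
       (auto simp: indicator_def semics_outside)
qed

lemma semics_translate:
  "semics (y + s *\<^sub>R axis i 1) = semic (y $ i + s) * (\<Prod>j\<in>UNIV - {i}. semic (y $ j))"
  unfolding semics_def by (subst prod.remove[of _ i]) (auto simp: axis_def intro!: prod.cong)

text \<open>The integrand is the partial derivative in direction \<open>i\<close> of
  \<open>(4 - (y $ i)\<^sup>2) * F y * semics y\<close>, a function of compact support that is
  differentiable along the \<open>i\<close>-th axis everywhere.\<close>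

lemma integral_semics_by_parts:
  fixes F DF :: "real ^ 'n \<Rightarrow> real"
  assumes F: "continuous_on UNIV F" and DF: "continuous_on UNIV DF"
    and der: "\<And>y. ((\<lambda>s. F (y + s *\<^sub>R axis i 1)) has_real_derivative DF y) (at 0)"
  shows "(\<integral>y. ((4 - (y $ i)\<^sup>2) * DF y - 3 * y $ i * F y) * semics y \<partial>lborel) = 0"
proof -
  let ?e = "axis i 1 :: real ^ 'n"
  define G where "G y = (4 - (y $ i)\<^sup>2) * DF y - 3 * y $ i * F y" for y
  have Gc: "continuous_on UNIV G"
    unfolding G_def by (intro continuous_intros F DF)
  define H where "H s y = (4 - ((y + s *\<^sub>R ?e) $ i)\<^sup>2) * F (y + s *\<^sub>R ?e) * semics (y + s *\<^sub>R ?e)" for s y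
  define D where "D s y = G (y + s *\<^sub>R ?e) * semics (y + s *\<^sub>R ?e)" for s y
  have der': "((\<lambda>s. F (y + s *\<^sub>R ?e)) has_real_derivative DF (y + s *\<^sub>R ?e)) (at s)" for s y
    using der[of "y + s *\<^sub>R ?e"] DERIV_shift[of "\<lambda>s. F (y + s *\<^sub>R ?e)" _ 0 s]
    by (simp add: algebra_simps)
  have derH: "((\<lambda>s. H s y) has_real_derivative D s y) (at s)" for s y
  proof -
    let ?P = "\<Prod>j\<in>UNIV - {i}. semic (y $ j)" and ?u = "y $ i + s"
    have 1: "((\<lambda>s. (4 - (y $ i + s)\<^sup>2) * semic (y $ i + s)) has_real_derivative - 3 * ?u * semic ?u) (at s)"
    proof -
      have "((\<lambda>s. y $ i + s) has_real_derivative 1) (at s)"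
        by (auto intro!: derivative_eq_intros)
      from DERIV_chain2[OF has_real_derivative_semic this] show ?thesis by simp
    qed
    have "((\<lambda>s. ((4 - (y $ i + s)\<^sup>2) * semic (y $ i + s)) * F (y + s *\<^sub>R ?e) * ?P)
       has_real_derivative ((- 3 * ?u * semic ?u) * F (y + s *\<^sub>R ?e)
           + DF (y + s *\<^sub>R ?e) * ((4 - ?u\<^sup>2) * semic ?u)) * ?P) (at s)"
      by (intro DERIV_cmult_right DERIV_mult 1 der')
    moreover have "(y + s *\<^sub>R ?e) $ i = y $ i + s" for s by simp
    ultimately show ?thesis
      unfolding H_def D_def G_def semics_translate by (simp add: algebra_simps)
  qed
  have Gi: "integrable lborel (\<lambda>y. G y * semics y)" by (rule integrable_semics[OF Gc])
  have H0: "integrable lborel (\<lambda>y. (4 - (y $ i)\<^sup>2) * F y * semics y)"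
    by (intro integrable_semics continuous_intros F)
  have shift: "integrable lborel (\<lambda>y. f (y + a))" "(\<integral>y. f (y + a) \<partial>lborel) = (\<integral>y. f y \<partial>lborel)"
    if "integrable lborel f" for f :: "real ^ 'n \<Rightarrow> real" and a
  proof -
    have m: "f \<in> borel_measurable borel" using that by auto
    have i: "integrable (distr lborel borel ((+) a)) f"
      using that by (subst lborel_distr_plus)
    show "integrable lborel (\<lambda>y. f (y + a))"
      using integrable_distr_eq[of "(+) a" lborel borel f] i m by (simp add: add.commute)
    have "(\<integral>y. f y \<partial>lborel) = (\<integral>y. f y \<partial>(distr lborel borel ((+) a)))"
      by (subst lborel_distr_plus) simp
    also have "\<dots> = (\<integral>y. f (a + y) \<partial>lborel)"
      using m by (subst integral_distr) auto
    finally show "(\<integral>y. f (y + a) \<partial>lborel) = (\<integral>y. f y \<partial>lborel)"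
      by (simp add: add.commute)
  qed
  obtain B where B: "\<And>y. \<bar>G y * semics y\<bar> \<le> B"
  proof -
    have "compact ((\<lambda>y. G y * semics y) ` cube)"
      by (intro compact_continuous_image continuous_intros continuous_on_subset[OF Gc] compact_cube) auto
    from compact_imp_bounded[OF this] obtain b
      where b: "\<And>y. y \<in> cube \<Longrightarrow> \<bar>G y * semics y\<bar> \<le> b"
      unfolding bounded_iff by fastforce
    have "\<bar>G y * semics y\<bar> \<le> max 0 b" for y
      using b[of y] semics_outside[of y] by (cases "y \<in> cube") auto
    then show ?thesis using that by blast
  qed
  \<comment> \<open>The support of \<open>semics\<close> has half-width 2. A translation by at most
    1 keeps it inside half-width 3, which gives one dominating function for all \<open>s\<close> in
    [0, 1].\<close>
  let ?K = "cbox (- vec 3) (vec 3) :: (real ^ 'n) set"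
  have bound: "\<bar>D s y\<bar> \<le> B * indicator ?K y" if "s \<in> {0..1}" for s y
  proof (cases "y \<in> ?K")
    case True then show ?thesis using B by (simp add: D_def)
  next
    case False
    then obtain j where "\<not> (- 3 \<le> y $ j \<and> y $ j \<le> 3)"
      by (auto simp: mem_box_cart)
    then have j: "\<bar>y $ j\<bar> > 3" by linarith
    have "\<bar>(y + s *\<^sub>R ?e) $ j\<bar> > 2" using j that by (auto simp: axis_def)
    then have "y + s *\<^sub>R ?e \<notin> cube" unfolding cube_def by (auto intro!: exI[of _ j] simp: not_le)
    with False show ?thesis by (simp add: D_def semics_outside)
  qed
  have "integral\<^sup>L lborel (D 0) = 0"
  proof (rule integral_flow_derivative_zero[where H = H and B = "\<lambda>y. B * indicator ?K y"])
    show "integrable lborel (\<lambda>y. B * indicator ?K y)"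
      using emeasure_lborel_cbox_finite[of "- vec 3 :: real ^ 'n" "vec 3"] by (intro integrable_mult_right integrable_real_indicator) (auto simp: less_top)
    show "integrable lborel (H s)" for s
      unfolding H_def using shift(1)[OF H0, of "s *\<^sub>R ?e"] by simp
    show "integral\<^sup>L lborel (H s) = integral\<^sup>L lborel (H 0)" for s
      unfolding H_def using shift(2)[OF H0, of "s *\<^sub>R ?e"] shift(2)[OF H0, of 0] by simp
  qed (use derH bound in auto)
  then show ?thesis by (simp add: D_def[abs_def] G_def)
qed

section \<open>Power sums and the loop polynomials\<close>

abbreviation mon :: "(nat \<Rightarrow> real) \<Rightarrow> nat list \<Rightarrow> real" where
  "mon q ks \<equiv> prod_list (map q ks)"

text \<open>The derivation that sends the variable q_k to \<open>d k\<close>, applied to a monomial.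
  It is formal in \<open>q\<close> and \<open>d\<close>, so that the same expression serves on the
  group and on the cube.\<close>

primrec dmon :: "(nat \<Rightarrow> real) \<Rightarrow> (nat \<Rightarrow> real) \<Rightarrow> nat list \<Rightarrow> real" where
  "dmon d q [] = 0"
| "dmon d q (k # ks) = d k * mon q ks + q k * dmon d q ks"

definition dele :: "nat \<Rightarrow> 'a list \<Rightarrow> 'a list" where
  "dele i ks = take i ks @ drop (Suc i) ks"

lemma dmon_eq_sum: "dmon d q ks = (\<Sum>i<length ks. d (ks ! i) * mon q (dele i ks))"
  by (induction ks)
     (simp_all add: sum.lessThan_Suc_shift dele_def sum_distrib_left ac_simps del: sum.lessThan_Suc)

lemma dmon_sum: "dmon (\<lambda>l. \<Sum>j\<in>A. c j * d j l) q ks = (\<Sum>j\<in>A. c j * dmon (d j) q ks)"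
  by (induction ks) (simp_all add: sum_distrib_left sum_distrib_right sum.distrib algebra_simps)

lemma sum_list_dele: "i < length ks \<Longrightarrow> ks ! i + sum_list (dele i ks) = sum_list (ks :: nat list)"
  unfolding dele_def by (subst (3) id_take_nth_drop[of i ks]) simp_all

lemma has_real_derivative_mon:
  assumes "\<And>k. ((\<lambda>s. q s k) has_real_derivative d k) (at s0)"
  shows "((\<lambda>s. mon (q s) ks) has_real_derivative dmon d (q s0) ks) (at s0)"
  by (induction ks) (auto intro!: derivative_eq_intros assms simp: algebra_simps)

definition psum :: "nat \<Rightarrow> real ^ 'n \<Rightarrow> real" where
  "psum k y = (\<Sum>i\<in>UNIV. (y $ i) ^ k)"

lemma continuous_on_psum [continuous_intros]: "continuous_on A (psum k)"
  unfolding psum_def by (intro continuous_intros)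

lemma continuous_on_mon [continuous_intros]:
  "(\<And>k. continuous_on A (\<lambda>y. q y k)) \<Longrightarrow> continuous_on A (\<lambda>y. mon (q y) ks)"
  by (induction ks) (auto intro!: continuous_intros)

lemma continuous_on_dmon [continuous_intros]:
  "(\<And>k. continuous_on A (\<lambda>y. q y k)) \<Longrightarrow> (\<And>k. continuous_on A (\<lambda>y. d y k)) \<Longrightarrow>
    continuous_on A (\<lambda>y. dmon (d y) (q y) ks)"
  by (induction ks) (auto intro!: continuous_intros)

lemma has_real_derivative_psum:
  "((\<lambda>s. psum k (y + s *\<^sub>R axis j 1)) has_real_derivative real k * (y $ j) ^ (k - 1)) (at 0)"
proof -
  have "((\<lambda>s. psum k (y + s *\<^sub>R axis j 1)) has_real_derivative
      (\<Sum>i\<in>UNIV. real k * (y $ i + 0 * axis j 1 $ i) ^ (k - 1) * axis j 1 $ i)) (at 0)"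
    unfolding psum_def by (auto intro!: derivative_eq_intros sum.cong)
  moreover have "(\<Sum>i\<in>UNIV. real k * (y $ i + 0 * axis j 1 $ i) ^ (k - 1) * axis j 1 $ i)
      = real k * (y $ j) ^ (k - 1)"
    by (subst sum.remove[of _ j]) (auto simp: axis_def)
  ultimately show ?thesis by simp
qed

section \<open>The Vandermonde product and its logarithmic derivative\<close>

definition vdm :: "real ^ 'n::{finite,linorder} \<Rightarrow> real" where
  "vdm y = (\<Prod>p | fst p < snd p. y $ snd p - y $ fst p)"

text \<open>The product rule written without division, so that it remains correct where coordinates
  coincide.\<close>

definition dvdm :: "'n \<Rightarrow> real ^ 'n::{finite,linorder} \<Rightarrow> real" where
  "dvdm j y = (\<Sum>p | fst p < snd p. (axis j 1 $ snd p - axis j 1 $ fst p) *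
      (\<Prod>r\<in>{p. fst p < snd p} - {p}. y $ snd r - y $ fst r))"

lemma continuous_on_vdm [continuous_intros]: "continuous_on A vdm"
  unfolding vdm_def by (intro continuous_intros)

lemma continuous_on_dvdm [continuous_intros]: "continuous_on A (dvdm j)"
  unfolding dvdm_def by (intro continuous_intros)

lemma has_real_derivative_vdm:
  "((\<lambda>s. vdm (y + s *\<^sub>R axis j 1)) has_real_derivative dvdm j y) (at 0)"
  unfolding vdm_def dvdm_def
  by (rule DERIV_cong, rule has_field_derivative_prod) (auto intro!: derivative_eq_intros)

lemma vdm_nonzero_iff: "vdm y \<noteq> 0 \<longleftrightarrow> (\<forall>i j. i \<noteq> j \<longrightarrow> y $ i \<noteq> y $ j)"
proof -
  have "vdm y \<noteq> 0 \<longleftrightarrow> (\<forall>i j. i < j \<longrightarrow> y $ j \<noteq> y $ i)"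
    unfolding vdm_def by (auto simp: prod_zero_iff)
  also have "\<dots> \<longleftrightarrow> (\<forall>i j. i \<noteq> j \<longrightarrow> y $ i \<noteq> y $ j)"
    by (metis neq_iff)
  finally show ?thesis .
qed

text \<open>The logarithmic derivative of the Vandermonde product. The second factor
  \<open>vdm y\<close> makes the identity hold also at coinciding coordinates, where both sides are
  0.\<close>

lemma vdm_dvdm:
  fixes y :: "real ^ 'n::{finite,linorder}"
  shows "vdm y * dvdm j y = (vdm y)\<^sup>2 * (\<Sum>l\<in>UNIV - {j}. 1 / (y $ j - y $ l))"
proof (cases "vdm y = 0")
  case False
  let ?P = "{p::'n \<times> 'n. fst p < snd p}"
  have nz: "y $ snd p - y $ fst p \<noteq> 0" if "p \<in> ?P" for p
    using False that by (auto simp: vdm_nonzero_iff)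
  have "dvdm j y = (\<Sum>p\<in>?P. (axis j 1 $ snd p - axis j 1 $ fst p) * (vdm y / (y $ snd p - y $ fst p)))"
    unfolding dvdm_def using nz by (intro sum.cong refl) (simp add: vdm_def prod.remove[of ?P])
  also have "\<dots> = vdm y * (\<Sum>p\<in>?P. (axis j 1 $ snd p - axis j 1 $ fst p) / (y $ snd p - y $ fst p))"
    by (simp add: sum_distrib_left ac_simps)
  also have "(\<Sum>p\<in>?P. (axis j 1 $ snd p - axis j 1 $ fst p) / (y $ snd p - y $ fst p))
      = (\<Sum>p\<in>UNIV. if fst p < snd p then (axis j 1 $ snd p - axis j 1 $ fst p) / (y $ snd p - y $ fst p) else 0)"
    by (simp add: sum.If_cases)
  also have "\<dots> = (\<Sum>a\<in>UNIV. \<Sum>b\<in>UNIV. if a < b then (axis j 1 $ b - axis j 1 $ a) / (y $ b - y $ a) else 0)"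
    by (simp add: sum.cartesian_product case_prod_unfold del: UNIV_Times_UNIV add: UNIV_Times_UNIV[symmetric])
  \<comment> \<open>A pair contributes only if \<open>j\<close> is one of its entries. The sign of
    the axis difference turns both cases into 1 / (y_j - y_l).\<close>
  also have "\<dots> = (\<Sum>a\<in>UNIV. \<Sum>b\<in>UNIV. if a < b \<and> b = j then 1 / (y $ b - y $ a) else 0)
      + (\<Sum>a\<in>UNIV. \<Sum>b\<in>UNIV. if a < b \<and> a = j then 1 / (y $ a - y $ b) else 0)"
    unfolding sum.distrib[symmetric]
    by (intro sum.cong refl) (auto simp: axis_def minus_divide_right)
  also have "(\<Sum>a\<in>UNIV. \<Sum>b\<in>UNIV. if a < b \<and> b = j then 1 / (y $ b - y $ a) else 0)
      = (\<Sum>a\<in>UNIV. if a < j then 1 / (y $ j - y $ a) else 0)"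
    by (intro sum.cong refl) (simp add: sum.If_cases conj_commute flip: if_if_eq_conj)
  also have "(\<Sum>a\<in>UNIV. \<Sum>b\<in>UNIV. if a < b \<and> a = j then 1 / (y $ a - y $ b) else 0)
      = (\<Sum>b\<in>UNIV. if j < b then 1 / (y $ j - y $ b) else 0)"
    by (subst sum.swap, intro sum.cong refl) (simp add: conj_commute flip: if_if_eq_conj)
  also have "(\<Sum>a\<in>UNIV. if a < j then 1 / (y $ j - y $ a) else 0)
      + (\<Sum>b\<in>UNIV. if j < b then 1 / (y $ j - y $ b) else 0)
      = (\<Sum>l\<in>UNIV. if l \<noteq> j then 1 / (y $ j - y $ l) else 0)"
    unfolding sum.distrib[symmetric] by (intro sum.cong refl) auto
  also have "\<dots> = (\<Sum>l\<in>UNIV - {j}. 1 / (y $ j - y $ l))"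
    by (intro sum.mono_neutral_cong_right) auto
  finally show ?thesis by (simp add: power2_eq_square mult.assoc)
qed simp

text \<open>Exchanging \<open>j\<close> and \<open>l\<close> changes the sign of the denominator.
  Averaging the two forms of the sum replaces singular terms by divided differences, which are
  polynomials when \<open>f\<close> is a power.\<close>

lemma sum_divided_differences:
  fixes y f :: "'n::finite \<Rightarrow> real"
  shows "(\<Sum>j\<in>UNIV. f j * (\<Sum>l\<in>UNIV - {j}. 2 / (y j - y l)))
       = (\<Sum>j\<in>UNIV. \<Sum>l\<in>UNIV - {j}. (f j - f l) / (y j - y l))"
proof -
  have *: "(\<Sum>j\<in>UNIV. \<Sum>l\<in>UNIV - {j}. G j l) = (\<Sum>j\<in>UNIV. \<Sum>l\<in>UNIV. if l = j then 0 else G j l)"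
    for G :: "'n \<Rightarrow> 'n \<Rightarrow> real"
    by (intro sum.cong refl sum.mono_neutral_cong_left) auto
  have "(\<Sum>j\<in>UNIV. \<Sum>l\<in>UNIV - {j}. f l / (y j - y l)) = (\<Sum>j\<in>UNIV. \<Sum>l\<in>UNIV - {j}. f j / (y l - y j))"
    unfolding * by (subst sum.swap) (auto intro!: sum.cong)
  also have "\<dots> = - (\<Sum>j\<in>UNIV. \<Sum>l\<in>UNIV - {j}. f j / (y j - y l))"
    unfolding sum_negf[symmetric]
    by (intro sum.cong refl) (metis minus_diff_eq minus_divide_right)
  moreover have "(\<Sum>j\<in>UNIV. f j * (\<Sum>l\<in>UNIV - {j}. 2 / (y j - y l)))
      = 2 * (\<Sum>j\<in>UNIV. \<Sum>l\<in>UNIV - {j}. f j / (y j - y l))"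
    unfolding sum_distrib_left by (intro sum.cong refl) simp
  ultimately show ?thesis
    by (simp add: diff_divide_distrib sum_subtractf)
qed

text \<open>The divided difference of a power is a sum of mixed monomials. Summed over all
  \<open>j\<close> and \<open>l\<close> these factor into power sums; the diagonal, absent on the
  left, accounts for the subtracted term.\<close>

lemma sum_power_divided_differences:
  fixes y :: "real ^ 'n"
  assumes "\<And>i j. i \<noteq> j \<Longrightarrow> y $ i \<noteq> y $ j"
  shows "(\<Sum>(j::'n)\<in>UNIV. \<Sum>l\<in>UNIV - {j}. ((y $ j) ^ Suc n - (y $ l) ^ Suc n) / (y $ j - y $ l))
    = (\<Sum>i\<le>n. psum i y * psum (n - i) y) - real (Suc n) * psum n y"
proof -
  have "(\<Sum>(j::'n)\<in>UNIV. \<Sum>l\<in>UNIV - {j}. ((y $ j) ^ Suc n - (y $ l) ^ Suc n) / (y $ j - y $ l))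
      = (\<Sum>j\<in>UNIV. \<Sum>l\<in>UNIV - {j}. \<Sum>i\<le>n. (y $ j) ^ i * (y $ l) ^ (n - i))"
  proof (intro sum.cong refl)
    fix j l :: 'n assume "l \<in> UNIV - {j}"
    then have "y $ j - y $ l \<noteq> 0" using assms[of j l] by auto
    then show "((y $ j) ^ Suc n - (y $ l) ^ Suc n) / (y $ j - y $ l) = (\<Sum>i\<le>n. (y $ j) ^ i * (y $ l) ^ (n - i))"
      by (subst power_diff_sumr2) (simp_all add: lessThan_Suc_atMost mult.commute
          del: sum.lessThan_Suc sum.atMost_Suc power_Suc)
  qed
  also have "\<dots> = (\<Sum>j\<in>UNIV. (\<Sum>l\<in>UNIV. \<Sum>i\<le>n. (y $ j) ^ i * (y $ l) ^ (n - i)) - (\<Sum>i\<le>n. (y $ j) ^ i * (y $ j) ^ (n - i)))"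
    by (intro sum.cong refl) (simp add: sum_diff1)
  also have "\<dots> = (\<Sum>j\<in>UNIV. \<Sum>l\<in>UNIV. \<Sum>i\<le>n. (y $ j) ^ i * (y $ l) ^ (n - i)) - (\<Sum>j\<in>UNIV. real (Suc n) * (y $ j) ^ n)"
    by (simp add: sum_subtractf flip: power_add)
  also have "(\<Sum>j\<in>UNIV. \<Sum>l\<in>UNIV. \<Sum>i\<le>n. (y $ j) ^ i * (y $ l) ^ (n - i)) = (\<Sum>i\<le>n. psum i y * psum (n - i) y)"
  proof -
    have "(\<Sum>j\<in>UNIV. \<Sum>l\<in>UNIV. \<Sum>i\<le>n. (y $ j) ^ i * (y $ l) ^ (n - i))
        = (\<Sum>j\<in>UNIV. \<Sum>i\<le>n. \<Sum>l\<in>UNIV. (y $ j) ^ i * (y $ l) ^ (n - i))"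
      by (intro sum.cong refl sum.swap)
    also have "\<dots> = (\<Sum>i\<le>n. psum i y * psum (n - i) y)"
      unfolding psum_def sum_product by (rule sum.swap)
    finally show ?thesis .
  qed
  finally show ?thesis by (simp add: psum_def sum_distrib_left)
qed

text \<open>Up to the factor \<open>k\<close>, \<open>loop k ks q\<close> is the part of the Laplacian of \<open>q\<^sub>k \<Prod>\<^sub>l q\<^sub>l\<close> (\<open>l\<close> in \<open>ks\<close>) in
  which the first derivative falls on \<open>q\<^sub>k\<close>, where \<open>q\<^sub>k\<close> is the power sum of the eigenvalues of
  \<open>m + m\<^sup>-\<^sup>1\<close>, each counted with half its multiplicity.\<close>

definition loop :: "nat \<Rightarrow> nat list \<Rightarrow> (nat \<Rightarrow> real) \<Rightarrow> real" where
  "loop k ks q = (- (2 * q 0 + 1) * q k + (\<Sum>i<k - 1. 4 * q i * q (k - 2 - i) - q (i + 1) * q (k - 1 - i))) * mon q ks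
     + dmon (\<lambda>l. real l * (4 * q (k + l - 2) - q (k + l))) q ks"

text \<open>The components of the vector field whose divergence, weighted by \<open>semics\<close>, is the loop polynomial.\<close>

definition wfield :: "nat \<Rightarrow> nat list \<Rightarrow> 'n \<Rightarrow> real ^ 'n::{finite,linorder} \<Rightarrow> real" where
  "wfield k ks j y = (vdm y)\<^sup>2 * (y $ j) ^ (k - 1) * mon (\<lambda>l. psum l y) ks"

definition dwfield :: "nat \<Rightarrow> nat list \<Rightarrow> 'n \<Rightarrow> real ^ 'n::{finite,linorder} \<Rightarrow> real" where
  "dwfield k ks j y = 2 * (vdm y * dvdm j y) * (y $ j) ^ (k - 1) * mon (\<lambda>l. psum l y) ks
     + (vdm y)\<^sup>2 * (real (k - 1) * (y $ j) ^ (k - 2)) * mon (\<lambda>l. psum l y) ks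
     + (vdm y)\<^sup>2 * (y $ j) ^ (k - 1) * dmon (\<lambda>l. real l * (y $ j) ^ (l - 1)) (\<lambda>l. psum l y) ks"

lemma continuous_on_wfield [continuous_intros]: "continuous_on A (wfield k ks j)"
  unfolding wfield_def by (intro continuous_intros)

lemma continuous_on_dwfield [continuous_intros]: "continuous_on A (dwfield k ks j)"
  unfolding dwfield_def by (intro continuous_intros)

lemma has_real_derivative_wfield:
  "((\<lambda>s. wfield k ks j (y + s *\<^sub>R axis j 1)) has_real_derivative dwfield k ks j y) (at 0)"
proof -
  have 1: "((\<lambda>s. mon (\<lambda>l. psum l (y + s *\<^sub>R axis j 1)) ks) has_real_derivative
      dmon (\<lambda>l. real l * (y $ j) ^ (l - 1)) (\<lambda>l. psum l y) ks) (at 0)"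
    using has_real_derivative_mon[of "\<lambda>s l. psum l (y + s *\<^sub>R axis j 1)", OF has_real_derivative_psum] by simp
  have 2: "((\<lambda>s. ((y + s *\<^sub>R axis j 1) $ j) ^ (k - 1)) has_real_derivative real (k - 1) * (y $ j) ^ (k - 2)) (at 0)"
    by (auto intro!: derivative_eq_intros simp: numeral_2_eq_2)
  have 3: "((\<lambda>s. (vdm (y + s *\<^sub>R axis j 1))\<^sup>2) has_real_derivative 2 * (vdm y * dvdm j y)) (at 0)"
    by (auto intro!: derivative_eq_intros has_real_derivative_vdm)
  show ?thesis
    unfolding wfield_def dwfield_def
    by (rule DERIV_cong[OF DERIV_mult[OF DERIV_mult[OF 3 2] 1]]) (simp add: algebra_simps)
qed

text \<open>The left side comes from the divergence of \<open>wfield\<close>. Differentiating the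
  Vandermonde factor gives divided differences of (4 - x^2) x^(k-1), hence the quadratic terms of
  \<open>loop\<close>; differentiating the explicit power and the weight corrects the linear term;
  differentiating the monomial gives the \<open>dmon\<close> part.\<close>

lemma loop_pointwise:
  fixes y :: "real ^ 'n::{finite,linorder}"
  assumes "k \<ge> 1"
  shows "(\<Sum>j\<in>UNIV. (4 - (y $ j)\<^sup>2) * dwfield k ks j y - 3 * y $ j * wfield k ks j y)
       = (vdm y)\<^sup>2 * loop k ks (\<lambda>l. psum l y)"
proof (cases "vdm y = 0")
  case True
  then show ?thesis by (simp add: wfield_def dwfield_def)
next
  case False
  then have inj: "\<And>i j. i \<noteq> j \<Longrightarrow> y $ i \<noteq> y $ j" by (simp add: vdm_nonzero_iff)
  obtain m where k: "k = Suc m" using assms by (cases k) auto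
  let ?V = "(vdm y)\<^sup>2" and ?q = "\<lambda>l. psum l y" and ?M = "mon (\<lambda>l. psum l y) ks"
  let ?d = "\<lambda>j. dmon (\<lambda>l. real l * (y $ j) ^ (l - 1)) ?q ks"
  let ?f = "\<lambda>j. (4 - (y $ j)\<^sup>2) * (y $ j) ^ m"
  define S1 where "S1 = (\<Sum>j\<in>UNIV. ?f j * (\<Sum>l\<in>UNIV - {j}. 2 / (y $ j - y $ l)))"
  define S2 where "S2 = (\<Sum>j\<in>UNIV. (4 - (y $ j)\<^sup>2) * (real m * (y $ j) ^ (m - 1)))"
  define S3 where "S3 = (\<Sum>j\<in>UNIV. ?f j * ?d j)"
  have "(4 - (y $ j)\<^sup>2) * dwfield k ks j y - 3 * y $ j * wfield k ks j y
      = ?V * (?M * (?f j * (\<Sum>l\<in>UNIV - {j}. 2 / (y $ j - y $ l)))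
          + ?M * ((4 - (y $ j)\<^sup>2) * (real m * (y $ j) ^ (m - 1))) + ?f j * ?d j - ?M * (3 * (y $ j) ^ k))" for j
  proof -
    have "(\<Sum>l\<in>UNIV - {j}. 2 / (y $ j - y $ l)) = 2 * (\<Sum>l\<in>UNIV - {j}. 1 / (y $ j - y $ l))"
      by (simp add: sum_distrib_left)
    then show ?thesis
      unfolding dwfield_def wfield_def vdm_dvdm k
      by (simp add: algebra_simps)
  qed
  then have LHS: "(\<Sum>j\<in>UNIV. (4 - (y $ j)\<^sup>2) * dwfield k ks j y - 3 * y $ j * wfield k ks j y)
     = ?V * (?M * S1 + ?M * S2 + S3 - ?M * (3 * ?q k))"
    by (simp add: S1_def S2_def S3_def psum_def sum.distrib sum_subtractf flip: sum_distrib_left)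
  have S3: "S3 = dmon (\<lambda>l. real l * (4 * ?q (k + l - 2) - ?q (k + l))) ?q ks"
  proof -
    have "(\<Sum>j\<in>UNIV. ?f j * (real l * (y $ j) ^ (l - 1))) = real l * (4 * ?q (k + l - 2) - ?q (k + l))" for l
    proof (cases l)
      case (Suc l')
      have "?f j * (real l * (y $ j) ^ (l - 1)) = real l * (4 * (y $ j) ^ (k + l - 2) - (y $ j) ^ (k + l))" for j
        by (simp add: Suc k algebra_simps power_add power2_eq_square)
      then have "(\<Sum>j\<in>UNIV. ?f j * (real l * (y $ j) ^ (l - 1)))
          = (\<Sum>j\<in>UNIV. real l * (4 * (y $ j) ^ (k + l - 2) - (y $ j) ^ (k + l)))"
        by (rule sum.cong[OF refl])
      then show ?thesis
        unfolding psum_def by (simp add: sum_subtractf flip: sum_distrib_left)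
    qed simp
    then show ?thesis unfolding S3_def by (simp flip: dmon_sum)
  qed
  \<comment> \<open>For \<open>m = 0\<close> the truncated \<open>m - 1\<close> is harmless because
    of the factor \<open>real m\<close>.\<close>
  have S2: "S2 = real m * (4 * ?q (m - 1) - ?q k)"
  proof (cases m)
    case (Suc m')
    have "(4 - (y $ j)\<^sup>2) * (real m * (y $ j) ^ (m - 1)) = real m * (4 * (y $ j) ^ (m - 1) - (y $ j) ^ k)" for j
      by (simp add: Suc k algebra_simps power_add power2_eq_square)
    then have "S2 = (\<Sum>j\<in>UNIV. real m * (4 * (y $ j) ^ (m - 1) - (y $ j) ^ k))"
      unfolding S2_def by (rule sum.cong[OF refl])
    then show ?thesis
      unfolding psum_def by (simp add: sum_subtractf flip: sum_distrib_left)
  qed (simp add: S2_def)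
  have T: "(\<Sum>j\<in>UNIV. \<Sum>l\<in>UNIV - {j}. ((y $ j) ^ m - (y $ l) ^ m) / (y $ j - y $ l))
      = (\<Sum>i<m. ?q i * ?q (m - 1 - i)) - real m * ?q (m - 1)"
    using sum_power_divided_differences[of y "m - 1", OF inj] by (cases m) (simp_all add: lessThan_Suc_atMost)
  have T2: "(\<Sum>j\<in>UNIV. \<Sum>l\<in>UNIV - {j}. ((y $ j) ^ (m + 2) - (y $ l) ^ (m + 2)) / (y $ j - y $ l))
      = 2 * ?q 0 * ?q k + (\<Sum>i<m. ?q (i + 1) * ?q (m - i)) - real (m + 2) * ?q k"
  proof -
    have "(\<Sum>i\<le>Suc m. ?q i * ?q (Suc m - i)) = ?q 0 * ?q (Suc m) + (\<Sum>i\<le>m. ?q (Suc i) * ?q (m - i))"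
      by (subst sum.atMost_Suc_shift) simp
    also have "(\<Sum>i\<le>m. ?q (Suc i) * ?q (m - i)) = (\<Sum>i<m. ?q (Suc i) * ?q (m - i)) + ?q (Suc m) * ?q 0"
      by (simp flip: lessThan_Suc_atMost)
    finally show ?thesis
      using sum_power_divided_differences[of y "Suc m", OF inj] by (simp add: k)
  qed
  have "S1 = (\<Sum>j\<in>UNIV. \<Sum>l\<in>UNIV - {j}. (?f j - ?f l) / (y $ j - y $ l))"
    unfolding S1_def by (rule sum_divided_differences)
  also have "\<dots> = 4 * (\<Sum>j\<in>UNIV. \<Sum>l\<in>UNIV - {j}. ((y $ j) ^ m - (y $ l) ^ m) / (y $ j - y $ l))
      - (\<Sum>j\<in>UNIV. \<Sum>l\<in>UNIV - {j}. ((y $ j) ^ (m + 2) - (y $ l) ^ (m + 2)) / (y $ j - y $ l))"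
    unfolding sum_distrib_left sum_subtractf[symmetric]
    by (intro sum.cong refl) (simp add: diff_divide_distrib add_divide_distrib algebra_simps power_add power2_eq_square)
  finally have S1: "S1 = 4 * ((\<Sum>i<m. ?q i * ?q (m - 1 - i)) - real m * ?q (m - 1))
      - (2 * ?q 0 * ?q k + (\<Sum>i<m. ?q (i + 1) * ?q (m - i)) - real (m + 2) * ?q k)"
    unfolding T T2 .
  \<comment> \<open>The terms 4 m q_(m-1) cancel, and q_k keeps the coefficient (m + 2) - m - 3 = -1
    besides -2 q_0.\<close>
  have "S1 + S2 - 3 * ?q k = - (2 * ?q 0 + 1) * ?q k + (4 * (\<Sum>i<m. ?q i * ?q (m - 1 - i)) - (\<Sum>i<m. ?q (i + 1) * ?q (m - i)))"
    unfolding S1 S2 by (simp add: algebra_simps)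
  also have "\<dots> = - (2 * ?q 0 + 1) * ?q k + (\<Sum>i<k - 1. 4 * ?q i * ?q (k - 2 - i) - ?q (i + 1) * ?q (k - 1 - i))"
    by (simp add: k sum_subtractf sum_distrib_left mult.assoc)
  finally have loop: "loop k ks ?q = (S1 + S2 - 3 * ?q k) * ?M + S3"
    unfolding loop_def S3 by simp
  then show ?thesis
    unfolding LHS loop by (simp add: algebra_simps)
qed

definition lap :: "nat list \<Rightarrow> (nat \<Rightarrow> real) \<Rightarrow> real" where
  "lap ks q = (\<Sum>i<length ks. real (ks ! i) * loop (ks ! i) (dele i ks) q)"

lemma continuous_on_loop [continuous_intros]:
  "(\<And>k. continuous_on A (\<lambda>y. q y k)) \<Longrightarrow> continuous_on A (\<lambda>y. loop k ks (q y))"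
  unfolding loop_def by (intro continuous_intros)

lemma continuous_on_lap [continuous_intros]:
  "(\<And>k. continuous_on A (\<lambda>y. q y k)) \<Longrightarrow> continuous_on A (\<lambda>y. lap ks (q y))"
  unfolding lap_def by (intro continuous_intros)

definition dpsum :: "'n \<Rightarrow> real ^ 'n \<Rightarrow> nat \<Rightarrow> real" where
  "dpsum j y l = real l * (y $ j) ^ (l - 1)"

lemma continuous_on_dpsum [continuous_intros]: "continuous_on A (\<lambda>y. dpsum j y l)"
  unfolding dpsum_def by (intro continuous_intros)

abbreviation psums :: "real ^ 'n \<Rightarrow> nat \<Rightarrow> real" where
  "psums y \<equiv> (\<lambda>l. psum l y)"

text \<open>Green's identity: \<open>lap\<close> is the radial part of the Laplacian of the group, a divergence with
  respect to the Weyl weight.\<close>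

lemma weyl_dirichlet:
  fixes B :: "nat list set" and c :: "nat list \<Rightarrow> real"
  defines "R \<equiv> \<lambda>y :: real ^ 'n::{finite,linorder}. \<Sum>ks\<in>B. c ks * mon (psums y) ks"
    and "dR \<equiv> \<lambda>(j::'n) (y::(real, 'n) vec). \<Sum>ks\<in>B. c ks * dmon (dpsum j y) (psums y) ks"
    and "lapR \<equiv> \<lambda>y::(real, 'n) vec. \<Sum>ks\<in>B. c ks * lap ks (psums y)"
  assumes B: "\<And>ks. ks \<in> B \<Longrightarrow> 0 \<notin> set ks"
  shows "(\<integral>y. lapR y * R y * (vdm y)\<^sup>2 * semics y \<partial>lborel)
       = - (\<integral>y. (\<Sum>j\<in>UNIV. (4 - (y $ j)\<^sup>2) * (dR j y)\<^sup>2) * (vdm y)\<^sup>2 * semics y \<partial>lborel)"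
proof -
  define F where "F j y = (\<Sum>ks\<in>B. c ks * (\<Sum>i<length ks. real (ks ! i) * wfield (ks ! i) (dele i ks) j y))" for j and y :: "(real, 'n) vec"
  define G where "G j y = (\<Sum>ks\<in>B. c ks * (\<Sum>i<length ks. real (ks ! i) * dwfield (ks ! i) (dele i ks) j y))" for j and y :: "(real, 'n) vec"
  have Fc: "continuous_on UNIV (F j)" and Gc: "continuous_on UNIV (G j)" for j
    unfolding F_def G_def by (intro continuous_intros)+
  have Rc: "continuous_on UNIV R" and dRc: "continuous_on UNIV (dR j)" and lapRc: "continuous_on UNIV lapR" for j
    unfolding R_def dR_def lapR_def by (intro continuous_intros)+
  have F: "F j y = (vdm y)\<^sup>2 * dR j y" for j y
    unfolding F_def dR_def wfield_def dmon_eq_sum dpsum_def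
    by (simp add: sum_distrib_left ac_simps)
  have derF: "((\<lambda>s. F j (y + s *\<^sub>R axis j 1)) has_real_derivative G j y) (at 0)" for j y
    unfolding F_def G_def by (intro DERIV_sum DERIV_cmult has_real_derivative_wfield)
  have derR: "((\<lambda>s. R (y + s *\<^sub>R axis j 1)) has_real_derivative dR j y) (at 0)" for j y
    unfolding R_def dR_def dpsum_def
    using has_real_derivative_mon[of "\<lambda>s l. psum l (y + s *\<^sub>R axis j 1)", OF has_real_derivative_psum]
    by (intro DERIV_sum DERIV_cmult) simp
  have derFR: "((\<lambda>s. F j (y + s *\<^sub>R axis j 1) * R (y + s *\<^sub>R axis j 1)) has_real_derivative
      G j y * R y + dR j y * F j y) (at 0)" for j y
    by (rule DERIV_cong[OF DERIV_mult[OF derF derR]]) simp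
  \<comment> \<open>Integration by parts is applied to the product of \<open>F j\<close> and
    \<open>R\<close>: the derivative of \<open>F j\<close> leads to the Laplacian of
    \<open>R\<close>, that of \<open>R\<close> to the Dirichlet integral.\<close>
  have I0: "(\<integral>y. ((4 - (y $ j)\<^sup>2) * (G j y * R y + dR j y * F j y) - 3 * y $ j * (F j y * R y)) * semics y \<partial>lborel) = 0" for j
    by (intro integral_semics_by_parts continuous_intros Fc Gc Rc dRc derFR)
  have lapV: "(\<Sum>j\<in>UNIV. (4 - (y $ j)\<^sup>2) * G j y - 3 * y $ j * F j y) = (vdm y)\<^sup>2 * lapR y" for y
  proof -
    have "(\<Sum>j\<in>UNIV. (4 - (y $ j)\<^sup>2) * G j y - 3 * y $ j * F j y)
        = (\<Sum>ks\<in>B. c ks * (\<Sum>i<length ks. real (ks ! i) *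
            (\<Sum>j\<in>UNIV. (4 - (y $ j)\<^sup>2) * dwfield (ks ! i) (dele i ks) j y - 3 * y $ j * wfield (ks ! i) (dele i ks) j y)))"
      unfolding F_def G_def sum_distrib_left sum_subtractf[symmetric]
      by (subst sum.swap, intro sum.cong refl, subst sum.swap, intro sum.cong refl) (simp add: algebra_simps)
    also have "\<dots> = (\<Sum>ks\<in>B. c ks * (\<Sum>i<length ks. real (ks ! i) * ((vdm y)\<^sup>2 * loop (ks ! i) (dele i ks) (psums y))))"
    proof (intro sum.cong refl arg_cong2[where f = "(*)"] loop_pointwise)
      fix ks i assume "ks \<in> B" "i \<in> {..<length ks}"
      then have "ks ! i \<noteq> 0" using B[of ks] nth_mem[of i ks] by (metis lessThan_iff)
      then show "1 \<le> ks ! i" by simp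
    qed
    also have "\<dots> = (vdm y)\<^sup>2 * lapR y"
      unfolding lapR_def lap_def by (simp add: sum_distrib_left ac_simps)
    finally show ?thesis .
  qed
  have int: "integrable lborel (\<lambda>y. ((4 - (y $ j)\<^sup>2) * (G j y * R y + dR j y * F j y) - 3 * y $ j * (F j y * R y)) * semics y)" for j
    by (intro integrable_semics continuous_intros Fc Gc Rc dRc)
  have "0 = (\<integral>y. (\<Sum>j\<in>UNIV. ((4 - (y $ j)\<^sup>2) * (G j y * R y + dR j y * F j y) - 3 * y $ j * (F j y * R y)) * semics y) \<partial>lborel)"
    by (subst Bochner_Integration.integral_sum) (use int I0 in auto)
  also have "\<dots> = (\<integral>y. (lapR y * R y * (vdm y)\<^sup>2) * semics y
        + ((\<Sum>j\<in>UNIV. (4 - (y $ j)\<^sup>2) * (dR j y)\<^sup>2) * (vdm y)\<^sup>2) * semics y \<partial>lborel)"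
  proof (intro Bochner_Integration.integral_cong refl)
    fix y :: "(real, 'n) vec"
    have "(\<Sum>j\<in>UNIV. ((4 - (y $ j)\<^sup>2) * (G j y * R y + dR j y * F j y) - 3 * y $ j * (F j y * R y)) * semics y)
       = (\<Sum>j\<in>UNIV. (4 - (y $ j)\<^sup>2) * G j y - 3 * y $ j * F j y) * (R y * semics y)
         + (\<Sum>j\<in>UNIV. (4 - (y $ j)\<^sup>2) * (dR j y)\<^sup>2) * ((vdm y)\<^sup>2 * semics y)"
      unfolding sum_distrib_right sum.distrib[symmetric]
      by (intro sum.cong refl) (simp add: F algebra_simps power2_eq_square)
    then show "(\<Sum>j\<in>UNIV. ((4 - (y $ j)\<^sup>2) * (G j y * R y + dR j y * F j y) - 3 * y $ j * (F j y * R y)) * semics y)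
       = (lapR y * R y * (vdm y)\<^sup>2) * semics y
        + ((\<Sum>j\<in>UNIV. (4 - (y $ j)\<^sup>2) * (dR j y)\<^sup>2) * (vdm y)\<^sup>2) * semics y"
      unfolding lapV by (simp add: ac_simps)
  qed
  also have "\<dots> = (\<integral>y. lapR y * R y * (vdm y)\<^sup>2 * semics y \<partial>lborel)
      + (\<integral>y. (\<Sum>j\<in>UNIV. (4 - (y $ j)\<^sup>2) * (dR j y)\<^sup>2) * (vdm y)\<^sup>2 * semics y \<partial>lborel)"
    by (intro Bochner_Integration.integral_add integrable_semics continuous_intros Rc dRc lapRc)
  finally show ?thesis by linarith
qed

section \<open>Points where the Weyl weight is positive\<close>

lemma exists_vdm_nonzero: "\<exists>p :: real ^ 'n::{finite,linorder}. (\<forall>i. \<bar>p $ i\<bar> < 2) \<and> vdm p \<noteq> 0"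
proof -
  define p :: "(real, 'n) vec" where "p = (\<chi> i. 1 / (1 + real (to_nat_on (UNIV :: 'n set) i)))"
  have inj: "to_nat_on (UNIV :: 'n set) i = to_nat_on UNIV j \<longleftrightarrow> i = j" for i j :: 'n
    by (simp add: countable_finite)
  have "vdm p \<noteq> 0"
    unfolding vdm_nonzero_iff by (auto simp: p_def inj)
  moreover have "\<bar>p $ i\<bar> < 2" for i
  proof -
    have "1 / (1 + real (to_nat_on (UNIV :: 'n set) i)) \<le> 1" by simp
    then have "1 / (1 + real (to_nat_on (UNIV :: 'n set) i)) < 2" by linarith
    then show ?thesis by (simp add: p_def)
  qed
  ultimately show ?thesis by blast
qed

text \<open>Move from \<open>y\<close> straight towards a point \<open>p\<close> of the open cube
  with distinct coordinates. Right after the start all coordinates are distinct: a pair that is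
  equal at \<open>y\<close> is separated by \<open>p\<close>, and a pair that differs at
  \<open>y\<close> still differs nearby.\<close>

lemma cube_dense:
  fixes h :: "real ^ 'n::{finite,linorder} \<Rightarrow> real"
  assumes h: "continuous_on UNIV h"
    and zero: "\<And>y. (\<And>i. \<bar>y $ i\<bar> < 2) \<Longrightarrow> vdm y \<noteq> 0 \<Longrightarrow> h y = 0"
    and y: "y \<in> cube"
  shows "h y = 0"
proof -
  obtain p :: "(real, 'n) vec" where p: "\<And>i. \<bar>p $ i\<bar> < 2" "vdm p \<noteq> 0"
    using exists_vdm_nonzero by blast
  define z where "z s = y + s *\<^sub>R (p - y)" for s
  have lim: "((\<lambda>s. h (z s)) \<longlongrightarrow> h y) (at_right 0)"
  proof -
    have "continuous_on UNIV (\<lambda>s. h (z s))"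
      unfolding z_def by (intro continuous_on_compose2[OF h] continuous_intros) auto
    then have "isCont (\<lambda>s. h (z s)) 0" by (simp add: continuous_on_eq_continuous_at)
    then show ?thesis
      by (simp add: isCont_def z_def filterlim_at_split)
  qed
  have ev1: "eventually (\<lambda>s. \<forall>i. \<bar>z s $ i\<bar> < 2) (at_right 0)"
  proof -
    have "\<bar>z s $ i\<bar> < 2" if "0 < s" "s < 1" for s i
    proof -
      have "\<bar>z s $ i\<bar> = \<bar>(1 - s) * (y $ i) + s * (p $ i)\<bar>" by (simp add: z_def algebra_simps)
      also have "\<dots> \<le> (1 - s) * \<bar>y $ i\<bar> + s * \<bar>p $ i\<bar>"
        using that by (intro order_trans[OF abs_triangle_ineq]) (simp add: abs_mult)
      also have "\<dots> < (1 - s) * 2 + s * 2"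
        using that p(1)[of i] y by (intro add_le_less_mono mult_left_mono mult_strict_left_mono) (auto simp: cube_def)
      finally show ?thesis by simp
    qed
    then show ?thesis
      unfolding eventually_at_right_field by (intro exI[of _ 1]) auto
  qed
  have ev2: "eventually (\<lambda>s. z s $ i \<noteq> z s $ j) (at_right 0)" if "i \<noteq> j" for i j
  proof -
    have pij: "p $ i \<noteq> p $ j" using p(2) that by (simp add: vdm_nonzero_iff)
    show ?thesis
    proof (cases "y $ i = y $ j")
      case True
      then have "z s $ i \<noteq> z s $ j" if "s > 0" for s
        using that pij by (simp add: z_def)
      then show ?thesis by (auto simp: eventually_at_right_field intro: exI[of _ 1])
    next
      case False
      have "((\<lambda>s. z s $ i - z s $ j) \<longlongrightarrow> z 0 $ i - z 0 $ j) (at_right 0)"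
        unfolding z_def by (intro tendsto_intros)
      then have "eventually (\<lambda>s. z s $ i - z s $ j \<noteq> 0) (at_right 0)"
        by (rule tendsto_imp_eventually_ne) (use False in \<open>simp add: z_def\<close>)
      then show ?thesis by simp
    qed
  qed
  have "eventually (\<lambda>s. vdm (z s) \<noteq> 0) (at_right 0)"
    unfolding vdm_nonzero_iff
    by (intro eventually_all_finite) (use ev2 in auto)
  with ev1 have "eventually (\<lambda>s. h (z s) = 0) (at_right 0)"
    by eventually_elim (use zero in auto)
  then have "((\<lambda>s. h (z s)) \<longlongrightarrow> 0) (at_right 0)"
    by (rule tendsto_eventually)
  with lim show ?thesis
    using tendsto_unique[of "at_right 0"] by (metis trivial_limit_at_right_real)
qed

text \<open>The weight is positive at points of the open cube with distinct coordinates. A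
  continuous nonnegative \<open>f\<close> with integral 0 vanishes at these points, and they are
  dense in the cube.\<close>

lemma weyl_integral_zero:
  fixes f :: "real ^ 'n::{finite,linorder} \<Rightarrow> real"
  assumes f: "continuous_on UNIV f" and nonneg: "\<And>y. y \<in> cube \<Longrightarrow> f y \<ge> 0"
    and zero: "(\<integral>y. f y * (vdm y)\<^sup>2 * semics y \<partial>lborel) = 0" and y: "y \<in> cube"
  shows "f y = 0"
proof -
  let ?F = "\<lambda>y. f y * (vdm y)\<^sup>2 * semics y"
  let ?C = "cbox (- vec 2) (vec 2) :: ((real, 'n) vec) set"
  have cont: "continuous_on UNIV ?F" by (intro continuous_intros f)
  have int: "integrable lborel ?F"
    by (intro integrable_semics continuous_intros f)
  have "integral ?C ?F = integral UNIV (\<lambda>y. if y \<in> ?C then ?F y else 0)"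
    by (simp add: integral_restrict_UNIV)
  also have "\<dots> = integral UNIV ?F"
    by (intro Henstock_Kurzweil_Integration.integral_cong) (auto simp: semics_outside cube_eq_cbox)
  also have "\<dots> = 0" using zero integral_lborel[OF int] by simp
  finally have "integral ?C ?F = 0" .
  moreover have "box (- vec 2) (vec 2) \<noteq> ({} :: ((real, 'n) vec) set)"
    by (auto simp: box_ne_empty cart_eq_inner_axis[symmetric] Basis_vec_def inner_axis)
  moreover have "0 \<le> ?F y" if "y \<in> ?C" for y
    using nonneg that by (simp add: cube_eq_cbox)
  ultimately have F0: "?F y = 0" if "y \<in> cube" for y
    using that integral_cbox_eq_0_iff[of "- vec 2" "vec 2" ?F] continuous_on_subset[OF cont, of ?C]
    by (simp add: cube_eq_cbox)
  show ?thesis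
  proof (rule cube_dense[OF f _ y])
    fix z :: "(real, 'n) vec" assume z: "\<And>i. \<bar>z $ i\<bar> < 2" "vdm z \<noteq> 0"
    have "semics z \<noteq> 0"
      unfolding semics_def using z(1) by (simp add: prod_zero_iff semic_eq_0_iff not_le)
    then show "f z = 0"
      using F0[of z] z by (auto simp: cube_def less_imp_le)
  qed
qed

lemma has_real_derivative_psum_line:
  "((\<lambda>s. psum k (y + s *\<^sub>R v)) has_real_derivative (\<Sum>j\<in>UNIV. v $ j * dpsum j (y + s0 *\<^sub>R v) k)) (at s0)"
  unfolding psum_def dpsum_def by (auto intro!: derivative_eq_intros sum.cong)

lemma gradient_zero_constant:
  fixes B :: "nat list set" and c :: "nat list \<Rightarrow> real"
  defines "R \<equiv> \<lambda>y :: real ^ 'n::{finite,linorder}. \<Sum>ks\<in>B. c ks * mon (psums y) ks"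
    and "dR \<equiv> \<lambda>(j::'n) (y::(real, 'n) vec). \<Sum>ks\<in>B. c ks * dmon (dpsum j y) (psums y) ks"
  assumes dR: "\<And>j y. y \<in> cube \<Longrightarrow> dR j y = 0" and y: "y \<in> cube" "y' \<in> cube"
  shows "R y = R y'"
proof -
  define v where "v = y' - y"
  have der: "((\<lambda>s. R (y + s *\<^sub>R v)) has_real_derivative (\<Sum>j\<in>UNIV. v $ j * dR j (y + s *\<^sub>R v))) (at s)" for s
  proof -
    have "((\<lambda>s. R (y + s *\<^sub>R v)) has_real_derivative
        (\<Sum>ks\<in>B. c ks * dmon (\<lambda>l. \<Sum>j\<in>UNIV. v $ j * dpsum j (y + s *\<^sub>R v) l) (psums (y + s *\<^sub>R v)) ks)) (at s)"
      unfolding R_def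
      using has_real_derivative_mon[of "\<lambda>s l. psum l (y + s *\<^sub>R v)", OF has_real_derivative_psum_line]
      by (intro DERIV_sum DERIV_cmult)
    also have "(\<Sum>ks\<in>B. c ks * dmon (\<lambda>l. \<Sum>j\<in>UNIV. v $ j * dpsum j (y + s *\<^sub>R v) l) (psums (y + s *\<^sub>R v)) ks)
        = (\<Sum>j\<in>UNIV. v $ j * dR j (y + s *\<^sub>R v))"
      unfolding dmon_sum dR_def sum_distrib_left by (subst sum.swap) (simp add: ac_simps)
    finally show ?thesis .
  qed
  have "R (y + 1 *\<^sub>R v) = R (y + 0 *\<^sub>R v)"
  proof (rule DERIV_isconst_end[of 0 1])
    show "continuous_on {0..1} (\<lambda>s. R (y + s *\<^sub>R v))"
      using der by (intro DERIV_continuous_on) (blast intro: has_field_derivative_at_within)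
    fix s :: real assume s: "0 < s" "s < 1"
    have "y + s *\<^sub>R v = (1 - s) *\<^sub>R y + s *\<^sub>R y'" by (simp add: v_def algebra_simps)
    moreover have "convex (cube :: ((real, 'n) vec) set)" by (simp add: cube_eq_cbox)
    ultimately have "y + s *\<^sub>R v \<in> cube"
      using s y by (simp add: convex_alt)
    then show "((\<lambda>s. R (y + s *\<^sub>R v)) has_real_derivative 0) (at s)"
      using der[of s] dR by simp
  qed simp
  then show ?thesis by (simp add: v_def)
qed

section \<open>Uniqueness of solutions of the loop equations\<close>

text \<open>Riesz representation for a positive semidefinite form, given by its Gram matrix \<open>G\<close>.\<close>

lemma gram_representation:
  fixes G :: "'i \<Rightarrow> 'i \<Rightarrow> real" and l :: "'i \<Rightarrow> real"
  assumes "finite I" and sym: "\<And>i j. G i j = G j i"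
    and "\<And>c. (\<Sum>i\<in>I. \<Sum>j\<in>I. c i * c j * G i j) \<ge> 0"
    and "\<And>c. (\<Sum>i\<in>I. \<Sum>j\<in>I. c i * c j * G i j) = 0 \<Longrightarrow> (\<Sum>i\<in>I. c i * l i) = 0"
  shows "\<exists>r. \<forall>i\<in>I. l i = (\<Sum>j\<in>I. r j * G i j)"
  using assms(1,3,4)
proof (induction I arbitrary: l rule: finite_induct)
  case (insert a I)
  define Q where "Q c = (\<Sum>i\<in>I. \<Sum>j\<in>I. c i * c j * G i j)" for c
  have Qa: "(\<Sum>i\<in>insert a I. \<Sum>j\<in>insert a I. c i * c j * G i j)
      = Q c + 2 * c a * (\<Sum>i\<in>I. c i * G i a) + c a * c a * G a a" for c
  proof -
    have 1: "(\<Sum>j\<in>insert a I. c i * c j * G i j) = c i * c a * G i a + (\<Sum>j\<in>I. c i * c j * G i j)" for i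
      using insert.hyps by simp
    have 2: "(\<Sum>j\<in>I. c a * c j * G a j) = c a * (\<Sum>j\<in>I. c j * G j a)"
      unfolding sum_distrib_left by (intro sum.cong refl) (simp only: sym[of a] mult.assoc)
    have 3: "(\<Sum>i\<in>I. c i * c a * G i a) = c a * (\<Sum>i\<in>I. c i * G i a)"
      unfolding sum_distrib_left by (intro sum.cong refl) simp
    show ?thesis
      unfolding Q_def 1 sum.distrib sum.insert[OF insert.hyps] 2 3 by (simp add: algebra_simps)
  qed
  have ext: "Q (c(a := x)) = Q c" "(\<Sum>i\<in>I. (c(a := x)) i * h i) = (\<Sum>i\<in>I. c i * h i)" for c x h
    using insert.hyps unfolding Q_def by (auto intro!: sum.cong)
  have pos: "0 \<le> Q c + 2 * x * (\<Sum>i\<in>I. c i * G i a) + x * x * G a a" for c x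
    using insert.prems(1)[of "c(a := x)"] unfolding Qa ext by simp
  have null: "Q c + 2 * x * (\<Sum>i\<in>I. c i * G i a) + x * x * G a a = 0 \<Longrightarrow>
      (\<Sum>i\<in>I. c i * l i) + x * l a = 0" for c x
  proof -
    have "(\<Sum>i\<in>insert a I. (c(a := x)) i * l i) = (\<Sum>i\<in>I. c i * l i) + x * l a"
      unfolding sum.insert[OF insert.hyps] ext by simp
    moreover assume "Q c + 2 * x * (\<Sum>i\<in>I. c i * G i a) + x * x * G a a = 0"
    ultimately show "(\<Sum>i\<in>I. c i * l i) + x * l a = 0"
      using insert.prems(2)[of "c(a := x)"] unfolding Qa ext by simp
  qed
  have pos0: "0 \<le> Q c" for c using pos[of c 0] by simp
  have "(\<Sum>i\<in>I. c i * l i) = 0" if "Q c = 0" for c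
    using null[of c 0] that by simp
  from insert.IH[OF pos0[unfolded Q_def] this[unfolded Q_def]]
  obtain r where r: "\<And>i. i \<in> I \<Longrightarrow> l i = (\<Sum>j\<in>I. r j * G i j)" by metis
  \<comment> \<open>Cauchy-Schwarz for a semidefinite form: a null vector on \<open>I\<close> is
    also orthogonal to the new vector. So the induction hypothesis applies to the functional given
    by the column of \<open>a\<close>.\<close>
  have "(\<Sum>i\<in>I. c i * G i a) = 0" if "Q c = 0" for c
  proof (rule ccontr)
    let ?b = "\<Sum>i\<in>I. c i * G i a"
    assume b: "?b \<noteq> 0"
    define K where "K = \<bar>G a a\<bar> + 1"
    have K: "K > 0" "G a a \<le> K" by (auto simp: K_def)
    \<comment> \<open>The minimiser of 2 x b + x^2 K, with b standing for \<open>?b\<close>. The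
      positive \<open>K\<close> replaces \<open>G a a\<close>, which may be 0.\<close>
    define x where "x = - ?b / K"
    have "2 * x * ?b + x * x * G a a \<le> 2 * x * ?b + x * x * K"
      using K by (intro add_left_mono mult_left_mono) auto
    also have "\<dots> = - (?b * ?b) / K"
      using K by (simp add: x_def field_simps)
    also have "\<dots> < 0" using b K by (intro divide_neg_pos) (auto simp: mult_neg_neg zero_less_mult_iff linorder_neq_iff)
    finally show False using pos[of c x] that by simp
  qed
  from insert.IH[OF pos0[unfolded Q_def] this[unfolded Q_def]]
  obtain s where s: "\<And>i. i \<in> I \<Longrightarrow> G i a = (\<Sum>j\<in>I. s j * G i j)" by metis
  \<comment> \<open>The coefficients \<open>s\<close> project the new vector to the span of the old
    ones; \<gamma> is the squared length of the remainder.\<close>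
  define \<gamma> where "\<gamma> = G a a - (\<Sum>j\<in>I. s j * G j a)"
  have Qs: "Q s = (\<Sum>j\<in>I. s j * G j a)"
    unfolding Q_def by (intro sum.cong refl) (simp add: s sum_distrib_left ac_simps)
  have sl: "(\<Sum>j\<in>I. s j * l j) = (\<Sum>k\<in>I. r k * G k a)"
  proof -
    have "(\<Sum>j\<in>I. s j * l j) = (\<Sum>j\<in>I. \<Sum>k\<in>I. s j * (r k * G j k))"
      by (intro sum.cong refl) (simp add: r sum_distrib_left)
    also have "\<dots> = (\<Sum>k\<in>I. \<Sum>j\<in>I. s j * (r k * G j k))" by (rule sum.swap)
    also have "\<dots> = (\<Sum>k\<in>I. r k * G k a)"
      by (intro sum.cong refl) (simp add: s sum_distrib_left sym ac_simps)
    finally show ?thesis .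
  qed
  \<comment> \<open>The remainder is orthogonal to the old vectors, so adding a multiple of it
    changes only the value at \<open>a\<close>. If \<gamma> = 0 it is a null vector, and by the
    kernel condition the value at \<open>a\<close> is already right.\<close>
  define \<alpha> where "\<alpha> = (if \<gamma> = 0 then 0 else (l a - (\<Sum>k\<in>I. r k * G k a)) / \<gamma>)"
  define r' where "r' j = (if j = a then \<alpha> else r j - \<alpha> * s j)" for j
  have r': "(\<Sum>j\<in>insert a I. r' j * G i j) = \<alpha> * G i a + (\<Sum>j\<in>I. r j * G i j) - \<alpha> * (\<Sum>j\<in>I. s j * G i j)" for i
  proof -
    have "(\<Sum>j\<in>I. r' j * G i j) = (\<Sum>j\<in>I. (r j - \<alpha> * s j) * G i j)"
      using insert.hyps by (intro sum.cong) (auto simp: r'_def)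
    then show ?thesis
      using insert.hyps by (simp add: r'_def sum_subtractf sum_distrib_left algebra_simps)
  qed
  have "l i = (\<Sum>j\<in>insert a I. r' j * G i j)" if "i \<in> I" for i
    unfolding r' using r[OF that] s[OF that] by simp
  moreover have "l a = (\<Sum>j\<in>insert a I. r' j * G a j)"
  proof -
    have "(\<Sum>j\<in>insert a I. r' j * G a j) = \<alpha> * \<gamma> + (\<Sum>k\<in>I. r k * G k a)"
    proof -
      have "(\<Sum>j\<in>I. c j * G a j) = (\<Sum>j\<in>I. c j * G j a)" for c
        by (intro sum.cong refl) (simp only: sym[of a])
      then show ?thesis unfolding r' \<gamma>_def by (simp add: algebra_simps)
    qed
    also have "\<dots> = l a"
    proof (cases "\<gamma> = 0")
      case True
      have "Q s + 2 * (-1) * (\<Sum>i\<in>I. s i * G i a) + (-1) * (-1) * G a a = \<gamma>"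
        by (simp add: Qs \<gamma>_def)
      then have "(\<Sum>i\<in>I. s i * l i) + (-1) * l a = 0" using True null by metis
      then show ?thesis using True sl by simp
    qed (simp add: \<alpha>_def)
    finally show ?thesis by simp
  qed
  ultimately show ?case by (intro exI[of _ r']) auto
qed simp

section \<open>Polynomials in the power sums, filtered by weight\<close>

text \<open>Exponent lists with bounded sum; zeros are excluded to keep the set finite, since
  \<open>q 0\<close> is a constant.\<close>

definition exponents :: "nat \<Rightarrow> nat list set" where
  "exponents n = {ks. sum_list ks \<le> n \<and> 0 \<notin> set ks}"

lemma finite_exponents: "finite (exponents n)"
proof (rule finite_subset)
  have len: "0 \<notin> set ks \<Longrightarrow> length ks \<le> sum_list ks" for ks :: "nat list"
    by (induction ks) auto
  show "exponents n \<subseteq> {ks. set ks \<subseteq> {..n} \<and> length ks \<le> n}"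
  proof
    fix ks assume "ks \<in> exponents n"
    then have ks: "sum_list ks \<le> n" "0 \<notin> set ks" by (auto simp: exponents_def)
    moreover have "k \<le> n" if "k \<in> set ks" for k
      using member_le_sum_list[OF that] ks(1) by simp
    ultimately show "ks \<in> {ks. set ks \<subseteq> {..n} \<and> length ks \<le> n}"
      using len[of ks] by auto
  qed
qed (rule finite_lists_length_le, simp)

text \<open>Polynomial functions of weight at most \<open>n\<close>, where q_k has weight
  \<open>k\<close>. The variable q_0 is frozen at \<open>N\<close>, so its powers go into the
  coefficients.\<close>

definition graded :: "real \<Rightarrow> nat \<Rightarrow> ((nat \<Rightarrow> real) \<Rightarrow> real) \<Rightarrow> bool" where
  "graded N n F \<longleftrightarrow> (\<exists>c. \<forall>q. q 0 = N \<longrightarrow> F q = (\<Sum>ks\<in>exponents n. c ks * mon q ks))"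

lemma graded_cmult: "graded N n F \<Longrightarrow> graded N n (\<lambda>q. a * F q)"
  unfolding graded_def
proof (elim exE)
  fix c assume c: "\<forall>q. q 0 = N \<longrightarrow> F q = (\<Sum>ks\<in>exponents n. c ks * mon q ks)"
  show "\<exists>c. \<forall>q. q 0 = N \<longrightarrow> a * F q = (\<Sum>ks\<in>exponents n. c ks * mon q ks)"
    using c by (intro exI[of _ "\<lambda>ks. a * c ks"]) (simp add: sum_distrib_left mult.assoc)
qed

lemma graded_add: "graded N n F \<Longrightarrow> graded N n G \<Longrightarrow> graded N n (\<lambda>q. F q + G q)"
  unfolding graded_def
proof (elim exE)
  fix c c' assume c: "\<forall>q. q 0 = N \<longrightarrow> F q = (\<Sum>ks\<in>exponents n. c ks * mon q ks)"
    "\<forall>q. q 0 = N \<longrightarrow> G q = (\<Sum>ks\<in>exponents n. c' ks * mon q ks)"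
  show "\<exists>c. \<forall>q. q 0 = N \<longrightarrow> F q + G q = (\<Sum>ks\<in>exponents n. c ks * mon q ks)"
    using c by (intro exI[of _ "\<lambda>ks. c ks + c' ks"]) (simp add: sum.distrib distrib_right)
qed

lemma graded_zero: "graded N n (\<lambda>q. 0)"
  unfolding graded_def by (intro exI[of _ "\<lambda>_. 0"]) simp

lemma graded_sum: "(\<And>i. i \<in> A \<Longrightarrow> graded N n (F i)) \<Longrightarrow> graded N n (\<lambda>q. \<Sum>i\<in>A. F i q)"
  by (induction A rule: infinite_finite_induct) (auto intro: graded_zero graded_add)

text \<open>Zero entries of the list are factors \<open>q 0 = N\<close> and move into the
  coefficient; the other entries form a member of \<open>exponents n\<close>.\<close>

lemma graded_mon:
  assumes "sum_list ks \<le> n"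
  shows "graded N n (\<lambda>q. mon q ks)"
proof -
  let ?z = "length (filter (\<lambda>k. k = 0) ks)" and ?ks = "filter (\<lambda>k. k \<noteq> 0) ks"
  have "mon q ks = N ^ ?z * mon q ?ks" if "q 0 = N" for q
    using that by (induction ks) auto
  moreover have "sum_list ?ks = sum_list ks" by (induction ks) auto
  then have ks: "?ks \<in> exponents n" using assms by (simp add: exponents_def)
  have "(\<Sum>ks'\<in>exponents n. (if ks' = ?ks then N ^ ?z else 0) * mon q ks') = N ^ ?z * mon q ?ks" for q
  proof -
    have "(\<Sum>ks'\<in>exponents n. (if ks' = ?ks then N ^ ?z else 0) * mon q ks')
        = (\<Sum>ks'\<in>exponents n. if ks' = ?ks then N ^ ?z * mon q ?ks else 0)"
      by (intro sum.cong refl) auto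
    also have "\<dots> = N ^ ?z * mon q ?ks" using ks finite_exponents by (simp add: sum.delta)
    finally show ?thesis .
  qed
  ultimately show ?thesis
    unfolding graded_def by (intro exI[of _ "\<lambda>ks'. if ks' = ?ks then N ^ ?z else 0"]) simp
qed

text \<open>Every term of \<open>loop k ks\<close> has weight at most that of q_k times the monomial
  \<open>ks\<close>. Hence \<open>lap\<close> acts on polynomials of bounded weight, which is what
  makes the uniqueness argument finite-dimensional.\<close>

lemma graded_loop:
  assumes "k + sum_list ks \<le> n"
  shows "graded N n (loop k ks)"
proof -
  have "graded N n (\<lambda>q. - 2 * mon q (0 # k # ks) + - 1 * mon q (k # ks)
      + (\<Sum>i<k - 1. 4 * mon q (i # (k - 2 - i) # ks) + - 1 * mon q ((i + 1) # (k - 1 - i) # ks))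
      + (\<Sum>i<length ks. 4 * real (ks ! i) * mon q ((k + ks ! i - 2) # dele i ks)
           + - real (ks ! i) * mon q ((k + ks ! i) # dele i ks)))"
    by (intro graded_add graded_sum graded_cmult graded_mon)
       (use assms sum_list_dele[of _ ks] in \<open>force+\<close>)
  also have "(\<lambda>q. - 2 * mon q (0 # k # ks) + - 1 * mon q (k # ks)
      + (\<Sum>i<k - 1. 4 * mon q (i # (k - 2 - i) # ks) + - 1 * mon q ((i + 1) # (k - 1 - i) # ks))
      + (\<Sum>i<length ks. 4 * real (ks ! i) * mon q ((k + ks ! i - 2) # dele i ks)
           + - real (ks ! i) * mon q ((k + ks ! i) # dele i ks))) = loop k ks"
    unfolding loop_def dmon_eq_sum
    by (rule ext) (simp add: algebra_simps sum_distrib_left sum_distrib_right sum_subtractf sum.distrib)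
  finally show ?thesis .
qed

lemma graded_lap: "sum_list ks \<le> n \<Longrightarrow> graded N n (lap ks)"
  unfolding lap_def[abs_def]
  by (intro graded_sum graded_cmult graded_loop) (use sum_list_dele[of _ ks] in force)

lemma sum_times_sum:
  fixes c d m :: "'i \<Rightarrow> real"
  shows "(\<Sum>i\<in>A. c i * m i) * (\<Sum>j\<in>A. d j * m j) = (\<Sum>i\<in>A. c i * (\<Sum>j\<in>A. d j * (m i * m j)))"
proof -
  let ?S = "\<Sum>j\<in>A. d j * m j"
  have "(\<Sum>j\<in>A. d j * (m i * m j)) = m i * ?S" for i
    unfolding sum_distrib_left by (intro sum.cong refl) simp
  then show ?thesis by (simp add: sum_distrib_right mult.assoc)
qed

lemma psum_0: "psum 0 (y :: real ^ 'n) = real CARD('n)"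
  by (simp add: psum_def)

text \<open>The loop equations determine the moments: in the finite-dimensional space of symmetric
  polynomials of bounded degree, represent the functional in question by a polynomial \<open>R\<close> with
  respect to the Weyl weight.  Green's identity with \<open>R\<close> itself shows that \<open>R\<close> is constant.\<close>

theorem loop_equations_unique:
  fixes q :: "'m \<Rightarrow> nat \<Rightarrow> real" and M :: "'m measure"
  assumes "prob_space M" and meas: "\<And>k. (\<lambda>m. q m k) \<in> borel_measurable M"
    and spec: "\<And>m. m \<in> space M \<Longrightarrow> \<exists>y \<in> (cube :: (real, 'n::{finite,linorder}) vec set). q m = psums y"
    and loop: "\<And>k ks. k \<ge> 1 \<Longrightarrow> (\<integral>m. loop k ks (q m) \<partial>M) = 0"
  shows "(\<integral>m. mon (q m) ks \<partial>M) * (\<integral>y. (vdm y)\<^sup>2 * semics y \<partial>(lborel :: (real, 'n) vec measure))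
       = (\<integral>y. mon (psums y) ks * (vdm y)\<^sup>2 * semics y \<partial>(lborel :: (real, 'n) vec measure))"
proof -
  interpret prob_space M by fact
  define W where "W f = (\<integral>y. f y * (vdm y)\<^sup>2 * semics y \<partial>lborel)" for f :: "(real, 'n) vec \<Rightarrow> real"
  have Wint: "integrable lborel (\<lambda>y :: (real, 'n) vec. f y * (vdm y)\<^sup>2 * semics y)" if "continuous_on UNIV f" for f
    by (intro integrable_semics continuous_intros that)
  have Wsum: "W (\<lambda>y. \<Sum>i\<in>A. c i * f i y) = (\<Sum>i\<in>A. c i * W (f i))"
    if "\<And>i. i \<in> A \<Longrightarrow> continuous_on UNIV (f i)" for A :: "nat list set" and c f
    unfolding W_def sum_distrib_right mult.assoc using Wint that
    by (subst Bochner_Integration.integral_sum) (auto simp: mult.assoc)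
  have Mint: "integrable M (\<lambda>m. mon (q m) ks)" for ks
  proof -
    have "compact ((\<lambda>y :: (real, 'n) vec. mon (psums y) ks) ` cube)"
      by (intro compact_continuous_image continuous_intros compact_cube)
    from compact_imp_bounded[OF this] obtain b
      where b: "\<And>y. y \<in> cube \<Longrightarrow> \<bar>mon (psums (y :: (real, 'n) vec)) ks\<bar> \<le> b"
      unfolding bounded_iff by fastforce
    have "(\<lambda>m. mon (q m) ks) \<in> borel_measurable M"
      by (induction ks) (use meas in auto)
    moreover have "AE m in M. norm (mon (q m) ks) \<le> b"
      using spec b by (intro AE_I2) (metis real_norm_def)
    ultimately show ?thesis by (intro integrable_const_bound)
  qed
  have Lsum: "(\<integral>m. (\<Sum>i\<in>A. c i * mon (q m) i) \<partial>M) = (\<Sum>i\<in>A. c i * (\<integral>m. mon (q m) i \<partial>M))" for A c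
    using Mint by (subst Bochner_Integration.integral_sum) auto
  define N where "N = real CARD('n)"
  define n where "n = sum_list ks"
  let ?I = "exponents n"
  define G where "G ks ks' = W (\<lambda>y. mon (psums y) ks * mon (psums y) ks')" for ks ks'
  define l where "l ks = (\<integral>m. mon (q m) ks \<partial>M)" for ks
  have Q: "(\<Sum>i\<in>?I. \<Sum>j\<in>?I. c i * c j * G i j) = W (\<lambda>y. (\<Sum>i\<in>?I. c i * mon (psums y) i)\<^sup>2)" for c
  proof -
    have "W (\<lambda>y. (\<Sum>i\<in>?I. c i * mon (psums y) i)\<^sup>2)
        = W (\<lambda>y. \<Sum>i\<in>?I. c i * (\<Sum>j\<in>?I. c j * (mon (psums y) i * mon (psums y) j)))"
      by (simp only: power2_eq_square sum_times_sum)
    also have "\<dots> = (\<Sum>i\<in>?I. c i * (\<Sum>j\<in>?I. c j * G i j))"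
      unfolding G_def by (subst Wsum, intro continuous_intros, subst Wsum, intro continuous_intros) simp
    finally show ?thesis by (simp add: sum_distrib_left mult.assoc)
  qed
  have "\<exists>r. \<forall>i\<in>?I. l i = (\<Sum>j\<in>?I. r j * G i j)"
  proof (rule gram_representation[OF finite_exponents])
    show "G i j = G j i" for i j by (simp add: G_def mult.commute)
    show "(\<Sum>i\<in>?I. \<Sum>j\<in>?I. c i * c j * G i j) \<ge> 0" for c
      unfolding Q W_def by (intro integral_nonneg_AE AE_I2 mult_nonneg_nonneg) auto
    \<comment> \<open>A null vector of the Gram matrix is a polynomial that vanishes on the cube. By
      \<open>spec\<close> it then vanishes at every \<open>q m\<close>, so its expectation is
      0.\<close>
    fix c assume "(\<Sum>i\<in>?I. \<Sum>j\<in>?I. c i * c j * G i j) = 0"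
    then have W0: "(\<integral>y. (\<Sum>i\<in>?I. c i * mon (psums y) i)\<^sup>2 * (vdm y)\<^sup>2 * semics y \<partial>(lborel :: (real, 'n) vec measure)) = 0"
      unfolding Q W_def .
    have "(\<Sum>i\<in>?I. c i * mon (psums y) i)\<^sup>2 = 0" if "y \<in> cube" for y :: "(real, 'n) vec"
      by (rule weyl_integral_zero[OF _ _ W0 that]) (auto intro!: continuous_intros)
    then have "(\<Sum>i\<in>?I. c i * mon (q m) i) = 0" if "m \<in> space M" for m
      using spec[OF that] by auto
    then have "(\<integral>m. (\<Sum>i\<in>?I. c i * mon (q m) i) \<partial>M) = 0"
      by (intro integral_eq_zero_AE AE_I2) auto
    then show "(\<Sum>i\<in>?I. c i * l i) = 0" unfolding l_def Lsum .
  qed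
  then obtain r where r: "\<And>i. i \<in> ?I \<Longrightarrow> l i = (\<Sum>j\<in>?I. r j * G i j)" by blast
  define R where "R y = (\<Sum>j\<in>?I. r j * mon (psums y) j)" for y :: "(real, 'n) vec"
  have Rc: "continuous_on UNIV R" unfolding R_def by (intro continuous_intros)
  \<comment> \<open>Both sides are linear in the polynomial, and on monomials they agree by the
    choice of \<open>r\<close>.\<close>
  have rep: "(\<integral>m. F (q m) \<partial>M) = W (\<lambda>y. F (psums y) * R y)" if "graded N n F" for F
  proof -
    from that obtain c where c: "\<And>q. q 0 = N \<Longrightarrow> F q = (\<Sum>ks\<in>?I. c ks * mon q ks)"
      unfolding graded_def by blast
    have "(\<integral>m. F (q m) \<partial>M) = (\<integral>m. (\<Sum>ks\<in>?I. c ks * mon (q m) ks) \<partial>M)"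
    proof (intro Bochner_Integration.integral_cong refl c)
      fix m assume "m \<in> space M"
      then show "q m 0 = N" using spec[of m] by (auto simp: N_def psum_0)
    qed
    also have "\<dots> = (\<Sum>i\<in>?I. c i * (\<Sum>j\<in>?I. r j * G i j))"
      unfolding Lsum using r by (simp add: l_def)
    also have "\<dots> = W (\<lambda>y. \<Sum>i\<in>?I. c i * (\<Sum>j\<in>?I. r j * (mon (psums y) i * mon (psums y) j)))"
      unfolding G_def by (subst Wsum, intro continuous_intros, subst Wsum, intro continuous_intros) simp
    also have "\<dots> = W (\<lambda>y. F (psums y) * R y)"
      unfolding R_def by (simp add: c N_def psum_0 sum_times_sum)
    finally show ?thesis .
  qed
  have grad: "graded N n (lap ks')" if "ks' \<in> ?I" for ks'
    using that by (intro graded_lap) (simp add: exponents_def)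
  have lap0: "(\<integral>m. lap ks' (q m) \<partial>M) = 0" if "ks' \<in> ?I" for ks'
  proof -
    have li: "integrable M (\<lambda>m. loop k ks'' (q m))" for k ks''
    proof -
      from graded_loop[of k ks'' "k + sum_list ks''" N] obtain c
        where c: "\<And>q. q 0 = N \<Longrightarrow> loop k ks'' q = (\<Sum>ks\<in>exponents (k + sum_list ks''). c ks * mon q ks)"
        unfolding graded_def by blast
      have "integrable M (\<lambda>m. \<Sum>ks\<in>exponents (k + sum_list ks''). c ks * mon (q m) ks)"
        by (intro Bochner_Integration.integrable_sum integrable_mult_right Mint)
      then show ?thesis
      proof (rule Bochner_Integration.integrable_cong[THEN iffD1, rotated 2, OF _ refl])
        fix m assume "m \<in> space M"
        then have "q m 0 = N" using spec[of m] by (auto simp: N_def psum_0)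
        then show "(\<Sum>ks\<in>exponents (k + sum_list ks''). c ks * mon (q m) ks) = loop k ks'' (q m)"
          by (simp add: c)
      qed
    qed
    have "(\<integral>m. lap ks' (q m) \<partial>M) = (\<Sum>i<length ks'. real (ks' ! i) * (\<integral>m. loop (ks' ! i) (dele i ks') (q m) \<partial>M))"
      unfolding lap_def using li by (subst Bochner_Integration.integral_sum) auto
    also have "\<dots> = 0"
      using loop by (intro sum.neutral) (force simp: Suc_le_eq)
    finally show ?thesis .
  qed
  \<comment> \<open>For every monomial of weight at most \<open>n\<close> the Weyl integral of its
    Laplacian times \<open>R\<close> is an expectation of \<open>lap\<close>, hence 0. Since
    \<open>R\<close> is a combination of the same monomials, its own Laplacian may be taken.\<close>
  have "W (\<lambda>y. (\<Sum>ks\<in>?I. r ks * lap ks (psums y)) * R y) = (\<Sum>ks\<in>?I. r ks * W (\<lambda>y. lap ks (psums y) * R y))"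
    unfolding sum_distrib_right mult.assoc
    by (subst Wsum, intro continuous_intros Rc) simp
  also have "\<dots> = 0"
    using rep[OF grad] lap0 by (intro sum.neutral) auto
  finally have W0: "(\<integral>y. (\<Sum>j\<in>UNIV. (4 - (y $ j)\<^sup>2) * (\<Sum>ks\<in>?I. r ks * dmon (dpsum j y) (psums y) ks)\<^sup>2) * (vdm y)\<^sup>2 * semics y \<partial>(lborel :: (real, 'n) vec measure)) = 0"
    using weyl_dirichlet[of ?I r, where 'n = 'n] unfolding W_def R_def exponents_def by simp
  have S0: "(\<Sum>j\<in>UNIV. (4 - (y $ j)\<^sup>2) * (\<Sum>ks\<in>?I. r ks * dmon (dpsum j y) (psums y) ks)\<^sup>2) = 0"
    if "y \<in> cube" for y :: "(real, 'n) vec"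
    by (rule weyl_integral_zero[OF _ _ W0 that])
       (auto intro!: continuous_intros sum_nonneg mult_nonneg_nonneg simp: cube_def abs_le_square_iff[of _ 2, simplified])
  have dR: "(\<Sum>ks\<in>?I. r ks * dmon (dpsum j y) (psums y) ks) = 0" if "y \<in> cube" for y :: "(real, 'n) vec" and j
  proof (rule cube_dense[OF _ _ that])
    fix z :: "(real, 'n) vec" assume z: "\<And>i. \<bar>z $ i\<bar> < 2"
    then have z2: "(z $ i)\<^sup>2 < 4" for i using abs_le_square_iff[of 2 "z $ i"] by (simp add: not_le[symmetric])
    have "z \<in> cube" using z by (auto simp: cube_def less_imp_le)
    then have "\<forall>j\<in>UNIV. (4 - (z $ j)\<^sup>2) * (\<Sum>ks\<in>?I. r ks * dmon (dpsum j z) (psums z) ks)\<^sup>2 = 0"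
      using S0[of z] z2 by (subst (asm) sum_nonneg_eq_0_iff) (auto intro!: mult_nonneg_nonneg simp: less_imp_le)
    then have "(4 - (z $ j)\<^sup>2) * (\<Sum>ks\<in>?I. r ks * dmon (dpsum j z) (psums z) ks)\<^sup>2 = 0"
      by blast
    then show "(\<Sum>ks\<in>?I. r ks * dmon (dpsum j z) (psums z) ks) = 0"
      using z2[of j] by simp
  qed (intro continuous_intros)
  have R: "R y = R 0" if "y \<in> cube" for y
    unfolding R_def by (rule gradient_zero_constant[OF dR that]) (auto simp: cube_def)
  have WR: "W (\<lambda>y. f y * R y) = R 0 * W f" for f
  proof -
    have "W (\<lambda>y. f y * R y) = (\<integral>y. R 0 * (f y * (vdm y)\<^sup>2 * semics y) \<partial>lborel)"
      unfolding W_def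
    proof (intro Bochner_Integration.integral_cong refl)
      fix y show "f y * R y * (vdm y)\<^sup>2 * semics y = R 0 * (f y * (vdm y)\<^sup>2 * semics y)"
        using R[of y] semics_outside[of y] by (cases "y \<in> cube") (auto simp: ac_simps)
    qed
    then show ?thesis by (simp add: W_def)
  qed
  have "(\<integral>m. mon (q m) ks \<partial>M) = R 0 * W (\<lambda>y. mon (psums y) ks)"
    using rep[OF graded_mon[of ks]] by (simp add: n_def WR)
  \<comment> \<open>The empty monomial fixes the constant: here it matters that \<open>M\<close> has
    total mass 1.\<close>
  moreover have "1 = R 0 * W (\<lambda>y. 1)"
    using rep[OF graded_mon[of "[]"]] WR[of "\<lambda>_. 1"] by (simp add: n_def prob_space)
  ultimately show ?thesis
    by (simp add: W_def)
qed

section \<open>The symplectic Lie algebra and its Casimir element\<close>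

named_theorems mm_simps

lemma mm_diff_left [mm_simps]: "(A::'a::comm_ring_1^'n^'m) ** (B - C) = A ** B - A ** C"
  by (simp add: matrix_matrix_mult_def vec_eq_iff sum_subtractf algebra_simps)

lemma mm_diff_right [mm_simps]: "((A::'a::comm_ring_1^'n^'m) - B) ** C = A ** C - B ** C"
  by (simp add: matrix_matrix_mult_def vec_eq_iff sum_subtractf algebra_simps)

lemma mm_add_left [mm_simps]: "(A::'a::comm_ring_1^'n^'m) ** (B + C) = A ** B + A ** C"
  by (rule matrix_add_ldistrib)

lemma mm_add_right [mm_simps]: "((A::'a::comm_ring_1^'n^'m) + B) ** C = A ** C + B ** C"
  by (simp add: matrix_matrix_mult_def vec_eq_iff sum.distrib algebra_simps)

lemma mm_minus_left [mm_simps]: "(- (A::'a::comm_ring_1^'n^'m)) ** B = - (A ** B)"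
  by (simp add: matrix_matrix_mult_def vec_eq_iff sum_negf)

lemma mm_minus_right [mm_simps]: "(A::'a::comm_ring_1^'n^'m) ** (- B) = - (A ** B)"
  by (simp add: matrix_matrix_mult_def vec_eq_iff sum_negf)

lemma mm_zero [simp]: "(0 :: 'a::comm_ring_1^'n^'m) ** B = 0" "(A::'a::comm_ring_1^'n^'m) ** 0 = 0"
  by (simp_all add: matrix_matrix_mult_def vec_eq_iff)

lemma mm_sum_left: "(A::'a::comm_ring_1^'n^'m) ** (\<Sum>x\<in>S. f x) = (\<Sum>x\<in>S. A ** f x)"
  by (induction S rule: infinite_finite_induct) (simp_all add: mm_simps)

lemma mm_sum_right: "(\<Sum>x\<in>S. f x) ** (A::'a::comm_ring_1^'n^'m) = (\<Sum>x\<in>S. f x ** A)"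
  by (induction S rule: infinite_finite_induct) (simp_all add: mm_simps)

lemma trace_sum: "trace (\<Sum>x\<in>S. f x) = (\<Sum>x\<in>S. trace (f x :: 'a::comm_ring_1^'n^'n))"
  unfolding trace_def sum_component by (rule sum.swap)

lemma trace_minus: "trace (- A) = - trace (A :: 'a::comm_ring_1^'n^'n)"
  by (simp add: trace_def sum_negf)

lemma mat_mult_component: "(mat c ** (A :: 'a::comm_ring_1^'n^'n)) $ i $ j = c * A $ i $ j"
  by (simp add: matrix_matrix_mult_def mat_def if_distrib if_distribR cong: if_cong)

lemma mat_mult_commute: "mat c ** (A :: 'a::comm_ring_1^'n^'n) = A ** mat c"
  by (simp add: vec_eq_iff mat_mult_component)
     (simp add: matrix_matrix_mult_def mat_def if_distrib if_distribR mult.commute cong: if_cong)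

lemma trace_mat_mult: "trace (mat c ** (A :: 'a::comm_ring_1^'n^'n)) = c * trace A"
  by (simp add: trace_def mat_mult_component sum_distrib_left)

lemma trace_mult_eq: "trace (A ** B) = (\<Sum>i\<in>UNIV. \<Sum>j\<in>UNIV. A $ i $ j * B $ j $ i)"
  by (simp add: trace_def matrix_matrix_mult_def)

section \<open>The Hermitian and the symplectic adjoint\<close>

definition ct :: "complex^'n^'n \<Rightarrow> complex^'n^'n" where
  "ct A = map_matrix cnj (transpose A)"

lemma ct_component [simp]: "ct A $ i $ j = cnj (A $ j $ i)"
  by (simp add: ct_def transpose_def)

lemma ct_mult: "ct (A ** B) = ct B ** ct A"
  by (simp add: vec_eq_iff matrix_matrix_mult_def mult.commute)

lemma ct_simps [simp]: "ct (A + B) = ct A + ct B" "ct (A - B) = ct A - ct B" "ct (- A) = - ct A"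
  "ct (ct A) = A" "ct (mat 1) = mat 1"
  by (simp_all add: vec_eq_iff mat_def)

lemma trace_ct: "trace (ct A) = cnj (trace A)"
  by (simp add: trace_def)

lemma sympJ_skew: "sympJ $ j $ i = - sympJ $ i $ j"
  by (cases i; cases j) (auto simp: sympJ_def)

lemma sympJ_cnj: "cnj (sympJ $ i $ j) = sympJ $ i $ j"
  by (cases i; cases j) (auto simp: sympJ_def)

lemma sympJ_square: "sympJ ** sympJ = (- mat 1 :: ('g::finite) cmat2)"
proof -
  have "(sympJ ** sympJ) $ i $ j = (- mat 1 :: 'g cmat2) $ i $ j" for i j
    by (cases i; cases j)
       (simp_all add: matrix_matrix_mult_def sympJ_def mat_def UNIV_Plus_UNIV[symmetric]
          sum.Plus if_distrib if_distribR cong: if_cong del: UNIV_Plus_UNIV)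
  then show ?thesis by (simp add: vec_eq_iff)
qed

lemma sympJ_square_component: "(\<Sum>q\<in>UNIV. sympJ $ i $ q * sympJ $ q $ l) = (if i = l then - 1 else 0 :: complex)"
  using arg_cong[OF sympJ_square, of "\<lambda>A. A $ i $ l"]
  by (simp add: matrix_matrix_mult_def mat_def split: if_splits)

lemma transpose_sympJ: "transpose sympJ = - sympJ"
  by (auto simp: vec_eq_iff transpose_def intro: sympJ_skew)

text \<open>Since \<open>J\<^sup>2 = - 1\<close>, this is the symplectic adjoint \<open>J\<^sup>-\<^sup>1 A\<^sup>t J\<close>.\<close>

definition st :: "('g::finite) cmat2 \<Rightarrow> 'g cmat2" where
  "st A = - (sympJ ** transpose A ** sympJ)"

lemma st_component: "st A $ i $ j = - (\<Sum>k\<in>UNIV. \<Sum>l\<in>UNIV. sympJ $ i $ l * A $ k $ l * sympJ $ k $ j)"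
  by (simp add: st_def matrix_matrix_mult_def transpose_def sum_distrib_right)

lemma st_mult: "st (A ** B) = st B ** st A"
proof -
  have "st B ** st A = sympJ ** transpose B ** (sympJ ** sympJ) ** transpose A ** sympJ"
    by (simp add: st_def mm_simps matrix_mul_assoc)
  also have "\<dots> = st (A ** B)"
    unfolding sympJ_square by (simp add: st_def mm_simps matrix_mul_assoc matrix_transpose_mul)
  finally show ?thesis by simp
qed

lemma transpose_minus: "transpose (- A :: 'a::comm_ring_1^'n^'m) = - transpose A"
  by (simp add: transpose_def vec_eq_iff)

lemma transpose_add: "transpose (A + B :: 'a::comm_ring_1^'n^'m) = transpose A + transpose B"
  by (simp add: transpose_def vec_eq_iff)

lemma st_simps [simp]:
  fixes A B :: "('g::finite) cmat2"
  shows "st (A + B) = st A + st B" "st (A - B) = st A - st B" "st (- A) = - st A"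
  "st (st A) = A" "st (mat c) = (mat c :: 'g cmat2)"
proof -
  show add: "st (A + B) = st A + st B" for A B :: "'g cmat2" by (simp add: st_def mm_simps transpose_add)
  show min: "st (- A) = - st A" for A :: "'g cmat2" by (simp add: st_def mm_simps transpose_minus)
  show "st (A - B) = st A - st B" using add[of A "- B"] min[of B] by simp
  show "st (st A) = A"
    by (simp add: st_def transpose_minus matrix_transpose_mul transpose_sympJ mm_simps matrix_mul_assoc sympJ_square)
       (simp add: sympJ_square mm_simps flip: matrix_mul_assoc)
  have "(sympJ :: 'g cmat2) ** mat c ** sympJ = mat c ** (sympJ ** sympJ)"
    unfolding mat_mult_commute[symmetric] by (rule matrix_mul_assoc[symmetric])
  also have "\<dots> = - mat c" by (simp add: sympJ_square mm_simps)
  finally have J: "(sympJ :: 'g cmat2) ** mat c ** sympJ = - mat c" .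
  show "st (mat c) = (mat c :: 'g cmat2)" by (simp only: st_def transpose_mat J minus_minus)
qed

lemma st_ct: "st (ct A) = ct (st A)"
proof -
  have "st (ct A) $ i $ j = ct (st A) $ i $ j" for i j
  proof -
    have "ct (st A) $ i $ j = - (\<Sum>l\<in>UNIV. \<Sum>k\<in>UNIV. sympJ $ j $ l * cnj (A $ k $ l) * sympJ $ k $ i)"
      by (subst sum.swap) (simp add: st_component sympJ_cnj)
    also have "\<dots> = - (\<Sum>l\<in>UNIV. \<Sum>k\<in>UNIV. sympJ $ i $ k * cnj (A $ k $ l) * sympJ $ l $ j)"
    proof (intro arg_cong[where f = uminus] sum.cong refl)
      fix k l
      show "sympJ $ j $ l * cnj (A $ k $ l) * sympJ $ k $ i = sympJ $ i $ k * cnj (A $ k $ l) * sympJ $ l $ j"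
        using sympJ_skew[of j l] sympJ_skew[of k i] by simp
    qed
    also have "\<dots> = st (ct A) $ i $ j" by (simp add: st_component)
    finally show ?thesis ..
  qed
  then show ?thesis by (simp add: vec_eq_iff)
qed

lemma trace_st: "trace (st A) = trace A"
proof -
  have "trace (st A) = - trace (sympJ ** (sympJ ** transpose A))"
    unfolding st_def trace_minus by (metis trace_mul_sym)
  also have "\<dots> = trace (transpose A)"
    by (simp add: matrix_mul_assoc sympJ_square mm_simps trace_minus)
  also have "\<dots> = trace A" by (simp add: trace_def transpose_def)
  finally show ?thesis .
qed

text \<open>The group in terms of two commuting anti-automorphisms: both \<open>ct m\<close> and
  \<open>st m\<close> are the inverse of \<open>m\<close>. This is the form in which it enters the
  computations below.\<close>

lemma USp_iff:
  fixes m :: "('g::finite) cmat2"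
  shows "m \<in> USp \<longleftrightarrow> ct m ** m = mat 1 \<and> st m = ct m"
proof -
  have conj: "transpose m ** map_matrix cnj m = mat 1 \<longleftrightarrow> ct m ** m = mat 1"
  proof -
    have "map_matrix cnj (transpose m ** map_matrix cnj m) = ct m ** m"
      by (simp add: vec_eq_iff matrix_matrix_mult_def transpose_def)
    moreover have "map_matrix cnj (mat 1) = (mat 1 :: 'g cmat2)"
      by (simp add: vec_eq_iff mat_def)
    moreover have "map_matrix cnj (map_matrix cnj A) = A" for A :: "'g cmat2"
      by (simp add: vec_eq_iff)
    ultimately show ?thesis by metis
  qed
  have "transpose m ** sympJ ** m = sympJ \<longleftrightarrow> st m = ct m" if "ct m ** m = mat 1"
  proof
    have inv: "m ** ct m = mat 1" using that by (simp add: matrix_left_right_inverse)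
    show "st m = ct m" if "transpose m ** sympJ ** m = sympJ"
    proof -
      have "transpose m ** sympJ = sympJ ** ct m"
        using that inv by (metis matrix_mul_assoc matrix_mul_rid)
      then have "sympJ ** transpose m ** sympJ = - ct m"
        by (metis matrix_mul_assoc sympJ_square mm_minus_left matrix_mul_lid)
      then show ?thesis by (simp add: st_def)
    qed
    show "transpose m ** sympJ ** m = sympJ" if "st m = ct m"
    proof -
      have "transpose m ** sympJ = sympJ ** st m"
        by (simp add: st_def mm_simps matrix_mul_assoc sympJ_square)
      then show ?thesis
        using that \<open>ct m ** m = mat 1\<close> by (metis matrix_mul_assoc matrix_mul_rid)
    qed
  qed
  moreover have "invertible m" if "ct m ** m = mat 1"
    using that matrix_left_right_inverse[of m "ct m"] unfolding invertible_def by blast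
  ultimately show ?thesis
    unfolding USp_def mem_Collect_eq conj by blast
qed

lemma USpD:
  assumes "m \<in> USp"
  shows "ct m ** m = mat 1" "m ** ct m = mat 1" "st m = ct m" "st (ct m) = m"
proof -
  show 1: "ct m ** m = mat 1" and 2: "st m = ct m" using assms by (simp_all add: USp_iff)
  from 1 show "m ** ct m = mat 1" by (simp add: matrix_left_right_inverse)
  show "st (ct m) = m" by (simp flip: 2)
qed

lemma USp_mult:
  assumes "m \<in> USp" "m' \<in> USp"
  shows "m ** m' \<in> USp"
proof -
  have "ct (m ** m') ** (m ** m') = ct m' ** (ct m ** m) ** m'"
    by (simp add: ct_mult matrix_mul_assoc)
  then show ?thesis
    using USpD[OF assms(1)] USpD[OF assms(2)] by (simp add: USp_iff st_mult ct_mult)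
qed

section \<open>The Lie algebra and contractions of its Casimir tensor\<close>

definition lie :: "('g::finite) cmat2 \<Rightarrow> bool" where
  "lie X \<longleftrightarrow> ct X = - X \<and> st X = - X"

text \<open>Skew-symmetrisation for both adjoints at once. It is not normalised: on the Lie algebra
  it is multiplication by 4.\<close>

definition lie_proj :: "('g::finite) cmat2 \<Rightarrow> 'g cmat2" where
  "lie_proj A = A - ct A - (st A - st (ct A))"

lemma lie_lie_proj: "lie (lie_proj A)"
  by (simp add: lie_def lie_proj_def flip: st_ct)

definition munit :: "'n \<Rightarrow> 'n \<Rightarrow> complex \<Rightarrow> complex^'n^'n" where
  "munit p q z = (\<chi> i j. if i = p \<and> j = q then z else 0)"

text \<open>The projections of \<open>E\<^sub>p\<^sub>q\<close> and \<open>\<i> E\<^sub>p\<^sub>q\<close> span the Lie algebra. Unlike a basis, this overcomplete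
  family makes the Casimir tensor a short computation; the price is the factor 8 below.\<close>

definition lie_frame :: "('g::finite + 'g) \<times> ('g + 'g) \<times> bool \<Rightarrow> 'g cmat2" where
  "lie_frame = (\<lambda>(p, q, b). lie_proj (munit p q (if b then 1 else \<i>)))"

lemma lie_lie_frame: "lie (lie_frame x)"
  by (cases x) (simp add: lie_frame_def lie_lie_proj)

lemma st_munit: "st (munit p q z) $ i $ j = - z * sympJ $ i $ q * sympJ $ p $ j"
proof -
  have "(\<Sum>k\<in>UNIV. \<Sum>l\<in>UNIV. sympJ $ i $ l * munit p q z $ k $ l * sympJ $ k $ j)
     = (\<Sum>k\<in>UNIV. \<Sum>l\<in>UNIV. if l = q then if k = p then sympJ $ i $ l * z * sympJ $ k $ j else 0 else 0)"
    by (intro sum.cong refl) (simp add: munit_def)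
  also have "\<dots> = sympJ $ i $ q * z * sympJ $ p $ j" by simp
  finally show ?thesis by (simp add: st_component)
qed

text \<open>A frame entry has the form z a - conj(z) a' with z = 1 or z = \<open>\<i>\<close>. In
  the products the terms with z^2 and conj(z)^2 cancel between the two values and those with z
  conj(z) add up, which gives -4 S. Expanding \<open>S\<close> yields each of the two stated tensors
  twice.\<close>

lemma casimir:
  fixes i j k l :: "'g::finite + 'g"
  shows "(\<Sum>x\<in>UNIV. lie_frame x $ i $ j * lie_frame x $ k $ l)
    = - 8 * ((if i = l \<and> j = k then 1 else 0) - sympJ $ i $ k * sympJ $ j $ l)"
proof -
  let ?d = "\<lambda>i j :: 'g + 'g. if i = j then 1 else 0 :: complex"
  let ?J = "\<lambda>i j :: 'g + 'g. sympJ $ i $ j"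
  \<comment> \<open>The entry \<open>(i, j)\<close> of E_pq minus its symplectic adjoint.\<close>
  define a where "a p q i j = ?d i p * ?d j q + ?J i q * ?J p j" for p q i j
  have frame: "lie_frame (p, q, b) $ i $ j
      = (let z = if b then 1 else \<i> in z * a p q i j - cnj z * a q p i j)" for p q b i j
  proof -
    have c: "ct (munit p q z) = munit q p (cnj z)" for z by (auto simp: vec_eq_iff munit_def)
    have m: "munit p q z $ i $ j = z * (?d i p * ?d j q)" for p q z by (simp add: munit_def)
    have "lie_proj (munit p q z) $ i $ j = z * a p q i j - cnj z * a q p i j" for z
      unfolding lie_proj_def c vector_minus_component st_munit m a_def by (simp only: algebra_simps) simp
    then show ?thesis
      by (simp only: lie_frame_def Let_def split)
  qed
  define S where "S = (\<Sum>p\<in>UNIV. \<Sum>q\<in>UNIV. a p q i j * a q p k l)"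
  have "(\<Sum>x\<in>UNIV. lie_frame x $ i $ j * lie_frame x $ k $ l)
     = (\<Sum>p\<in>UNIV. \<Sum>q\<in>UNIV. \<Sum>b\<in>UNIV. lie_frame (p, q, b) $ i $ j * lie_frame (p, q, b) $ k $ l)"
    by (simp only: UNIV_Times_UNIV[symmetric] sum.cartesian_product')
  also have "\<dots> = (\<Sum>p\<in>UNIV. \<Sum>q\<in>UNIV. - 2 * (a p q i j * a q p k l) - 2 * (a q p i j * a p q k l))"
    by (intro sum.cong refl) (simp add: frame UNIV_bool Let_def algebra_simps)
  also have "\<dots> = - 2 * S - 2 * (\<Sum>p\<in>UNIV. \<Sum>q\<in>UNIV. a q p i j * a p q k l)"
    by (simp add: S_def sum_subtractf sum_negf flip: sum_distrib_left)
  also have "(\<Sum>p\<in>UNIV. \<Sum>q\<in>UNIV. a q p i j * a p q k l) = S"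
    unfolding S_def by (rule sum.swap)
  finally have 1: "(\<Sum>x\<in>UNIV. lie_frame x $ i $ j * lie_frame x $ k $ l) = - 4 * S" by simp
  have d: "(\<Sum>p\<in>UNIV. ?d i p * f p) = f i" "(\<Sum>p\<in>UNIV. f p * ?d i p) = f i" for f i
    by (simp_all add: if_distrib if_distribR cong: if_cong)
  have "S = (\<Sum>p\<in>UNIV. \<Sum>q\<in>UNIV. ?d i p * (?d j q * (?d k q * ?d l p)))
     + (\<Sum>p\<in>UNIV. \<Sum>q\<in>UNIV. ?d i p * (?d j q * (?J k p * ?J q l)))
     + (\<Sum>p\<in>UNIV. \<Sum>q\<in>UNIV. ?d l p * (?d k q * (?J i q * ?J p j)))
     + (\<Sum>p\<in>UNIV. \<Sum>q\<in>UNIV. (?J k p * ?J p j) * (?J i q * ?J q l))"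
    unfolding S_def a_def sum.distrib[symmetric] by (intro sum.cong refl) (simp add: algebra_simps)
  also have "(\<Sum>p\<in>UNIV. \<Sum>q\<in>UNIV. (?J k p * ?J p j) * (?J i q * ?J q l))
      = (\<Sum>p\<in>UNIV. ?J k p * ?J p j) * (\<Sum>q\<in>UNIV. ?J i q * ?J q l)"
    by (simp add: sum_product)
  also have "\<dots> = (if i = l \<and> j = k then 1 else 0)"
    by (auto simp: sympJ_square_component)
  finally have "S = ?d k j * ?d l i + ?J k i * ?J j l + ?J i k * ?J l j + (if i = l \<and> j = k then 1 else 0)"
    by (simp only: sum_distrib_left[symmetric] d)
  also have "\<dots> = 2 * ((if i = l \<and> j = k then 1 else 0) - ?J i k * ?J j l)"
    using sympJ_skew[of k i] sympJ_skew[of l j] by auto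
  finally show ?thesis unfolding 1 by simp
qed

text \<open>In the Casimir tensor the exchange part contracts with \<open>A\<close> to the trace,
  and the part with two factors J contracts to the symplectic adjoint.\<close>

lemma casimir_sandwich:
  "(\<Sum>x\<in>UNIV. lie_frame x ** A ** lie_frame x) = mat (- 8) ** (mat (trace A) + st (A :: ('g::finite) cmat2))"
proof -
  have "(\<Sum>x\<in>UNIV. lie_frame x ** A ** lie_frame x) $ i $ l = (mat (- 8) ** (mat (trace A) + st A)) $ i $ l" for i l
  proof -
    have "(\<Sum>x\<in>UNIV. lie_frame x ** A ** lie_frame x) $ i $ l
        = (\<Sum>x\<in>UNIV. \<Sum>k\<in>UNIV. \<Sum>j\<in>UNIV. lie_frame x $ i $ j * A $ j $ k * lie_frame x $ k $ l)"
      by (simp add: sum_component matrix_matrix_mult_def sum_distrib_right)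
    also have "\<dots> = (\<Sum>k\<in>UNIV. \<Sum>j\<in>UNIV. \<Sum>x\<in>UNIV. lie_frame x $ i $ j * A $ j $ k * lie_frame x $ k $ l)"
      by (subst sum.swap, intro sum.cong refl, rule sum.swap)
    also have "\<dots> = (\<Sum>k\<in>UNIV. \<Sum>j\<in>UNIV. A $ j $ k * (\<Sum>x\<in>UNIV. lie_frame x $ i $ j * lie_frame x $ k $ l))"
      by (simp add: sum_distrib_left ac_simps)
    also have "\<dots> = (\<Sum>k\<in>UNIV. \<Sum>j\<in>UNIV. - 8 * (if i = l \<and> j = k then A $ j $ k else 0)
         + 8 * (sympJ $ i $ k * A $ j $ k * sympJ $ j $ l))"
      unfolding casimir by (intro sum.cong refl) (simp add: algebra_simps)
    also have "\<dots> = (\<Sum>k\<in>UNIV. \<Sum>j\<in>UNIV. - 8 * (if i = l \<and> j = k then A $ j $ k else 0))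
         + 8 * (\<Sum>k\<in>UNIV. \<Sum>j\<in>UNIV. sympJ $ i $ k * A $ j $ k * sympJ $ j $ l)"
      by (simp only: sum.distrib sum_distrib_left)
    also have "(\<Sum>k\<in>UNIV. \<Sum>j\<in>UNIV. sympJ $ i $ k * A $ j $ k * sympJ $ j $ l) = - st A $ i $ l"
      unfolding st_component by (simp, rule sum.swap)
    also have "(\<Sum>k\<in>UNIV. \<Sum>j\<in>UNIV. - 8 * (if i = l \<and> j = k then A $ j $ k else 0)) = - 8 * (if i = l then trace A else 0)"
      by (cases "i = l") (simp_all add: trace_def sum_negf flip: sum_distrib_left)
    finally show ?thesis by (simp add: mat_mult_component) (simp add: mat_def)
  qed
  then show ?thesis by (simp add: vec_eq_iff)
qed

text \<open>The other contraction of the tensor: pairing with the frame sees only the part of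
  \<open>B\<close> that changes sign under \<open>st\<close>.\<close>

lemma casimir_trace:
  "(\<Sum>x\<in>UNIV. trace (lie_frame x ** A) * trace (lie_frame x ** B))
     = - 8 * (trace (A ** B) - trace (A ** st (B :: ('g::finite) cmat2)))"
proof -
  have tr: "(\<Sum>i\<in>UNIV. \<Sum>j\<in>UNIV. A $ j $ i * C $ i $ j) = trace (A ** C)" for C
    unfolding trace_mult_eq by (rule sum.swap)
  have "(\<Sum>x\<in>UNIV. trace (lie_frame x ** A) * trace (lie_frame x ** B))
     = (\<Sum>x\<in>UNIV. \<Sum>i\<in>UNIV. \<Sum>j\<in>UNIV. lie_frame x $ i $ j * A $ j $ i * trace (lie_frame x ** B))"
    by (simp add: trace_mult_eq[of "lie_frame _" A] sum_distrib_right)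
  also have "\<dots> = (\<Sum>i\<in>UNIV. \<Sum>j\<in>UNIV. \<Sum>x\<in>UNIV. lie_frame x $ i $ j * A $ j $ i * trace (lie_frame x ** B))"
    by (subst sum.swap, intro sum.cong refl, rule sum.swap)
  also have "\<dots> = (\<Sum>i\<in>UNIV. \<Sum>j\<in>UNIV. A $ j $ i * (- 8 * (B $ i $ j - st B $ i $ j)))"
  proof (intro sum.cong refl)
    fix i j :: "'g + 'g"
    have "(\<Sum>x\<in>UNIV. lie_frame x $ i $ j * A $ j $ i * trace (lie_frame x ** B))
       = (\<Sum>x\<in>UNIV. \<Sum>k\<in>UNIV. \<Sum>l\<in>UNIV. A $ j $ i * (B $ l $ k * (lie_frame x $ i $ j * lie_frame x $ k $ l)))"
      by (simp add: trace_mult_eq sum_distrib_left ac_simps)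
    also have "\<dots> = (\<Sum>k\<in>UNIV. \<Sum>l\<in>UNIV. \<Sum>x\<in>UNIV. A $ j $ i * (B $ l $ k * (lie_frame x $ i $ j * lie_frame x $ k $ l)))"
      by (subst sum.swap, intro sum.cong refl, rule sum.swap)
    also have "\<dots> = A $ j $ i * (\<Sum>k\<in>UNIV. \<Sum>l\<in>UNIV. B $ l $ k * (\<Sum>x\<in>UNIV. lie_frame x $ i $ j * lie_frame x $ k $ l))"
      by (simp add: sum_distrib_left)
    also have "(\<Sum>k\<in>UNIV. \<Sum>l\<in>UNIV. B $ l $ k * (\<Sum>x\<in>UNIV. lie_frame x $ i $ j * lie_frame x $ k $ l))
        = (\<Sum>k\<in>UNIV. \<Sum>l\<in>UNIV. (if l = i then if k = j then - 8 * B $ l $ k else 0 else 0))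
          - 8 * (\<Sum>k\<in>UNIV. \<Sum>l\<in>UNIV. sympJ $ i $ k * B $ l $ k * sympJ $ l $ j)"
      unfolding casimir sum_distrib_left sum_subtractf[symmetric]
      by (intro sum.cong refl) (auto simp: sympJ_skew[of j] algebra_simps)
    also have "(\<Sum>k\<in>UNIV. \<Sum>l\<in>UNIV. sympJ $ i $ k * B $ l $ k * sympJ $ l $ j) = - st B $ i $ j"
      unfolding st_component by (simp, rule sum.swap)
    also have "(\<Sum>k\<in>UNIV. \<Sum>l\<in>UNIV. (if l = i then if k = j then - 8 * B $ l $ k else 0 else 0)) = - 8 * B $ i $ j"
      by simp
    finally show "(\<Sum>x\<in>UNIV. lie_frame x $ i $ j * A $ j $ i * trace (lie_frame x ** B))
        = A $ j $ i * (- 8 * (B $ i $ j - st B $ i $ j))" by simp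
  qed
  also have "\<dots> = - 8 * ((\<Sum>i\<in>UNIV. \<Sum>j\<in>UNIV. A $ j $ i * B $ i $ j) - (\<Sum>i\<in>UNIV. \<Sum>j\<in>UNIV. A $ j $ i * st B $ i $ j))"
    by (simp add: sum_distrib_left sum_subtractf sum_negf algebra_simps)
  finally show ?thesis
    unfolding tr .
qed

section \<open>Powers and traces of h = m + m^-1\<close>

primrec mpow :: "complex^'n^'n \<Rightarrow> nat \<Rightarrow> complex^'n^'n" where
  "mpow A 0 = mat 1"
| "mpow A (Suc k) = A ** mpow A k"

lemma mpow_add: "mpow A (i + j) = mpow A i ** mpow A j"
  by (induction i) (simp_all add: matrix_mul_assoc)

lemma mpow_commute: "A ** B = B ** A \<Longrightarrow> mpow A k ** B = B ** mpow A k"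
  by (induction k) (simp_all, metis matrix_mul_assoc)

lemma mpow_Suc_right: "mpow A (Suc k) = mpow A k ** A"
  by (simp add: mpow_commute)

lemma ct_mpow: "ct (mpow A k) = mpow (ct A) k"
  by (induction k) (simp_all add: ct_mult mpow_commute)

lemma st_mpow: "st (mpow A k) = mpow (st A) k"
  by (induction k) (simp_all add: st_mult mpow_commute)

lemma mat_add: "mat a + mat b = (mat (a + b) :: 'a::comm_ring_1^'n^'n)"
  by (simp add: vec_eq_iff mat_def)

lemma mat_mult: "mat a ** mat b = (mat (a * b) :: 'a::comm_ring_1^'n^'n)"
  by (simp add: vec_eq_iff mat_mult_component) (simp add: mat_def)

lemma mult_mat_left: "A ** (mat c ** B) = mat c ** ((A :: 'a::comm_ring_1^'n^'n) ** B)"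
  by (metis mat_mult_commute matrix_mul_assoc)

lemma trace_mult_mat: "trace (A ** (mat c ** B)) = c * trace ((A :: 'a::comm_ring_1^'n^'n) ** B)"
  by (simp add: mult_mat_left trace_mat_mult)

lemma trace_mult_mat_right: "trace ((A :: 'a::comm_ring_1^'n^'n) ** mat c) = c * trace A"
  using trace_mult_mat[of A c "mat 1"] by simp

definition herm :: "complex^'n^'n \<Rightarrow> complex^'n^'n" where
  "herm m = m + ct m"

text \<open>With \<open>ddherm\<close>, the first and second derivatives of \<open>herm\<close>
  along exp(sX) m, for skew-Hermitian \<open>X\<close>. The minus sign comes from
  \<open>ct X = - X\<close>.\<close>

definition dherm :: "complex^'n^'n \<Rightarrow> complex^'n^'n \<Rightarrow> complex^'n^'n" where
  "dherm X m = X ** m - ct m ** X"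

definition ddherm :: "complex^'n^'n \<Rightarrow> complex^'n^'n \<Rightarrow> complex^'n^'n" where
  "ddherm X m = X ** X ** m + ct m ** X ** X"

text \<open>The factor 1/2 removes the doubling of the eigenvalues. The trace itself is real because
  \<open>herm m\<close> is Hermitian.\<close>

definition htrace :: "complex^'n^'n \<Rightarrow> nat \<Rightarrow> real" where
  "htrace m k = Re (trace (mpow (herm m) k)) / 2"

lemma ct_herm [simp]: "ct (herm m) = herm m"
  by (simp add: herm_def add.commute)

lemma trace_real:
  assumes "ct A = A" "ct B = B"
  shows "trace (A ** B) = complex_of_real (Re (trace (A ** B)))"
proof -
  have "cnj (trace (A ** B)) = trace (A ** B)"
    unfolding trace_ct[symmetric] ct_mult assms by (rule trace_mul_sym)
  then show ?thesis by (simp add: complex_eq_iff)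
qed

lemma trace_mpow_herm: "trace (mpow (herm m) k) = complex_of_real (2 * htrace m k)"
  using trace_real[of "mpow (herm m) k" "mat 1"] by (simp add: htrace_def ct_mpow)

lemma htrace_0: "htrace (m :: ('g::finite) cmat2) 0 = real CARD('g)"
  by (simp add: htrace_def trace_I)

context
  fixes m :: "('g::finite) cmat2"
  assumes m: "m \<in> USp"
begin

lemma st_herm: "st (herm m) = herm m"
  using USpD[OF m] by (simp add: herm_def add.commute)

lemma herm_commute: "mpow (herm m) k ** m = m ** mpow (herm m) k"
  "mpow (herm m) k ** ct m = ct m ** mpow (herm m) k"
  using USpD[OF m] by (auto intro!: mpow_commute simp: herm_def mm_simps)

lemma st_mpow_herm: "st (mpow (herm m) k) = mpow (herm m) k"
  by (simp add: st_mpow st_herm)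

text \<open>\<open>st\<close> preserves traces and exchanges \<open>m\<close> with
  \<open>ct m\<close>, so both halves of \<open>herm m\<close> contribute equally.\<close>

lemma trace_mult_herm:
  assumes "st B = B" "B ** m = m ** B"
  shows "2 * trace (m ** B) = trace (herm m ** B)"
proof -
  have "trace (m ** B) = trace (st (m ** B))" by (simp add: trace_st)
  also have "\<dots> = trace (ct m ** B)"
    unfolding st_mult assms(1) USpD(3)[OF m] by (rule trace_mul_sym)
  finally show ?thesis by (simp add: herm_def mm_simps trace_add)
qed

text \<open>The Casimir element acts on the standard representation by the scalar -8 (2g + 1), where
  2g is the trace of the identity and 1 comes from \<open>st (mat 1) = mat 1\<close>.\<close>

lemma sum_ddherm:
  "(\<Sum>x\<in>UNIV. ddherm (lie_frame x) m) = mat (- 8 * (2 * of_nat CARD('g) + 1)) ** herm m"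
proof -
  have c: "(\<Sum>x\<in>UNIV. lie_frame x ** lie_frame x) = (mat (- 8 * (2 * of_nat CARD('g) + 1)) :: 'g cmat2)"
    using casimir_sandwich[of "mat 1 :: 'g cmat2"] by (simp add: trace_I mat_add mat_mult)
  have "(\<Sum>x\<in>UNIV. ddherm (lie_frame x) m)
      = (\<Sum>x\<in>UNIV. lie_frame x ** lie_frame x) ** m + ct m ** (\<Sum>x\<in>UNIV. lie_frame x ** lie_frame x)"
    by (simp add: ddherm_def sum.distrib mm_sum_left mm_sum_right matrix_mul_assoc)
  then show ?thesis
    unfolding c mat_mult_commute[of _ "ct m", symmetric] herm_def mm_add_left .
qed

text \<open>Expanding both factors gives four sandwiches of \<open>casimir_sandwich\<close>. Those
  with a single side multiplied by \<open>m\<close> or \<open>ct m\<close> combine to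
  \<open>herm m\<close>; the two others yield the traces of \<open>B\<close>; the bare terms
  \<open>B\<close> cancel.\<close>

lemma sum_dherm_sandwich:
  assumes B: "st B = B" "B ** m = m ** B" "B ** ct m = ct m ** B"
  shows "(\<Sum>x\<in>UNIV. dherm (lie_frame x) m ** B ** dherm (lie_frame x) m)
    = mat 8 ** (mat (2 * trace B) - mat (trace (m ** B)) ** herm m)"
proof -
  note U = USpD[OF m]
  let ?X = "lie_frame :: _ \<Rightarrow> 'g cmat2"
  let ?S = "\<lambda>A. mat (- 8) ** (mat (trace A) + st A)"
  have e: "dherm X m ** B ** dherm X m
      = (X ** (m ** B) ** X) ** m - X ** (m ** B ** ct m) ** X - ct m ** (X ** B ** X) ** m
        + ct m ** (X ** (B ** ct m) ** X)" for X
    by (simp add: dherm_def mm_simps matrix_mul_assoc)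
  have "(\<Sum>x\<in>UNIV. dherm (?X x) m ** B ** dherm (?X x) m)
     = ?S (m ** B) ** m - ?S (m ** B ** ct m) - ct m ** ?S B ** m + ct m ** ?S (B ** ct m)"
    unfolding e sum.distrib sum_subtractf
    by (simp add: casimir_sandwich flip: mm_sum_left mm_sum_right)
  moreover have "?S (m ** B) ** m = mat (- 8) ** (mat (trace (m ** B)) ** m + B)"
  proof -
    have "st (m ** B) ** m = B ** (ct m ** m)" 
      unfolding st_mult B(1) U(3) by (rule matrix_mul_assoc[symmetric])
    then show ?thesis using U by (simp add: mm_simps flip: matrix_mul_assoc)
  qed
  moreover have "?S (m ** B ** ct m) = mat (- 8) ** (mat (trace B) + B)"
  proof -
    have "m ** B ** ct m = B ** (m ** ct m)" using B by (simp add: matrix_mul_assoc)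
    then show ?thesis using U B by simp
  qed
  moreover have "ct m ** ?S B ** m = mat (- 8) ** (mat (trace B) + B)"
  proof -
    have "ct m ** (mat (trace B) + B) = (mat (trace B) + B) ** ct m"
      unfolding mm_add_left mm_add_right B(3) mat_mult_commute ..
    then have "ct m ** ?S B ** m = mat (- 8) ** ((mat (trace B) + B) ** (ct m ** m))"
      unfolding mult_mat_left B(1) by (simp add: matrix_mul_assoc)
    then show ?thesis using U by simp
  qed
  moreover have "ct m ** ?S (B ** ct m) = mat (- 8) ** (mat (trace (m ** B)) ** ct m + B)"
  proof -
    have "ct m ** st (B ** ct m) = (ct m ** m) ** B" using U B by (simp add: st_mult matrix_mul_assoc)
    moreover have "trace (B ** ct m) = trace (m ** B)"
      using U B trace_st[of "B ** ct m"] by (simp add: st_mult)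
    moreover have "ct m ** ?S (B ** ct m) = mat (- 8) ** (mat (trace (B ** ct m)) ** ct m + ct m ** st (B ** ct m))"
      unfolding mult_mat_left mm_add_left[of "ct m"] mat_mult_commute[of "trace (B ** ct m)" "ct m"] ..
    ultimately show ?thesis using U by simp
  qed
  ultimately have "(\<Sum>x\<in>UNIV. dherm (?X x) m ** B ** dherm (?X x) m)
    = mat (- 8) ** (mat (trace (m ** B)) ** m + B - (mat (trace B) + B) - (mat (trace B) + B)
        + (mat (trace (m ** B)) ** ct m + B))"
    by (simp only: mm_add_left mm_diff_left)
  also have "mat (trace (m ** B)) ** m + B - (mat (trace B) + B) - (mat (trace B) + B)
        + (mat (trace (m ** B)) ** ct m + B) = - (mat (2 * trace B) - mat (trace (m ** B)) ** herm m)"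
    using mat_add[of "trace B" "trace B", where 'n = "'g + 'g"] by (simp add: herm_def mm_simps)
  also have "mat (- 8) ** - (mat (2 * trace B) - mat (trace (m ** B)) ** herm m)
      = mat 8 ** (mat (2 * trace B) - mat (trace (m ** B)) ** herm m)"
    by (simp add: vec_eq_iff mat_mult_component)
  finally show ?thesis .
qed

text \<open>By cyclicity \<open>dherm\<close> is paired as \<open>X\<close> against A (m - m^-1).
  This matrix changes sign under \<open>st\<close>, so the subtraction in
  \<open>casimir_trace\<close> doubles 8 to 16, and (m - m^-1)^2 = h^2 - 4 produces the group
  version of 4 - t^2.\<close>

lemma sum_dherm_traces:
  assumes A: "st A = A" "A ** m = m ** A" "A ** ct m = ct m ** A"
    and B: "st B = B" "B ** m = m ** B" "B ** ct m = ct m ** B"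
  shows "(\<Sum>x\<in>UNIV. trace (A ** dherm (lie_frame x) m) * trace (B ** dherm (lie_frame x) m))
    = 16 * (4 * trace (A ** B) - trace (A ** B ** (herm m ** herm m)))"
proof -
  note U = USpD[OF m]
  let ?d = "m - ct m"
  have C: "trace (C ** dherm X m) = trace (X ** (C ** ?d))" if "C ** m = m ** C" for C X
  proof -
    have "trace (C ** (X ** m)) = trace (X ** (m ** C))"
      by (metis matrix_mul_assoc trace_mul_sym)
    moreover have "trace (C ** (ct m ** X)) = trace (X ** (C ** ct m))"
      by (metis matrix_mul_assoc trace_mul_sym)
    ultimately show ?thesis using that by (simp add: dherm_def mm_simps trace_sub)
  qed
  have skew: "st (B ** ?d) = - (B ** ?d)"
    using U B by (simp add: st_mult mm_simps)
  have "(\<Sum>x\<in>UNIV. trace (A ** dherm (lie_frame x) m) * trace (B ** dherm (lie_frame x) m))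
    = - 16 * trace (A ** ?d ** (B ** ?d))"
    unfolding C[OF A(2)] C[OF B(2)] casimir_trace skew mm_minus_right trace_minus by simp
  also have "A ** ?d ** (B ** ?d) = A ** B ** (?d ** ?d)"
  proof -
    have "?d ** B = B ** ?d" using B by (simp add: mm_simps)
    then show ?thesis by (metis matrix_mul_assoc)
  qed
  also have "?d ** ?d = herm m ** herm m - mat 4"
  proof -
    have "mat 4 = mat 1 + mat 1 + mat 1 + (mat 1 :: 'g cmat2)" by (simp add: mat_add)
    then show ?thesis using U by (simp add: herm_def mm_simps)
  qed
  finally show ?thesis
    by (simp add: mm_simps trace_sub trace_mat_mult flip: mat_mult_commute)
qed

end

text \<open>The derivative along \<open>X\<close> is applied to this function, which is itself \<open>1 / k\<close> times the derivative
  along \<open>X\<close> of the trace of \<open>(herm m)\<^sup>k\<close>, times a monomial. Summing over the frame gives the loop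
  polynomial.\<close>

definition sdfun :: "complex^'n^'n \<Rightarrow> nat \<Rightarrow> nat list \<Rightarrow> complex^'n^'n \<Rightarrow> real" where
  "sdfun X k ks m = Re (trace (mpow (herm m) (k - 1) ** dherm X m)) * mon (htrace m) ks"

definition dhtrace :: "complex^'n^'n \<Rightarrow> complex^'n^'n \<Rightarrow> nat \<Rightarrow> real" where
  "dhtrace X m l = real l * Re (trace (mpow (herm m) (l - 1) ** dherm X m)) / 2"

definition dsdfun :: "complex^'n^'n \<Rightarrow> nat \<Rightarrow> nat list \<Rightarrow> complex^'n^'n \<Rightarrow> real" where
  "dsdfun X k ks m =
     (Re (trace ((\<Sum>j<k - 1. mpow (herm m) j ** dherm X m ** mpow (herm m) (k - 2 - j)) ** dherm X m))
       + Re (trace (mpow (herm m) (k - 1) ** ddherm X m))) * mon (htrace m) ks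
     + Re (trace (mpow (herm m) (k - 1) ** dherm X m)) * dmon (dhtrace X m) (htrace m) ks"

lemma ct_dherm: "lie X \<Longrightarrow> ct (dherm X m) = dherm X m"
  by (simp add: dherm_def lie_def ct_mult mm_simps)

text \<open>\<open>T1\<close> is the second derivative of \<open>herm\<close>, \<open>T2\<close> the
  derivative of its power, \<open>T3\<close> that of the monomial. The factor 16 is the frame
  constant 8 times the 2 between traces and \<open>htrace\<close>.\<close>

lemma sum_dsdfun:
  assumes m: "(m :: ('g::finite) cmat2) \<in> USp" and k: "k \<ge> 1"
  shows "(\<Sum>x\<in>UNIV. dsdfun (lie_frame x) k ks m) = 16 * loop k ks (htrace m)"
proof -
  let ?h = "herm m" and ?q = "htrace m"
  let ?H = "\<lambda>j. mpow (herm m) j" and ?D = "\<lambda>x. dherm (lie_frame x) m"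
  note st = st_mpow_herm[OF m] and com = herm_commute[OF m]
  have tr: "trace (?H k) = of_real (2 * ?q k)" for k by (rule trace_mpow_herm)
  have "(\<Sum>x\<in>UNIV. trace (?H (k - 1) ** ddherm (lie_frame x) m))
      = trace (?H (k - 1) ** (mat (- 8 * (2 * of_nat CARD('g) + 1)) ** ?h))"
    unfolding sum_ddherm[OF m, symmetric] by (simp add: mm_sum_left trace_sum)
  also have "?H (k - 1) ** (mat (- 8 * (2 * of_nat CARD('g) + 1)) ** ?h)
      = mat (- 8 * (2 * of_nat CARD('g) + 1)) ** ?H k"
    using k mpow_Suc_right[of ?h "k - 1"] by (simp add: mat_mult_commute matrix_mul_assoc del: mpow.simps)
       (metis mat_mult_commute matrix_mul_assoc)
  finally have "(\<Sum>x\<in>UNIV. Re (trace (?H (k - 1) ** ddherm (lie_frame x) m))) = 16 * (- (2 * ?q 0 + 1) * ?q k)"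
    unfolding trace_mat_mult tr by (simp add: htrace_0 flip: Re_sum)
  then have T1: "(\<Sum>x\<in>UNIV. Re (trace (?H (k - 1) ** ddherm (lie_frame x) m))) = 16 * (- (2 * ?q 0 + 1) * ?q k)" .
  have S2: "(\<Sum>x\<in>UNIV. trace ((?H j ** ?D x ** ?H (k - 2 - j)) ** ?D x))
      = 16 * of_real (4 * ?q j * ?q (k - 2 - j) - ?q (j + 1) * ?q (k - 1 - j))" if j: "j < k - 1" for j
  proof -
    let ?B = "?H (k - 2 - j)"
    have "(\<Sum>x\<in>UNIV. trace ((?H j ** ?D x ** ?B) ** ?D x)) = trace (?H j ** (\<Sum>x\<in>UNIV. ?D x ** ?B ** ?D x))"
      by (simp add: mm_sum_left trace_sum matrix_mul_assoc)
    also have "\<dots> = 8 * (2 * trace ?B * trace (?H j) - trace (m ** ?B) * trace (?H j ** ?h))"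
      unfolding sum_dherm_sandwich[OF m st com]
      unfolding trace_mult_mat mm_diff_left trace_sub trace_mult_mat_right by simp
    also have "?H j ** ?h = ?H (j + 1)" using mpow_Suc_right[of ?h j] by simp
    also have "trace (m ** ?B) = trace (?H (k - 1 - j)) / 2"
    proof -
      have "k - 1 - j = Suc (k - 2 - j)" using j by simp
      then show ?thesis using trace_mult_herm[OF m st com(1), of "k - 2 - j"] by (simp add: mult.commute)
    qed
    finally show ?thesis unfolding tr by simp
  qed
  have "(\<Sum>x\<in>UNIV. Re (trace ((\<Sum>j<k - 1. ?H j ** ?D x ** ?H (k - 2 - j)) ** ?D x)))
      = Re (\<Sum>j<k - 1. \<Sum>x\<in>UNIV. trace ((?H j ** ?D x ** ?H (k - 2 - j)) ** ?D x))"
    by (subst sum.swap) (simp add: mm_sum_right trace_sum Re_sum)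
  also have "\<dots> = 16 * (\<Sum>j<k - 1. 4 * ?q j * ?q (k - 2 - j) - ?q (j + 1) * ?q (k - 1 - j))"
    using S2 by (simp add: sum_distrib_left Re_sum)
  finally have T2: "(\<Sum>x\<in>UNIV. Re (trace ((\<Sum>j<k - 1. ?H j ** ?D x ** ?H (k - 2 - j)) ** ?D x)))
      = 16 * (\<Sum>j<k - 1. 4 * ?q j * ?q (k - 2 - j) - ?q (j + 1) * ?q (k - 1 - j))" .
  have S3: "(\<Sum>x\<in>UNIV. Re (trace (?H (k - 1) ** ?D x)) * dhtrace (lie_frame x) m l)
      = 16 * (real l * (4 * ?q (k + l - 2) - ?q (k + l)))" for l
  proof (cases "l = 0")
    case False
    have re: "trace (?H i ** ?D x) = of_real (Re (trace (?H i ** ?D x)))" for i x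
      by (rule trace_real) (simp_all add: ct_mpow ct_dherm lie_lie_frame)
    have "of_real (\<Sum>x\<in>UNIV. Re (trace (?H (k - 1) ** ?D x)) * Re (trace (?H (l - 1) ** ?D x)))
        = (\<Sum>x\<in>UNIV. trace (?H (k - 1) ** ?D x) * trace (?H (l - 1) ** ?D x))"
      using re by simp
    also have "\<dots> = 16 * (4 * trace (?H (k - 1) ** ?H (l - 1)) - trace (?H (k - 1) ** ?H (l - 1) ** (?h ** ?h)))"
      by (rule sum_dherm_traces[OF m st com st com])
    also have "?H (k - 1) ** ?H (l - 1) = ?H (k + l - 2)"
    proof -
      have "k + l - 2 = (k - 1) + (l - 1)" using k False by simp
      then show ?thesis by (simp only: mpow_add)
    qed
    also have "?H (k + l - 2) ** (?h ** ?h) = ?H (k + l)"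
    proof -
      have "k + l = (k + l - 2) + 2" using k False by simp
      then have "?H (k + l) = ?H (k + l - 2) ** ?H 2" by (metis mpow_add)
      moreover have "?H 2 = ?h ** ?h" by (simp add: numeral_2_eq_2)
      ultimately show ?thesis by simp
    qed
    finally have "complex_of_real (\<Sum>x\<in>UNIV. Re (trace (?H (k - 1) ** ?D x)) * Re (trace (?H (l - 1) ** ?D x)))
        = complex_of_real (32 * (4 * ?q (k + l - 2) - ?q (k + l)))"
      unfolding tr by simp
    then have "(\<Sum>x\<in>UNIV. Re (trace (?H (k - 1) ** ?D x)) * Re (trace (?H (l - 1) ** ?D x)))
        = 32 * (4 * ?q (k + l - 2) - ?q (k + l))" by (simp only: of_real_eq_iff)
    moreover have "(\<Sum>x\<in>UNIV. Re (trace (?H (k - 1) ** ?D x)) * dhtrace (lie_frame x) m l)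
        = real l / 2 * (\<Sum>x\<in>UNIV. Re (trace (?H (k - 1) ** ?D x)) * Re (trace (?H (l - 1) ** ?D x)))"
      unfolding dhtrace_def sum_distrib_left by (intro sum.cong refl) simp
    ultimately have "(\<Sum>x\<in>UNIV. Re (trace (?H (k - 1) ** ?D x)) * dhtrace (lie_frame x) m l)
        = real l / 2 * (32 * (4 * ?q (k + l - 2) - ?q (k + l)))" by (simp only:)
    also have "\<dots> = 16 * (real l * (4 * ?q (k + l - 2) - ?q (k + l)))" by (simp add: algebra_simps)
    finally show ?thesis .
  qed (simp add: dhtrace_def)
  have T3: "(\<Sum>x\<in>UNIV. Re (trace (?H (k - 1) ** ?D x)) * dmon (dhtrace (lie_frame x) m) ?q ks)
      = 16 * dmon (\<lambda>l. real l * (4 * ?q (k + l - 2) - ?q (k + l))) ?q ks"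
  proof -
    have "dmon (\<lambda>l. 16 * F l) ?q ks = 16 * dmon F ?q ks" for F
      using dmon_sum[of "\<lambda>_. 16" "\<lambda>_. F" "{()}"] by simp
    then show ?thesis unfolding dmon_sum[symmetric] S3 .
  qed
  show ?thesis
    unfolding dsdfun_def sum.distrib T3 sum_distrib_right[symmetric] T1 T2
    by (simp add: loop_def algebra_simps)
qed

section \<open>Schwinger--Dyson equations for the Haar measure\<close>

definition mder :: "(real \<Rightarrow> complex^'n^'n) \<Rightarrow> complex^'n^'n \<Rightarrow> real \<Rightarrow> bool" where
  "mder A A' s \<longleftrightarrow> (\<forall>i j. ((\<lambda>s. A s $ i $ j) has_vector_derivative A' $ i $ j) (at s))"

lemma mder_const: "mder (\<lambda>_. A) 0 s"
  by (simp add: mder_def)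

lemma mder_add: "mder A A' s \<Longrightarrow> mder B B' s \<Longrightarrow> mder (\<lambda>s. A s + B s) (A' + B') s"
  by (simp add: mder_def has_vector_derivative_add)

lemma mder_diff: "mder A A' s \<Longrightarrow> mder B B' s \<Longrightarrow> mder (\<lambda>s. A s - B s) (A' - B') s"
  by (simp add: mder_def has_vector_derivative_diff)

lemma mder_minus: "mder A A' s \<Longrightarrow> mder (\<lambda>s. - A s) (- A') s"
  by (simp add: mder_def has_vector_derivative_minus)

lemma mder_mult:
  "mder A A' s \<Longrightarrow> mder B B' s \<Longrightarrow> mder (\<lambda>s. A s ** B s) (A' ** B s + A s ** B') s"
  unfolding mder_def matrix_matrix_mult_def
  by (auto simp: sum.distrib[symmetric] intro!: derivative_eq_intros sum.cong)

lemma mder_ct: "mder A A' s \<Longrightarrow> mder (\<lambda>s. ct (A s)) (ct A') s"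
  by (auto simp: mder_def intro!: has_vector_derivative_cnj)

lemma mder_transpose: "mder A A' s \<Longrightarrow> mder (\<lambda>s. transpose (A s)) (transpose A') s"
  by (simp add: mder_def transpose_def)

lemma mder_st: "mder A A' s \<Longrightarrow> mder (\<lambda>s. st (A s)) (st A') s"
  using mder_minus[OF mder_mult[OF mder_mult[OF mder_const[of sympJ] mder_transpose] mder_const[of sympJ]]]
  by (simp add: st_def)

lemma mder_mpow:
  assumes "mder A A' s"
  shows "mder (\<lambda>s. mpow (A s) k) (\<Sum>j<k. mpow (A s) j ** A' ** mpow (A s) (k - 1 - j)) s"
proof (induction k)
  case 0
  then show ?case using mder_const[of "mat 1" s] by simp
next
  case (Suc k)
  have "A' ** mpow (A s) k + A s ** (\<Sum>j<k. mpow (A s) j ** A' ** mpow (A s) (k - 1 - j))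
      = (\<Sum>j<Suc k. mpow (A s) j ** A' ** mpow (A s) (Suc k - 1 - j))"
    unfolding mm_sum_left sum.lessThan_Suc_shift by (simp add: matrix_mul_assoc)
  with mder_mult[OF assms Suc.IH] show ?case by simp
qed

lemma has_real_derivative_Re_trace:
  assumes "mder A A' s"
  shows "((\<lambda>s. Re (trace (A s))) has_real_derivative Re (trace A')) (at s)"
proof -
  have "((\<lambda>s. trace (A s)) has_vector_derivative trace A') (at s)"
    using assms unfolding trace_def mder_def by (intro has_vector_derivative_sum) auto
  then show ?thesis
    by (simp add: has_real_derivative_iff_has_vector_derivative has_vector_derivative_complex_iff)
qed

lemma mder_constant:
  assumes "\<And>s. mder A 0 s"
  shows "A s = A 0"
proof -
  have "A s $ i $ j = A 0 $ i $ j" for i j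
  proof -
    have "((\<lambda>s. A s $ i $ j) has_vector_derivative 0) (at s within UNIV)" for s
      using assms by (simp add: mder_def)
    then obtain c where "\<And>s. A s $ i $ j = c"
      using has_vector_derivative_zero_constant[of UNIV "\<lambda>s. A s $ i $ j"] by auto
    then show ?thesis by simp
  qed
  then show ?thesis by (simp add: vec_eq_iff)
qed

section \<open>One-parameter subgroups\<close>

lemma mpow_component_bound:
  fixes X :: "complex^'n^'n"
  obtains K where "\<And>n i j. cmod (mpow X n $ i $ j) \<le> K ^ n" "K \<ge> 0"
proof -
  define b where "b = (\<Sum>i\<in>UNIV. \<Sum>j\<in>UNIV. cmod (X $ i $ j))"
  have b: "(\<Sum>k\<in>UNIV. cmod (X $ i $ k)) \<le> b" for i
    unfolding b_def by (rule member_le_sum) (auto intro: sum_nonneg)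
  have b0: "b \<ge> 0" unfolding b_def by (intro sum_nonneg) auto
  have "cmod (mpow X n $ i $ j) \<le> b ^ n" for n i j
  proof (induction n arbitrary: i)
    case 0
    then show ?case by (simp add: mat_def)
  next
    case (Suc n)
    have "cmod (mpow X (Suc n) $ i $ j) \<le> (\<Sum>k\<in>UNIV. cmod (X $ i $ k * mpow X n $ k $ j))"
      by (simp add: matrix_matrix_mult_def norm_sum)
    also have "\<dots> \<le> (\<Sum>k\<in>UNIV. cmod (X $ i $ k) * b ^ n)"
      by (intro sum_mono) (simp add: norm_mult mult_left_mono Suc.IH)
    also have "\<dots> \<le> b * b ^ n"
      using b[of i] b0 by (simp add: sum_distrib_right[symmetric] mult_right_mono)
    finally show ?case by simp
  qed
  then show ?thesis using b0 that by blast
qed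

definition mexp :: "complex^'n^'n \<Rightarrow> real \<Rightarrow> complex^'n^'n" where
  "mexp X s = (\<chi> i j. suminf (\<lambda>n. mpow X n $ i $ j / fact n * of_real s ^ n))"

lemma mexp_0: "mexp X 0 = mat 1"
proof -
  have "mexp X 0 $ i $ j = mat 1 $ i $ j" for i j
    using powser_zero[of "\<lambda>n. mpow X n $ i $ j / fact n"] by (simp add: mexp_def)
  then show ?thesis by (simp add: vec_eq_iff)
qed

text \<open>Each entry is a scalar power series in \<open>s\<close>. Its coefficients are dominated
  by those of an exponential, so it may be differentiated termwise; shifting the index turns
  \<open>mpow X (Suc n)\<close> into \<open>X ** mpow X n\<close>.\<close>

lemma mder_mexp: "mder (mexp X) (X ** mexp X s) s"
  unfolding mder_def
proof (intro allI)
  fix i j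
  let ?c = "\<lambda>i n. mpow X n $ i $ j / fact n"
  obtain K where K: "\<And>n i j. cmod (mpow X n $ i $ j) \<le> K ^ n" "K \<ge> 0"
    using mpow_component_bound[of X] by blast
  have summ: "summable (\<lambda>n. ?c i n * y ^ n)" for i y
  proof (rule summable_comparison_test')
    show "summable (\<lambda>n. inverse (fact n) * (K * cmod y) ^ n)" by (rule summable_exp)
    fix n :: nat
    have "cmod (mpow X n $ i $ j) / fact n * cmod y ^ n \<le> K ^ n / fact n * cmod y ^ n"
      by (intro mult_right_mono divide_right_mono K) auto
    then show "norm (?c i n * y ^ n) \<le> inverse (fact n) * (K * cmod y) ^ n"
      by (simp add: norm_mult norm_divide norm_power power_mult_distrib field_simps)
  qed
  have "((\<lambda>x. suminf (\<lambda>n. ?c i n * x ^ n)) has_field_derivative (suminf (\<lambda>n. diffs (?c i) n * of_real s ^ n))) (at (of_real s))"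
    by (rule termdiffs_strong_converges_everywhere[OF summ])
  then have "((\<lambda>x. suminf (\<lambda>n. ?c i n * of_real x ^ n)) has_vector_derivative (suminf (\<lambda>n. diffs (?c i) n * of_real s ^ n))) (at s)"
    by (rule has_vector_derivative_real_field)
  moreover have "(suminf (\<lambda>n. diffs (?c i) n * of_real s ^ n)) = (X ** mexp X s) $ i $ j"
  proof -
    have "diffs (?c i) n * of_real s ^ n = (\<Sum>k\<in>UNIV. X $ i $ k * (?c k n * of_real s ^ n))" for n
    proof -
      have "diffs (?c i) n = (\<Sum>k\<in>UNIV. X $ i $ k * mpow X n $ k $ j) / fact n"
        by (simp add: diffs_def matrix_matrix_mult_def del: of_nat_Suc)
      then show ?thesis by (simp add: sum_divide_distrib sum_distrib_right mult.assoc)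
    qed
    then have "(suminf (\<lambda>n. diffs (?c i) n * of_real s ^ n)) = (suminf (\<lambda>n. \<Sum>k\<in>UNIV. X $ i $ k * (?c k n * of_real s ^ n)))"
      by simp
    also have "\<dots> = (\<Sum>k\<in>UNIV. suminf (\<lambda>n. X $ i $ k * (?c k n * of_real s ^ n)))"
      by (intro suminf_sum summable_mult summ)
    also have "\<dots> = (\<Sum>k\<in>UNIV. X $ i $ k * suminf (\<lambda>n. ?c k n * of_real s ^ n))"
      by (intro sum.cong refl suminf_mult summ)
    finally show ?thesis by (simp add: matrix_matrix_mult_def mexp_def)
  qed
  ultimately show "((\<lambda>s. mexp X s $ i $ j) has_vector_derivative (X ** mexp X s) $ i $ j) (at s)"
    by (simp add: mexp_def)
qed

text \<open>The products of \<open>mexp X s\<close> with its two adjoints have derivative 0 in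
  \<open>s\<close> and start at the identity. So both adjoints are left inverses and therefore
  equal.\<close>

lemma mexp_USp:
  assumes "lie X"
  shows "mexp X s \<in> USp"
proof -
  have X: "ct X = - X" "st X = - X" using assms by (auto simp: lie_def)
  have "mder (\<lambda>s. ct (mexp X s) ** mexp X s) 0 s" for s
    using mder_mult[OF mder_ct[OF mder_mexp[of X s]] mder_mexp[of X s]] X
    by (simp add: ct_mult mm_simps matrix_mul_assoc)
  then have 1: "ct (mexp X s) ** mexp X s = mat 1"
    using mder_constant[of "\<lambda>s. ct (mexp X s) ** mexp X s" s] by (simp add: mexp_0)
  have "mder (\<lambda>s. st (mexp X s) ** mexp X s) 0 s" for s
    using mder_mult[OF mder_st[OF mder_mexp[of X s]] mder_mexp[of X s]] X
    by (simp add: st_mult mm_simps matrix_mul_assoc)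
  then have 2: "st (mexp X s) ** mexp X s = mat 1"
    using mder_constant[of "\<lambda>s. st (mexp X s) ** mexp X s" s] by (simp add: mexp_0)
  have "mexp X s ** ct (mexp X s) = mat 1" using 1 by (simp add: matrix_left_right_inverse)
  then have "st (mexp X s) = st (mexp X s) ** (mexp X s ** ct (mexp X s))" by simp
  also have "\<dots> = ct (mexp X s)" unfolding matrix_mul_assoc 2 by simp
  finally have "st (mexp X s) = ct (mexp X s)" .
  with 1 show ?thesis by (simp add: USp_iff)
qed

text \<open>Under the trace the \<open>l\<close> terms of the noncommutative product rule coincide
  by cyclicity.\<close>

lemma has_real_derivative_htrace:
  assumes X: "ct X = - X" and M: "mder M (X ** M s) s"
  shows "((\<lambda>s. htrace (M s) l) has_real_derivative dhtrace X (M s) l) (at s)"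
proof -
  have h: "mder (\<lambda>s. herm (M s)) (dherm X (M s)) s"
    using mder_add[OF M mder_ct[OF M]] X by (simp add: herm_def dherm_def ct_mult mm_simps)
  have "trace (\<Sum>j<l. mpow (herm (M s)) j ** dherm X (M s) ** mpow (herm (M s)) (l - 1 - j))
     = of_nat l * trace (mpow (herm (M s)) (l - 1) ** dherm X (M s))"
  proof -
    have "trace (mpow (herm (M s)) j ** dherm X (M s) ** mpow (herm (M s)) (l - 1 - j))
       = trace (mpow (herm (M s)) (l - 1) ** dherm X (M s))" if "j < l" for j
    proof -
      have "trace (mpow (herm (M s)) j ** dherm X (M s) ** mpow (herm (M s)) (l - 1 - j))
          = trace (mpow (herm (M s)) (l - 1 - j) ** mpow (herm (M s)) j ** dherm X (M s))"
        by (metis matrix_mul_assoc trace_mul_sym)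
      then show ?thesis using that by (simp flip: mpow_add)
    qed
    then show ?thesis by (simp add: trace_sum)
  qed
  then have "Re (trace (\<Sum>j<l. mpow (herm (M s)) j ** dherm X (M s) ** mpow (herm (M s)) (l - 1 - j))) / 2
      = dhtrace X (M s) l"
    by (simp add: dhtrace_def)
  with DERIV_cdivide[OF has_real_derivative_Re_trace[OF mder_mpow[OF h, of l]], of 2]
  show ?thesis by (simp add: htrace_def)
qed

lemma has_real_derivative_sdfun:
  assumes X: "ct X = - X" and M: "mder M (X ** M s) s"
  shows "((\<lambda>s. sdfun X k ks (M s)) has_real_derivative dsdfun X k ks (M s)) (at s)"
proof -
  have h: "mder (\<lambda>s. herm (M s)) (dherm X (M s)) s"
    using mder_add[OF M mder_ct[OF M]] X by (simp add: herm_def dherm_def ct_mult mm_simps)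
  have "mder (\<lambda>s. dherm X (M s)) (ddherm X (M s)) s"
    using mder_diff[OF mder_mult[OF mder_const[of X] M] mder_mult[OF mder_ct[OF M] mder_const[of X]]] X
    by (simp add: dherm_def ddherm_def ct_mult mm_simps matrix_mul_assoc)
  from has_real_derivative_Re_trace[OF mder_mult[OF mder_mpow[OF h, of "k - 1"] this]]
  have 1: "((\<lambda>s. Re (trace (mpow (herm (M s)) (k - 1) ** dherm X (M s)))) has_real_derivative
      Re (trace ((\<Sum>j<k - 1. mpow (herm (M s)) j ** dherm X (M s) ** mpow (herm (M s)) (k - 2 - j)) ** dherm X (M s)))
       + Re (trace (mpow (herm (M s)) (k - 1) ** ddherm X (M s)))) (at s)"
    by (simp add: trace_add numeral_2_eq_2)
  have 2: "((\<lambda>s. mon (htrace (M s)) ks) has_real_derivative dmon (dhtrace X (M s)) (htrace (M s)) ks) (at s)"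
    by (rule has_real_derivative_mon[of "\<lambda>s. htrace (M s)", OF has_real_derivative_htrace[OF X M]])
  show ?thesis
    unfolding sdfun_def dsdfun_def
    by (rule DERIV_cong[OF DERIV_mult[OF 1 2]]) (simp add: algebra_simps)
qed

section \<open>Continuity and compactness\<close>

lemma continuous_on_mm [continuous_intros]:
  "continuous_on S f \<Longrightarrow> continuous_on S g \<Longrightarrow> continuous_on S (\<lambda>x. f x ** (g x :: complex^'n^'n) :: complex^'n^'n)"
  unfolding matrix_matrix_mult_def by (intro continuous_intros)

lemma continuous_on_ct [continuous_intros]:
  "continuous_on S f \<Longrightarrow> continuous_on S (\<lambda>x. ct (f x))"
  unfolding ct_def map_matrix_def transpose_def by (simp, intro continuous_intros)

lemma continuous_on_transpose [continuous_intros]: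
  "continuous_on S f \<Longrightarrow> continuous_on S (\<lambda>x. transpose (f x :: complex^'n^'n))"
  unfolding transpose_def by (intro continuous_intros)

lemma continuous_on_trace [continuous_intros]:
  "continuous_on S f \<Longrightarrow> continuous_on S (\<lambda>x. trace (f x :: complex^'n^'n))"
  unfolding trace_def by (intro continuous_intros)

lemma continuous_on_mpow [continuous_intros]:
  "continuous_on S f \<Longrightarrow> continuous_on S (\<lambda>x. mpow (f x) k)"
  by (induction k) (auto intro!: continuous_intros)

lemma continuous_on_herm [continuous_intros]:
  "continuous_on S herm" "continuous_on S (dherm X)" "continuous_on S (ddherm X)"
  unfolding herm_def[abs_def] dherm_def[abs_def] ddherm_def[abs_def] by (intro continuous_intros)+

lemma continuous_on_htrace [continuous_intros]:
  "continuous_on S (\<lambda>m. htrace m k)" "continuous_on S (\<lambda>m. dhtrace X m k)"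
  unfolding htrace_def dhtrace_def by (intro continuous_intros; simp)+

lemma continuous_on_sdfun: "continuous_on S (sdfun X k ks)" "continuous_on S (dsdfun X k ks)"
  unfolding sdfun_def[abs_def] dsdfun_def[abs_def] by (intro continuous_intros)+

lemma compact_USp: "compact (USp :: ('g::finite) cmat2 set)"
proof -
  have eq: "USp = {m :: 'g cmat2. ct m ** m = mat 1} \<inter> {m. st m = ct m}"
    by (auto simp: USp_iff)
  have "closed {m :: 'g cmat2. ct m ** m = mat 1}"
    by (intro closed_Collect_eq continuous_intros)
  moreover have "closed {m :: 'g cmat2. st m = ct m}"
    unfolding st_def by (intro closed_Collect_eq continuous_intros)
  ultimately have "closed (USp :: 'g cmat2 set)" unfolding eq by (rule closed_Int)
  moreover have "bounded (USp :: 'g cmat2 set)"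
  proof -
    have "norm m \<le> (\<Sum>i\<in>(UNIV :: ('g + 'g) set). \<Sum>j\<in>(UNIV :: ('g + 'g) set). 1)" if "m \<in> USp" for m :: "'g cmat2"
    proof -
      \<comment> \<open>The columns of a unitary matrix are unit vectors.\<close>
      have "cmod (m $ i $ j) \<le> 1" for i j
      proof -
        have "(ct m ** m) $ j $ j = 1" using USpD(1)[OF that] by (simp add: mat_def)
        then have "(\<Sum>k\<in>UNIV. of_real ((cmod (m $ k $ j))\<^sup>2)) = (1 :: complex)"
          unfolding complex_norm_square by (simp add: matrix_matrix_mult_def mult.commute)
        then have "(\<Sum>k\<in>UNIV. (cmod (m $ k $ j))\<^sup>2) = 1"
          unfolding of_real_sum[symmetric] by (simp only: of_real_eq_1_iff)
        moreover have "(cmod (m $ i $ j))\<^sup>2 \<le> (\<Sum>k\<in>UNIV. (cmod (m $ k $ j))\<^sup>2)"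
          by (rule member_le_sum) auto
        ultimately show ?thesis by (simp add: power_le_one_iff abs_square_le_1)
      qed
      then show ?thesis
        unfolding norm_vec_def
        by (intro order_trans[OF L2_set_le_sum] sum_mono) (auto intro!: order_trans[OF L2_set_le_sum] sum_mono)
    qed
    then show ?thesis unfolding bounded_iff by blast
  qed
  ultimately show ?thesis by (simp add: compact_eq_bounded_closed)
qed

section \<open>Consequences of the invariance of Haar measure\<close>

context
  fixes \<mu> :: "('g::finite) cmat2 measure"
  assumes haar: "is_normalized_Haar \<mu>"
begin

lemma haar_space: "space \<mu> = USp"
proof -
  have "sets \<mu> = sets (restrict_space borel USp)" using haar by (simp add: is_normalized_Haar_def)
  from sets_eq_imp_space_eq[OF this] show ?thesis by (simp add: space_restrict_space)
qed

lemma haar_prob: "prob_space \<mu>"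
  using haar by (simp add: is_normalized_Haar_def)

lemma haar_measurable:
  assumes "continuous_on UNIV F"
  shows "F \<in> borel_measurable \<mu>"
proof -
  have "sets \<mu> = sets (restrict_space borel USp)" using haar by (simp add: is_normalized_Haar_def)
  then show ?thesis
    using measurable_restrict_space1[OF borel_measurable_continuous_onI[OF assms], of USp] measurable_cong_sets by blast
qed

lemma haar_bounded:
  fixes F :: "'g cmat2 \<Rightarrow> real"
  assumes "continuous_on UNIV F"
  obtains B where "\<And>m. m \<in> USp \<Longrightarrow> \<bar>F m\<bar> \<le> B"
proof -
  have "compact (F ` USp)"
    by (intro compact_continuous_image continuous_on_subset[OF assms] compact_USp) auto
  from compact_imp_bounded[OF this] show ?thesis
    using that unfolding bounded_iff by fastforce
qed

lemma haar_integrable: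
  fixes F :: "'g cmat2 \<Rightarrow> real"
  assumes "continuous_on UNIV F"
  shows "integrable \<mu> F"
proof -
  interpret prob_space \<mu> by (rule haar_prob)
  obtain B where B: "\<And>m. m \<in> USp \<Longrightarrow> \<bar>F m\<bar> \<le> B" using haar_bounded[OF assms] by blast
  show ?thesis
    by (rule integrable_const_bound[where B = B]) (use B haar_measurable[OF assms] in \<open>auto simp: haar_space\<close>)
qed

lemma haar_invariant:
  fixes F :: "'g cmat2 \<Rightarrow> real"
  assumes "continuous_on UNIV F" and u: "u \<in> USp"
  shows "(\<integral>m. F (u ** m) \<partial>\<mu>) = (\<integral>m. F m \<partial>\<mu>)"
proof -
  have s: "sets \<mu> = sets (restrict_space borel USp)" using haar by (simp add: is_normalized_Haar_def)
  have "(\<lambda>m :: 'g cmat2. u ** m) \<in> borel_measurable borel"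
  proof (rule borel_measurable_continuous_onI)
    show "continuous_on UNIV (\<lambda>m :: 'g cmat2. u ** m)"
      using continuous_on_mm[OF continuous_on_const[of UNIV u] continuous_on_id[of UNIV]] by simp
  qed
  then have "(\<lambda>m. u ** m) \<in> measurable (restrict_space borel USp) (restrict_space borel USp)"
    using u USp_mult by (intro measurable_restrict_space2 measurable_restrict_space1) (auto simp: space_restrict_space)
  then have "(\<lambda>m. u ** m) \<in> measurable \<mu> \<mu>"
    using measurable_cong_sets[OF s s] by blast
  then have "(\<integral>m. F m \<partial>(distr \<mu> \<mu> (\<lambda>m. u ** m))) = (\<integral>m. F (u ** m) \<partial>\<mu>)"
    by (rule integral_distr[OF _ haar_measurable[OF assms(1)]])
  moreover have "distr \<mu> \<mu> (\<lambda>m. u ** m) = \<mu>"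
    using haar u by (simp add: is_normalized_Haar_def)
  ultimately show ?thesis by simp
qed

lemma schwinger_dyson:
  assumes X: "lie X"
  shows "(\<integral>m. dsdfun X k ks m \<partial>\<mu>) = 0"
proof -
  interpret prob_space \<mu> by (rule haar_prob)
  obtain B where B: "\<And>m. m \<in> USp \<Longrightarrow> \<bar>dsdfun X k ks m\<bar> \<le> B"
    using haar_bounded[OF continuous_on_sdfun(2)] by blast
  \<comment> \<open>The derivative at time \<open>s\<close> is \<open>dsdfun\<close> at the
    transported point, which is again in the group; its maximum over the compact group is a constant
    dominating function.\<close>
  have "integral\<^sup>L \<mu> ((\<lambda>s m. dsdfun X k ks (mexp X s ** m)) 0) = 0"
  proof (rule integral_flow_derivative_zero[where H = "\<lambda>s m. sdfun X k ks (mexp X s ** m)" and B = "\<lambda>_. B"])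
    fix s :: real
    show "(\<integral>m. sdfun X k ks (mexp X s ** m) \<partial>\<mu>) = (\<integral>m. sdfun X k ks (mexp X 0 ** m) \<partial>\<mu>)"
      using haar_invariant[OF continuous_on_sdfun(1) mexp_USp[OF X]] by simp
    show "integrable \<mu> (\<lambda>m. sdfun X k ks (mexp X s ** m))"
      by (intro haar_integrable continuous_on_compose2[OF continuous_on_sdfun(1)] continuous_intros) auto
    fix m assume "m \<in> space \<mu>"
    then have "mexp X s ** m \<in> USp"
      by (intro USp_mult mexp_USp X) (simp add: haar_space)
    then show "\<bar>dsdfun X k ks (mexp X s ** m)\<bar> \<le> B" by (rule B)
    have "mder (\<lambda>s. mexp X s ** m) (X ** (mexp X s ** m)) s"
      using mder_mult[OF mder_mexp[of X s] mder_const[of m s]] by (simp add: matrix_mul_assoc)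
    then show "((\<lambda>s. sdfun X k ks (mexp X s ** m)) has_real_derivative dsdfun X k ks (mexp X s ** m)) (at s)"
      using X by (intro has_real_derivative_sdfun) (auto simp: lie_def)
  qed simp
  then show ?thesis by (simp add: mexp_0)
qed

lemma haar_loop:
  assumes "k \<ge> 1"
  shows "(\<integral>m. loop k ks (htrace m) \<partial>\<mu>) = 0"
proof -
  have "16 * (\<integral>m. loop k ks (htrace m) \<partial>\<mu>) = (\<integral>m. 16 * loop k ks (htrace m) \<partial>\<mu>)" by simp
  also have "\<dots> = (\<integral>m. (\<Sum>x\<in>UNIV. dsdfun (lie_frame x) k ks m) \<partial>\<mu>)"
    by (intro Bochner_Integration.integral_cong refl sum_dsdfun[symmetric] assms) (simp add: haar_space)
  also have "\<dots> = (\<Sum>x\<in>UNIV. \<integral>m. dsdfun (lie_frame x) k ks m \<partial>\<mu>)"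
    by (intro Bochner_Integration.integral_sum haar_integrable continuous_on_sdfun)
  also have "\<dots> = 0" using schwinger_dyson[OF lie_lie_frame] by simp
  finally show ?thesis by simp
qed

end

section \<open>Eigenvalues\<close>

text \<open>The Hermitian form, antilinear in the first argument. Its real part is the real inner
  product, through which real dimension counts and orthogonal complements become available.\<close>

definition hip :: "complex^'n \<Rightarrow> complex^'n \<Rightarrow> complex" where
  "hip v w = (\<Sum>i\<in>UNIV. cnj (v $ i) * w $ i)"

lemma hip_add_right: "hip v (w + w') = hip v w + hip v w'"
  by (simp add: hip_def sum.distrib algebra_simps)

lemma hip_scale_right: "hip v (c *s w) = c * hip v w"
  by (simp add: hip_def sum_distrib_left ac_simps)

lemma hip_scaleR_right: "hip v (c *\<^sub>R w) = of_real c * hip v w"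
  by (simp add: hip_def sum_distrib_left scaleR_conv_of_real[where 'a = complex] ac_simps)

lemma hip_zero_right [simp]: "hip v 0 = 0"
  by (simp add: hip_def)

lemma hip_scale_left: "hip (c *s v) w = cnj c * hip v w"
  by (simp add: hip_def sum_distrib_left ac_simps)

lemma hip_cnj: "cnj (hip v w) = hip w v"
  by (simp add: hip_def mult.commute)

lemma Re_hip: "Re (hip v w) = v \<bullet> w"
  by (simp add: hip_def inner_vec_def inner_complex_def)

lemma Im_hip: "Im (hip v w) = (\<i> *s v) \<bullet> w"
  by (simp add: hip_def inner_vec_def inner_complex_def)

lemma hip_self: "hip v v = of_real ((norm v)\<^sup>2)"
  using Re_hip[of v v] hip_cnj[of v v] by (simp add: complex_eq_iff power2_norm_eq_inner)

lemma hip_mult: "hip v (A *v w) = hip (ct A *v v) w"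
proof -
  have "hip v (A *v w) = (\<Sum>i\<in>UNIV. \<Sum>j\<in>UNIV. cnj (v $ i) * (A $ i $ j * w $ j))"
    by (simp add: hip_def matrix_vector_mult_def sum_distrib_left)
  also have "\<dots> = (\<Sum>j\<in>UNIV. \<Sum>i\<in>UNIV. cnj (v $ i) * (A $ i $ j * w $ j))"
    by (rule sum.swap)
  also have "\<dots> = hip (ct A *v v) w"
    by (simp add: hip_def matrix_vector_mult_def sum_distrib_left sum_distrib_right mult_ac)
  finally show ?thesis .
qed

definition qconj :: "complex^('g + 'g) \<Rightarrow> complex^('g::finite + 'g)" where
  "qconj v = sympJ *v (\<chi> i. cnj (v $ i))"

lemma qconj_component: "qconj v $ i = (\<Sum>k\<in>UNIV. sympJ $ i $ k * cnj (v $ k))"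
  by (simp add: qconj_def matrix_vector_mult_def)

text \<open>This is the skewness of J. For equal arguments it says that a vector is orthogonal to
  its quaternionic conjugate, which makes eigenvectors come in orthogonal pairs.\<close>

lemma hip_qconj_skew: "hip v (qconj w) = - hip w (qconj v)"
proof -
  have "hip v (qconj w) = (\<Sum>i\<in>UNIV. \<Sum>k\<in>UNIV. cnj (v $ i) * (sympJ $ i $ k * cnj (w $ k)))"
    by (simp add: hip_def qconj_component sum_distrib_left)
  also have "\<dots> = (\<Sum>k\<in>UNIV. \<Sum>i\<in>UNIV. cnj (v $ i) * (sympJ $ i $ k * cnj (w $ k)))"
    by (rule sum.swap)
  also have "\<dots> = (\<Sum>k\<in>UNIV. \<Sum>i\<in>UNIV. - (cnj (w $ k) * (sympJ $ k $ i * cnj (v $ i))))"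
  proof (intro sum.cong refl)
    fix i k
    show "cnj (v $ i) * (sympJ $ i $ k * cnj (w $ k)) = - (cnj (w $ k) * (sympJ $ k $ i * cnj (v $ i)))"
      using sympJ_skew[of k i] by simp
  qed
  also have "\<dots> = - hip w (qconj v)"
    by (simp add: hip_def qconj_component sum_distrib_left sum_negf)
  finally show ?thesis .
qed

lemma hip_qconj_self: "hip v (qconj v) = 0"
  using hip_qconj_skew[of v v] by simp

lemma qconj_qconj: "qconj (qconj v) = - v"
proof -
  have "(\<chi> i. cnj (qconj v $ i)) = sympJ *v v"
    by (simp add: vec_eq_iff qconj_component sympJ_cnj matrix_vector_mult_def)
  then have "qconj (qconj v) = (sympJ ** sympJ) *v v"
    by (simp add: qconj_def[of "qconj v"] matrix_vector_mul_assoc)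
  also have "\<dots> = - v"
    by (simp add: sympJ_square vec_eq_iff matrix_vector_mult_def mat_def sum_negf if_distrib if_distribR cong: if_cong)
  finally show ?thesis .
qed

lemma hip_qconj_qconj: "hip (qconj v) (qconj w) = hip w v"
  using hip_qconj_skew[of "qconj v" w] hip_cnj[of "qconj v" "qconj w"] hip_cnj[of w v]
  by (simp add: qconj_qconj) (simp add: hip_def sum_negf)

lemma qconj_scale_real: "qconj (of_real t *s v) = of_real t *s qconj v"
  by (simp add: vec_eq_iff qconj_component sum_distrib_left mult_ac)

text \<open>\<open>st A = A\<close> lets J pass across \<open>A\<close> at the cost of a transpose,
  and \<open>ct A = A\<close> says that the conjugate is the transpose. The two effects
  cancel.\<close>

lemma qconj_mult:
  assumes "ct A = A" "st A = A"
  shows "A *v qconj v = qconj (A *v v)"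
proof -
  have "A ** sympJ = st A ** sympJ" using assms by simp
  also have "\<dots> = - (sympJ ** transpose A ** (sympJ ** sympJ))"
    unfolding st_def mm_minus_left matrix_mul_assoc ..
  also have "\<dots> = sympJ ** transpose A" by (simp add: sympJ_square mm_simps)
  finally have "sympJ ** transpose A = A ** sympJ" ..
  moreover have "(\<chi> i. cnj ((A *v v) $ i)) = transpose A *v (\<chi> i. cnj (v $ i))"
  proof -
    have "cnj (A $ i $ j) = A $ j $ i" for i j using arg_cong[OF assms(1), of "\<lambda>A. A $ j $ i"] by simp
    then show ?thesis by (simp add: vec_eq_iff matrix_vector_mult_def transpose_def)
  qed
  ultimately show ?thesis
    by (simp add: qconj_def matrix_vector_mul_assoc del: transpose_matrix_vector)
qed

text \<open>A maximiser \<open>w\<close> of the Rayleigh quotient on the unit sphere of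
  \<open>E\<close> is an eigenvector: otherwise moving it along the residual \<open>r\<close>, which
  stays in \<open>E\<close> by invariance, would increase the quotient. Only a real subspace is
  involved.\<close>

lemma hermitian_eigenvector:
  fixes h :: "complex^'n^'n" and E :: "(complex^'n) set"
  assumes h: "ct h = h" and E: "subspace E" "\<And>w. w \<in> E \<Longrightarrow> h *v w \<in> E" and ne: "\<exists>w\<in>E. w \<noteq> 0"
  shows "\<exists>w\<in>E. \<exists>t::real. norm w = 1 \<and> h *v w = of_real t *s w \<and> t = w \<bullet> (h *v w)"
proof -
  have scale: "of_real c *s x = c *\<^sub>R x" for c and x :: "complex^'n"
    by (simp add: vec_eq_iff scaleR_conv_of_real[where 'a = complex])
  have lin: "h *v (x + y) = h *v x + h *v y" "h *v (c *\<^sub>R x) = c *\<^sub>R (h *v x)" for x y c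
    by (simp_all add: vec_eq_iff matrix_vector_mult_def scaleR_sum_right sum.distrib algebra_simps)
  have sa: "x \<bullet> (h *v y) = y \<bullet> (h *v x)" for x y
    using Re_hip hip_mult[of x h y] h by (metis inner_commute)
  let ?K = "E \<inter> sphere 0 1"
  obtain w0 where w0: "w0 \<in> E" "w0 \<noteq> 0" using ne by blast
  have "w0 /\<^sub>R norm w0 \<in> ?K" using w0 E(1) by (simp add: subspace_scale)
  then have "?K \<noteq> {}" by blast
  moreover have "compact ?K"
    using closed_subspace[OF E(1)] by (simp add: closed_Int_compact)
  moreover have "continuous_on ?K (\<lambda>w. w \<bullet> (h *v w))"
    by (intro continuous_intros matrix_vector_mult_linear_continuous_on)
  ultimately obtain w where w: "w \<in> ?K" and max: "\<And>x. x \<in> ?K \<Longrightarrow> x \<bullet> (h *v x) \<le> w \<bullet> (h *v w)"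
    using continuous_attains_sup[of ?K "\<lambda>w. w \<bullet> (h *v w)"] by blast
  define t where "t = w \<bullet> (h *v w)"
  have wE: "w \<in> E" and w1: "norm w = 1" using w by auto
  have max': "x \<bullet> (h *v x) \<le> t * (x \<bullet> x)" if "x \<in> E" for x
  proof (cases "x = 0")
    case False
    have "(x /\<^sub>R norm x) \<bullet> (h *v (x /\<^sub>R norm x)) \<le> t"
      unfolding t_def using that False E(1) by (intro max) (simp add: subspace_scale)
    then have "(x \<bullet> (h *v x)) / (norm x)\<^sup>2 \<le> t"
      using False by (simp add: lin power2_eq_square field_simps)
    then show ?thesis using False by (simp add: power2_norm_eq_inner field_simps)
  qed (simp add: matrix_vector_mult_0_right)
  define r where "r = h *v w - t *\<^sub>R w"
  have rE: "r \<in> E" unfolding r_def using wE E by (simp add: subspace_diff subspace_scale)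
  define c where "c = \<bar>r \<bullet> (h *v r) - t * (r \<bullet> r)\<bar> + 1"
  have c: "c > 0" "- c \<le> r \<bullet> (h *v r) - t * (r \<bullet> r)" by (auto simp: c_def)
  have key: "2 * e * (r \<bullet> r) + e\<^sup>2 * (r \<bullet> (h *v r) - t * (r \<bullet> r)) \<le> 0" for e
  proof -
    have 1: "(w + e *\<^sub>R r) \<bullet> (h *v (w + e *\<^sub>R r)) \<le> t * ((w + e *\<^sub>R r) \<bullet> (w + e *\<^sub>R r))"
      using max'[of "w + e *\<^sub>R r"] wE rE E(1) by (simp add: subspace_add subspace_scale)
    have 2: "(w + e *\<^sub>R r) \<bullet> (h *v (w + e *\<^sub>R r)) = t + 2 * e * (r \<bullet> (h *v w)) + e\<^sup>2 * (r \<bullet> (h *v r))"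
      using sa[of w r] by (simp add: lin inner_add_left inner_add_right t_def power2_eq_square algebra_simps)
    have 3: "(w + e *\<^sub>R r) \<bullet> (w + e *\<^sub>R r) = 1 + 2 * e * (r \<bullet> w) + e\<^sup>2 * (r \<bullet> r)"
      using w1 by (simp add: inner_add_left inner_add_right norm_eq_1 power2_eq_square inner_commute algebra_simps)
    have 4: "r \<bullet> (h *v w) = r \<bullet> r + t * (r \<bullet> w)"
      by (simp add: r_def inner_diff_right inner_diff_left algebra_simps)
    show ?thesis using 1 unfolding 2 3 4 by (simp add: algebra_simps)
  qed
  have "r \<bullet> r = 0"
  proof (rule ccontr)
    assume "r \<bullet> r \<noteq> 0"
    then have rr: "r \<bullet> r > 0" by (simp add: order.not_eq_order_implies_strict)
    \<comment> \<open>With this step size the quadratic term of \<open>key\<close> can cancel at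
      most half of the linear one.\<close>
    let ?e = "(r \<bullet> r) / c"
    have "?e\<^sup>2 * (- c) \<le> ?e\<^sup>2 * (r \<bullet> (h *v r) - t * (r \<bullet> r))"
      using c by (intro mult_left_mono) auto
    moreover have "?e\<^sup>2 * (- c) = - ?e * (r \<bullet> r)" using c by (simp add: power2_eq_square)
    ultimately have "2 * ?e * (r \<bullet> r) - ?e * (r \<bullet> r) \<le> 0" using key[of ?e] by linarith
    moreover have "?e * (r \<bullet> r) > 0" using rr c by simp
    ultimately show False by linarith
  qed
  then have "h *v w = of_real t *s w" by (simp add: r_def scale)
  then show ?thesis using wE w1 t_def by blast
qed

text \<open>\<open>qconj\<close> is an antiunitary map of square \<open>- 1\<close> commuting with \<open>herm m\<close>, so every eigenvalue occurs
  twice.\<close>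

lemma quaternionic_eigenbasis:
  fixes m :: "('g::finite) cmat2" and A :: "'g set"
  assumes m: "m \<in> USp" and "finite A"
  shows "\<exists>v t. \<forall>a\<in>A. herm m *v v a = complex_of_real (t a) *s v a \<and> \<bar>t a\<bar> \<le> 2 \<and>
    (\<forall>b\<in>A. hip (v a) (v b) = (if a = b then 1 else 0) \<and> hip (v a) (qconj (v b)) = 0)"
  using assms(2)
proof (induction A rule: finite_induct)
  case (insert a A)
  let ?h = "herm m"
  obtain v t where v: "\<And>a. a \<in> A \<Longrightarrow> ?h *v v a = complex_of_real (t a) *s v a"
    "\<And>a. a \<in> A \<Longrightarrow> \<bar>t a\<bar> \<le> (2::real)"
    "\<And>a b. a \<in> A \<Longrightarrow> b \<in> A \<Longrightarrow> hip (v a) (v b) = (if a = b then 1 else 0)"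
    "\<And>a b. a \<in> A \<Longrightarrow> b \<in> A \<Longrightarrow> hip (v a) (qconj (v b)) = 0"
    using insert.IH by blast
  have h: "ct ?h = ?h" "st ?h = ?h" using st_herm[OF m] by simp_all
  have hv': "?h *v qconj (v b) = complex_of_real (t b) *s qconj (v b)" if "b \<in> A" for b
    using v(1)[OF that] qconj_mult[OF h, of "v b"] by (simp add: qconj_scale_real)
  define E where "E = {w. \<forall>b\<in>A. hip (v b) w = 0 \<and> hip (qconj (v b)) w = 0}"
  have "subspace E"
    unfolding subspace_def E_def by (auto simp: hip_add_right hip_scaleR_right)
  moreover have "?h *v w \<in> E" if "w \<in> E" for w
    using that by (auto simp: E_def hip_mult h v(1) hv' hip_scale_left)
  moreover have "\<exists>w\<in>E. w \<noteq> 0"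
  proof -
    \<comment> \<open>The multiples by \<open>\<i>\<close> make real orthogonality to this set the
      same as complex orthogonality. It has at most four vectors for each element of
      \<open>A\<close>, fewer than the real dimension 4g, so the complement is nonzero.\<close>
    let ?S = "v ` A \<union> (\<lambda>b. \<i> *s v b) ` A \<union> ((\<lambda>b. qconj (v b)) ` A \<union> (\<lambda>b. \<i> *s qconj (v b)) ` A)"
    have fin: "finite ?S" using insert.hyps by simp
    have "card ?S \<le> (card A + card A) + (card A + card A)"
      by (intro order_trans[OF card_Un_le] add_mono card_image_le insert.hyps)
    moreover have "card A < CARD('g)"
      using insert.hyps by (metis card_seteq finite linorder_not_less subset_UNIV UNIV_I)
    moreover have "dim ?S \<le> card ?S" using fin by (rule dim_le_card')
    moreover have "DIM(complex^('g + 'g)) = 4 * CARD('g)" by (simp add: card_UNIV_sum)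
    ultimately have "dim ?S < DIM(complex^('g + 'g))" by linarith
    then obtain w where w: "w \<noteq> 0" "\<And>y. y \<in> span ?S \<Longrightarrow> orthogonal w y"
      using orthogonal_to_subspace_exists[of ?S] by metis
    then have o: "y \<bullet> w = 0" if "y \<in> ?S" for y
      using that span_base[of y ?S] by (metis orthogonal_def inner_commute)
    have "hip (v b) w = 0 \<and> hip (qconj (v b)) w = 0" if "b \<in> A" for b
      using that o[of "v b"] o[of "\<i> *s v b"] o[of "qconj (v b)"] o[of "\<i> *s qconj (v b)"]
      by (auto simp: complex_eq_iff Re_hip Im_hip)
    then show ?thesis using w(1) by (auto simp: E_def)
  qed
  ultimately obtain w s where w: "w \<in> E" "norm w = 1" "?h *v w = complex_of_real s *s w" "s = w \<bullet> (?h *v w)"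
    using hermitian_eigenvector[OF h(1), of E] by blast
  \<comment> \<open>Both halves of \<open>herm m\<close> contribute the real part of the product of
    \<open>w\<close> and \<open>m w\<close>, which is at most 1 in modulus because \<open>m\<close>
    is an isometry.\<close>
  have s2: "\<bar>s\<bar> \<le> 2"
  proof -
    have "norm (m *v w) = 1"
    proof -
      have "hip (m *v w) (m *v w) = hip w w"
        by (simp add: hip_mult matrix_vector_mul_assoc USpD[OF m])
      then show ?thesis using w(2) by (simp add: hip_self) (metis norm_ge_zero of_real_eq_1_iff of_real_power power2_eq_1_iff norm_not_less_zero zero_less_one neg_less_0_iff_less)
    qed
    moreover have "w \<bullet> (ct m *v w) = w \<bullet> (m *v w)"
      using hip_mult[of w "ct m" w] Re_hip by (metis ct_simps(4) inner_commute)
    then have "s = 2 * (w \<bullet> (m *v w))"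
      using w(4) by (simp add: herm_def matrix_vector_mult_add_rdistrib inner_add_right)
    ultimately show ?thesis
      using Cauchy_Schwarz_ineq2[of w "m *v w"] w(2) by simp
  qed
  have "hip w w = 1" using w(2) by (simp add: hip_self)
  moreover have "hip w (qconj w) = 0" by (rule hip_qconj_self)
  moreover have 1: "hip (v b) w = 0" "hip (qconj (v b)) w = 0" if "b \<in> A" for b
    using w(1) that by (auto simp: E_def)
  moreover have "hip w (v b) = 0" "hip w (qconj (v b)) = 0" if "b \<in> A" for b
    using 1[OF that] hip_cnj complex_cnj_zero by metis+
  moreover have "hip (v b) (qconj w) = 0" if "b \<in> A" for b
    using hip_qconj_skew[of "v b" w] calculation(6)[OF that] by simp
  ultimately show ?case
    using insert.hyps v w s2
    by (intro exI[of _ "v(a := w)"] exI[of _ "t(a := s)"]) auto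
qed simp

text \<open>The vectors \<open>v a\<close> and their quaternionic conjugates form an orthonormal
  eigenbasis of all 2g dimensions. Each \<open>t a\<close> occurs twice in the trace, and
  \<open>htrace\<close> halves it.\<close>

lemma USp_eigenvalues:
  fixes m :: "('g::finite) cmat2"
  assumes m: "m \<in> USp"
  shows "\<exists>y \<in> (cube :: (real^'g) set). htrace m = psums y"
proof -
  obtain v :: "'g \<Rightarrow> complex^('g + 'g)" and t where v: "\<And>a. herm m *v v a = complex_of_real (t a) *s v a" "\<And>a. \<bar>t a\<bar> \<le> (2::real)"
    "\<And>a b. hip (v a) (v b) = (if a = b then 1 else 0)" "\<And>a b. hip (v a) (qconj (v b)) = 0"
  proof -
    from quaternionic_eigenbasis[OF m finite[of UNIV]] obtain v t where
      "\<forall>a\<in>(UNIV :: 'g set). herm m *v v a = complex_of_real (t a) *s v a \<and> \<bar>t a\<bar> \<le> 2 \<and>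
        (\<forall>b\<in>(UNIV :: 'g set). hip (v a) (v b) = (if a = b then 1 else 0) \<and> hip (v a) (qconj (v b)) = 0)"
      by (elim exE)
    then show ?thesis by (intro that[of v t]) auto
  qed
  let ?h = "herm m"
  have h: "ct ?h = ?h" "st ?h = ?h" using st_herm[OF m] by simp_all
  define u where "u = case_sum v (\<lambda>a. qconj (v a))"
  define s where "s = case_sum t t"
  have hu: "?h *v u j = complex_of_real (s j) *s u j" for j
    using v(1) qconj_mult[OF h] by (cases j) (simp_all add: u_def s_def qconj_scale_real)
  have uu: "hip (u i) (u j) = (if i = j then 1 else 0)" for i j
  proof -
    have "hip (qconj (v a)) (v b) = 0" for a b using v(4) hip_cnj complex_cnj_zero by metis
    then show ?thesis using v by (cases i; cases j) (auto simp: u_def hip_qconj_qconj)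
  qed
  define W where "W = (\<chi> i j. u j $ i)"
  have "ct W ** W = mat 1"
    using uu by (simp add: vec_eq_iff matrix_matrix_mult_def W_def hip_def mat_def)
  then have WW: "W ** ct W = mat 1" by (simp add: matrix_left_right_inverse)
  have hk: "mpow ?h k *v u j = complex_of_real (s j ^ k) *s u j" for k j
  proof (induction k)
    case (Suc k)
    have "mpow ?h (Suc k) *v u j = ?h *v (complex_of_real (s j ^ k) *s u j)"
      using Suc by (simp flip: matrix_vector_mul_assoc)
    also have "\<dots> = complex_of_real (s j ^ k) *s (?h *v u j)"
      by (simp add: vector_scalar_commute)
    finally show ?case by (simp add: hu vector_smult_assoc mult.commute)
  qed simp
  have "htrace m k = psum k (\<chi> a. t a)" for k
  proof -
    have "trace (mpow ?h k) = trace (mpow ?h k ** (W ** ct W))" by (simp add: WW)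
    also have "\<dots> = trace (ct W ** (mpow ?h k ** W))"
      by (metis matrix_mul_assoc trace_mul_sym)
    also have "\<dots> = (\<Sum>j\<in>UNIV. hip (u j) (mpow ?h k *v u j))"
      by (simp add: trace_def matrix_matrix_mult_def W_def hip_def matrix_vector_mult_def)
    also have "\<dots> = (\<Sum>j\<in>UNIV. complex_of_real (s j ^ k))"
      by (simp add: hk hip_scale_right uu)
    also have "\<dots> = complex_of_real (2 * (\<Sum>a\<in>UNIV. t a ^ k))"
      by (simp add: UNIV_Plus_UNIV[symmetric] sum.Plus s_def del: UNIV_Plus_UNIV)
    finally show ?thesis
      unfolding trace_mpow_herm of_real_eq_iff by (simp add: psum_def)
  qed
  moreover have "(\<chi> a. t a) \<in> (cube :: (real^'g) set)" using v(2) by (simp add: cube_def)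
  ultimately show ?thesis by (intro bexI[of _ "\<chi> a. t a"]) auto
qed

section \<open>The total mass of the Weyl weight\<close>

text \<open>Chebyshev polynomials of the second kind in the variable t / 2: the scaling that makes
  them monic and orthogonal for the semicircle weight on [-2, 2].\<close>

fun cheb :: "nat \<Rightarrow> real poly" where
  "cheb 0 = 1"
| "cheb (Suc 0) = [:0, 1:]"
| "cheb (Suc (Suc n)) = [:0, 1:] * cheb (Suc n) - cheb n"

lemma cheb_monic: "degree (cheb n) = n \<and> lead_coeff (cheb n) = 1"
proof (induction n rule: cheb.induct)
  case (3 n)
  let ?p = "[:0, 1:] * cheb (Suc n)"
  have nz: "cheb (Suc n) \<noteq> 0" using 3 by auto
  have deg: "degree ?p = Suc (Suc n)"
    using 3 nz by (subst degree_mult_eq) auto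
  have "degree (- cheb n) < degree ?p" using 3 deg by simp
  from degree_add_eq_left[OF this] show ?case
  proof -
    have "coeff (cheb (Suc n)) (Suc n) = 1" using 3 by metis
    moreover have "coeff (cheb n) (Suc (Suc n)) = 0" using 3 by (intro coeff_eq_0) simp
    moreover have "degree (cheb (Suc (Suc n))) = Suc (Suc n)"
      using \<open>degree (?p + - cheb n) = degree ?p\<close> deg by (simp del: mult_pCons_left)
    ultimately show ?thesis by simp
  qed
qed auto

lemma degree_cheb: "degree (cheb n) = n"
  using cheb_monic[of n] by simp

lemma coeff_cheb: "coeff (cheb n) n = 1"
  using cheb_monic[of n] by metis

lemma cheb_sin: "poly (cheb n) (2 * cos x) * sin x = sin (real (Suc n) * x)"
proof (induction n rule: cheb.induct)
  case (3 n)
  have "poly (cheb (Suc (Suc n))) (2 * cos x) * sin x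
     = 2 * cos x * (poly (cheb (Suc n)) (2 * cos x) * sin x) - poly (cheb n) (2 * cos x) * sin x"
    by (simp add: algebra_simps)
  also have "\<dots> = 2 * cos x * sin (real (Suc (Suc n)) * x) - sin (real (Suc n) * x)"
    using 3 by simp
  also have "\<dots> = sin (real (Suc (Suc (Suc n))) * x)"
  proof -
    have "real (Suc (Suc (Suc n))) * x = real (Suc (Suc n)) * x + x"
      "real (Suc n) * x = real (Suc (Suc n)) * x - x"
      by (simp_all add: algebra_simps)
    then show ?thesis by (simp only: sin_add sin_diff) (simp add: algebra_simps)
  qed
  finally show ?case .
qed (simp_all add: sin_double)

text \<open>After the substitution \<open>t = 2 cos x\<close> the orthogonality integrand becomes
  \<open>4 sin ((j + 1) x) sin ((k + 1) x)\<close>, of which this is a primitive.\<close>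

definition cheb_prim :: "nat \<Rightarrow> nat \<Rightarrow> real \<Rightarrow> real" where
  "cheb_prim j k x = (if j = k then 2 * x else 2 * sin ((real j - real k) * x) / (real j - real k))
     - 2 * sin (real (j + k + 2) * x) / real (j + k + 2)"

lemma has_real_derivative_cheb_prim:
  "(cheb_prim j k has_real_derivative 4 * sin (real (Suc j) * x) * sin (real (Suc k) * x)) (at x)"
proof -
  have "(cheb_prim j k has_real_derivative
      2 * cos ((real j - real k) * x) - 2 * cos (real (j + k + 2) * x)) (at x)"
    unfolding cheb_prim_def[abs_def]
    by (cases "j = k") (auto intro!: derivative_eq_intros simp del: of_nat_add)
  moreover have "2 * cos ((real j - real k) * x) - 2 * cos (real (j + k + 2) * x)
     = 4 * sin (real (Suc j) * x) * sin (real (Suc k) * x)"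
  proof -
    have "(real j - real k) * x = real (Suc j) * x - real (Suc k) * x"
      "real (j + k + 2) * x = real (Suc j) * x + real (Suc k) * x"
      by (simp_all add: algebra_simps)
    then show ?thesis by (simp only: cos_add cos_diff) (simp add: algebra_simps)
  qed
  ultimately show ?thesis by simp
qed

lemma cheb_orthogonal:
  "integrable lborel (\<lambda>t. poly (cheb j) t * poly (cheb k) t * semic t)"
  "(\<integral>t. poly (cheb j) t * poly (cheb k) t * semic t \<partial>lborel) = (if j = k then 2 * pi else 0)"
proof -
  let ?f = "\<lambda>t. poly (cheb j) t * poly (cheb k) t * semic t"
  let ?F = "\<lambda>t. - cheb_prim j k (arccos (t / 2))"
  have outside: "semic t = 0" if "t \<notin> {-2..2}" for t
    using that by (auto simp: semic_eq_0_iff)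
  have "continuous_on {-2..2} ?f"
    by (intro continuous_intros)
  from borel_integrable_compact[OF _ this] show int: "integrable lborel ?f"
  proof (rule Bochner_Integration.integrable_cong[THEN iffD1, rotated 2, OF _ refl])
    fix t show "indicat_real {- 2..2} t *\<^sub>R ?f t = ?f t"
      using outside[of t] by (cases "t \<in> {-2..2}") auto
  qed simp
  \<comment> \<open>The primitive is differentiable only in the open interval, because of
    \<open>arccos\<close>, hence the interior form of the fundamental theorem. The sign in
    \<open>?F\<close> reflects that \<open>arccos\<close> decreases.\<close>
  have "(?f has_integral (?F 2 - ?F (- 2))) {-2..2}"
  proof (rule fundamental_theorem_of_calculus_interior)
    show "continuous_on {-2..2} ?F"
    proof (rule continuous_on_minus, rule continuous_on_compose2[of UNIV "cheb_prim j k"])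
      show "continuous_on UNIV (cheb_prim j k)"
        by (rule DERIV_continuous_on, rule has_field_derivative_at_within, rule has_real_derivative_cheb_prim)
      show "continuous_on {-2..2} (\<lambda>t::real. arccos (t / 2))"
        by (intro continuous_on_arccos continuous_intros) auto
    qed simp
    fix t :: real assume t: "t \<in> {-2<..<2}"
    let ?x = "arccos (t / 2)"
    have c: "2 * cos ?x = t" using t by (simp add: cos_arccos)
    have s: "sin ?x = sqrt (1 - (t / 2)\<^sup>2)" using t by (simp add: sin_arccos)
    have pos: "0 < sin ?x" using t arccos_lt_bounded[of "t / 2"] by (auto intro!: sin_gt_zero)
    have sm: "semic t = 2 * sin ?x"
    proof -
      have "semic t = sqrt (4 - t\<^sup>2)" using t by (intro semic_eq) auto
      also have "\<dots> = sqrt (4 * (1 - (t / 2)\<^sup>2))" by (simp add: power_divide algebra_simps)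
      also have "\<dots> = 2 * sin ?x" by (simp only: real_sqrt_mult s real_sqrt_four)
      finally show ?thesis .
    qed
    have "((\<lambda>t. arccos (t / 2)) has_real_derivative inverse (- sin ?x) * (1 / 2)) (at t)"
      using t unfolding s by (intro DERIV_chain2[OF DERIV_arccos]) (auto intro!: derivative_eq_intros)
    from DERIV_minus[OF DERIV_chain2[OF has_real_derivative_cheb_prim this]]
    have "(?F has_real_derivative - (4 * sin (real (Suc j) * ?x) * sin (real (Suc k) * ?x) * (inverse (- sin ?x) * (1 / 2)))) (at t)" .
    also have "- (4 * sin (real (Suc j) * ?x) * sin (real (Suc k) * ?x) * (inverse (- sin ?x) * (1 / 2))) = ?f t"
      unfolding cheb_sin[symmetric] c sm using pos by (simp add: field_simps)
    finally show "(?F has_vector_derivative ?f t) (at t)"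
      by (simp add: has_real_derivative_iff_has_vector_derivative)
  qed simp
  then have "integral {-2..2} ?f = ?F 2 - ?F (- 2)" by (rule integral_unique)
  \<comment> \<open>The endpoints correspond to the angles 0 and pi, where all sines vanish. Only
    the summand \<open>2 * x\<close> of the case \<open>j = k\<close> survives.\<close>
  moreover have "?F 2 - ?F (- 2) = (if j = k then 2 * pi else 0)"
  proof -
    have "sin ((2 + real n) * pi) = 0" for n
      using sin_npi[of "n + 2"] by (simp add: add.commute)
    moreover have "sin ((real j - real k) * pi) = 0"
      by (simp add: left_diff_distrib sin_diff sin_npi)
    ultimately show ?thesis by (simp add: cheb_prim_def del: of_nat_add)
  qed
  moreover have "integral {-2..2} ?f = integral UNIV ?f"
  proof -
    have "integral {-2..2} ?f = integral UNIV (\<lambda>t. if t \<in> {-2..2} then ?f t else 0)"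
      by (simp only: integral_restrict_UNIV)
    also have "\<dots> = integral UNIV ?f"
      by (intro Henstock_Kurzweil_Integration.integral_cong) (use outside in auto)
    finally show ?thesis .
  qed
  ultimately show "(\<integral>t. ?f t \<partial>lborel) = (if j = k then 2 * pi else 0)"
    using integral_lborel[OF int] by simp
qed

section \<open>The Vandermonde determinant in an arbitrary monic basis\<close>

definition ordrank :: "'n::{finite,linorder} \<Rightarrow> nat" where
  "ordrank i = card {l. l < i}"

lemma ordrank_less: "i < j \<Longrightarrow> ordrank i < ordrank j"
  unfolding ordrank_def by (intro psubset_card_mono) (auto dest: less_trans)

lemma ordrank_inj: "ordrank i = ordrank j \<longleftrightarrow> i = j"
  using ordrank_less by (metis less_irrefl neq_iff)

lemma ordrank_image: "ordrank ` {l. l \<le> j} = {..ordrank j}"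
proof (rule card_subset_eq)
  show "ordrank ` {l. l \<le> j} \<subseteq> {..ordrank j}"
  proof
    fix x assume "x \<in> ordrank ` {l. l \<le> j}"
    then obtain l where "x = ordrank l" "l \<le> j" by blast
    moreover from this have "l = j \<or> l < j" by (auto simp: le_less)
    ultimately show "x \<in> {..ordrank j}" using ordrank_less[of l j] by auto
  qed
  have "{l. l \<le> j} = insert j {l. l < j}" by auto
  then have "card {l. l \<le> j} = Suc (ordrank j)" by (simp add: ordrank_def)
  moreover have "card (ordrank ` {l. l \<le> j}) = card {l. l \<le> j}"
    by (intro card_image inj_onI) (simp add: ordrank_inj)
  ultimately show "card (ordrank ` {l. l \<le> j}) = card {..ordrank j}" by simp
qed simp

text \<open>Any two monic families differ by a unipotent column operation, so their determinants
  agree; the Newton basis at the nodes \<open>y\<close> makes the matrix triangular.\<close>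

lemma det_monic:
  fixes P :: "'n::{finite,wellorder} \<Rightarrow> real poly" and y :: "(real, 'n) vec"
  assumes P: "\<And>j. degree (P j) = ordrank j" "\<And>j. lead_coeff (P j) = 1"
  shows "det (\<chi> i j. poly (P j) (y $ i)) = det (\<chi> i j. (y $ i) ^ ordrank j :: ((real, 'n) vec, 'n) vec)"
proof -
  define T :: "((real, 'n) vec, 'n) vec" where "T = (\<chi> l j. coeff (P j) (ordrank l))"
  have "(\<chi> i j. poly (P j) (y $ i)) = (\<chi> i j. (y $ i) ^ ordrank j) ** T"
  proof -
    have "poly (P j) x = (\<Sum>l\<in>UNIV. x ^ ordrank l * T $ l $ j)" for j x
    proof -
      have "poly (P j) x = (\<Sum>d\<in>ordrank ` {l. l \<le> j}. coeff (P j) d * x ^ d)"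
        by (simp add: poly_altdef P(1) ordrank_image)
      also have "\<dots> = (\<Sum>l | l \<le> j. coeff (P j) (ordrank l) * x ^ ordrank l)"
        by (subst sum.reindex) (auto intro!: inj_onI simp: ordrank_inj)
      also have "\<dots> = (\<Sum>(l::'n)\<in>UNIV. coeff (P j) (ordrank l) * x ^ ordrank l)"
      proof (rule sum.mono_neutral_left)
        show "\<forall>l\<in>UNIV - {l. l \<le> j}. coeff (P j) (ordrank l) * x ^ ordrank l = 0"
          using P(1)[of j] ordrank_less[of j] by (auto simp: not_le coeff_eq_0)
      qed auto
      finally show ?thesis by (simp add: T_def mult.commute)
    qed
    then show ?thesis by (simp add: vec_eq_iff matrix_matrix_mult_def)
  qed
  moreover have "det T = 1"
  proof -
    have "det T = (\<Prod>i\<in>UNIV. T $ i $ i)"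
      by (rule det_upperdiagonal) (auto simp: T_def P(1) ordrank_less intro!: coeff_eq_0)
    also have "\<dots> = 1" using P by (auto simp: T_def intro!: prod.neutral)
    finally show ?thesis .
  qed
  ultimately show ?thesis by (simp add: det_mul)
qed

lemma det_monic_vdm:
  fixes P :: "'n::{finite,wellorder} \<Rightarrow> real poly" and y :: "(real, 'n) vec"
  assumes P: "\<And>j. degree (P j) = ordrank j" "\<And>j. lead_coeff (P j) = 1"
  shows "det (\<chi> i j. poly (P j) (y $ i)) = vdm y"
proof -
  define N where "N j = (\<Prod>l | l < j. [:- (y $ l), 1:])" for j
  have "degree (N j) = ordrank j" for j
    unfolding N_def ordrank_def by (simp add: degree_prod_eq_sum_degree)
  moreover have "lead_coeff (N j) = 1" for j
    unfolding N_def lead_coeff_prod by simp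
  ultimately have "det (\<chi> i j. poly (P j) (y $ i)) = det (\<chi> i j. poly (N j) (y $ i))"
    using det_monic[of P, OF P] det_monic[of N] by simp
  also have "\<dots> = (\<Prod>i\<in>UNIV. poly (N i) (y $ i))"
    by (subst det_lowerdiagonal) (auto simp: N_def poly_prod intro!: prod_zero)
  also have "\<dots> = (\<Prod>i\<in>UNIV. \<Prod>l | l < i. y $ i - y $ l)"
    by (simp add: N_def poly_prod)
  also have "\<dots> = vdm y"
  proof -
    have "vdm y = (\<Prod>p\<in>(\<lambda>(i, l). (l, i)) ` (SIGMA i:UNIV. {l. l < i}). y $ snd p - y $ fst p)"
      unfolding vdm_def by (rule prod.cong) (auto simp: image_iff)
    also have "\<dots> = (\<Prod>p\<in>(SIGMA i:UNIV. {l. l < i}). y $ fst p - y $ snd p)"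
      by (subst prod.reindex) (auto simp: inj_on_def case_prod_unfold)
    finally show ?thesis by (simp add: prod.Sigma case_prod_unfold)
  qed
  finally show ?thesis .
qed

section \<open>Lebesgue measure on vectors as a product measure\<close>

lemma borel_measurable_vec_lambda:
  fixes f :: "'a \<Rightarrow> 'n::finite \<Rightarrow> real"
  assumes "\<And>i. (\<lambda>x. f x i) \<in> borel_measurable M"
  shows "(\<lambda>x. \<chi> i. f x i) \<in> borel_measurable M"
  using assms by (subst borel_measurable_euclidean_space) (auto simp: Basis_vec_def inner_axis)

text \<open>Both measures assign to a box the product of its side lengths. The bijection
  \<open>e\<close> allows relabelling: it later yields permutations of coordinates and the passage
  to functions on {1..g}.\<close>

lemma lborel_vec_eq_PiM:
  fixes e :: "'i \<Rightarrow> 'n::finite"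
  assumes e: "bij_betw e I UNIV"
  shows "(lborel :: (real^'n) measure) = distr (PiM I (\<lambda>_. lborel :: real measure)) borel (\<lambda>t. \<chi> i. t (inv_into I e i))"
proof (rule lborel_eqI)
  have fin: "finite I" using bij_betw_finite[OF e] by simp
  interpret product_sigma_finite "\<lambda>_ :: 'i. lborel :: real measure" by standard
  have inv: "inv_into I e i \<in> I" "e (inv_into I e i) = i" for i
    using e by (auto simp: bij_betw_def inv_into_into f_inv_into_f)
  have inve: "inv_into I e (e a) = a" if "a \<in> I" for a
    using e that by (simp add: bij_betw_def)
  have m: "(\<lambda>t. \<chi> i. t (inv_into I e i)) \<in> measurable (PiM I (\<lambda>_. lborel :: real measure)) borel"
    by (rule borel_measurable_vec_lambda[where f = "\<lambda>t i. t (inv_into I e i)"]) (use inv in auto)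
  fix l u :: "real^'n" assume lu: "\<And>b. b \<in> Basis \<Longrightarrow> l \<bullet> b \<le> u \<bullet> b"
  have lu': "l $ i \<le> u $ i" for i
  proof -
    have "axis i 1 \<in> (Basis :: (real^'n) set)" by (auto simp: Basis_vec_def)
    from lu[OF this] show ?thesis by (simp add: inner_axis)
  qed
  have pre: "(\<lambda>t. \<chi> i. t (inv_into I e i)) -` box l u \<inter> space (PiM I (\<lambda>_. lborel :: real measure))
      = PiE I (\<lambda>a. {l $ e a<..<u $ e a})" (is "?L = ?R")
  proof (intro equalityI subsetI)
    fix t assume "t \<in> ?L"
    then show "t \<in> ?R" using inve by (auto simp: space_PiM mem_box_cart PiE_iff; metis inve)
  next
    fix t assume t: "t \<in> ?R"
    have "l $ i < t (inv_into I e i) \<and> t (inv_into I e i) < u $ i" for i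
      using t inv[of i] by (auto simp: PiE_iff; metis inv)
    then show "t \<in> ?L" using t by (auto simp: space_PiM mem_box_cart PiE_iff)
  qed
  have "emeasure (distr (PiM I (\<lambda>_. lborel :: real measure)) borel (\<lambda>t. \<chi> i. t (inv_into I e i))) (box l u)
      = (\<Prod>a\<in>I. emeasure lborel {l $ e a<..<u $ e a})"
    using m by (simp add: emeasure_distr pre emeasure_PiM[OF fin])
  also have "\<dots> = ennreal (\<Prod>a\<in>I. u $ e a - l $ e a)"
    using lu' by (simp add: prod_ennreal)
  also have "(\<Prod>a\<in>I. u $ e a - l $ e a) = (\<Prod>i\<in>UNIV. u $ i - l $ i)"
    by (rule prod.reindex_bij_betw[OF e])
  also have "\<dots> = (\<Prod>b\<in>Basis. (u - l) \<bullet> b)"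
  proof -
    have "(\<Prod>b\<in>Basis. (u - l) \<bullet> b) = (\<Prod>b\<in>(\<lambda>i. axis i (1::real)) ` (UNIV :: 'n set). (u - l) \<bullet> b)"
      by (intro prod.cong) (auto simp: Basis_vec_def)
    also have "\<dots> = (\<Prod>i\<in>UNIV. (u - l) \<bullet> axis i 1)"
      by (subst prod.reindex) (auto intro!: injI simp: axis_eq_axis)
    finally show ?thesis by (simp add: inner_axis)
  qed
  finally show "emeasure (distr (PiM I (\<lambda>_. lborel :: real measure)) borel (\<lambda>t. \<chi> i. t (inv_into I e i))) (box l u) = ennreal (\<Prod>b\<in>Basis. (u - l) \<bullet> b)" .
qed simp

lemma integral_lborel_vec_prod:
  fixes f :: "'n::finite \<Rightarrow> real \<Rightarrow> real"
  assumes "\<And>i. integrable lborel (f i)"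
  shows "(\<integral>y. (\<Prod>i\<in>UNIV. f i (y $ i)) \<partial>(lborel :: (real^'n) measure)) = (\<Prod>i\<in>UNIV. \<integral>t. f i t \<partial>lborel)"
proof -
  interpret product_sigma_finite "\<lambda>_ :: 'n. lborel :: real measure" by standard
  have [measurable]: "f i \<in> borel_measurable borel" for i
    using assms[of i] by simp
  have "(\<integral>y. (\<Prod>i\<in>UNIV. f i (y $ i)) \<partial>(lborel :: (real^'n) measure))
      = (\<integral>t. (\<Prod>i\<in>UNIV. f i (t i)) \<partial>PiM UNIV (\<lambda>_. lborel))"
    by (subst lborel_vec_eq_PiM[of id UNIV], simp, subst integral_distr)
       (auto intro!: borel_measurable_vec_lambda[where f = "\<lambda>t. t"])
  also have "\<dots> = (\<Prod>i\<in>UNIV. \<integral>t. f i t \<partial>lborel)"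
    by (rule product_integral_prod) (use assms in auto)
  finally show ?thesis .
qed

text \<open>The square of the determinant is a double sum over permutations. Each term factors over
  the coordinates, and orthogonality leaves the diagonal: g! terms, each equal to (2 pi)^g.\<close>

theorem weyl_mass:
  "(\<integral>y. (vdm y)\<^sup>2 * semics y \<partial>(lborel :: (real^'n::{finite,wellorder}) measure)) = fact CARD('n) * (2 * pi) ^ CARD('n)"
proof -
  let ?S = "{p. p permutes (UNIV :: 'n set)}"
  let ?c = "\<lambda>i. cheb (ordrank i)"
  have vdm: "vdm y = (\<Sum>p\<in>?S. of_int (sign p) * (\<Prod>i\<in>UNIV. poly (?c (p i)) (y $ i)))" for y :: "(real, 'n) vec"
    using det_monic_vdm[of ?c y] by (simp add: degree_cheb coeff_cheb det_def)
  have int: "integrable lborel (\<lambda>y :: (real, 'n) vec. (\<Prod>i\<in>UNIV. poly (?c (p i)) (y $ i) * poly (?c (q i)) (y $ i)) * semics y)" for p q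
    by (intro integrable_semics continuous_intros)
  have I: "(\<integral>y. (\<Prod>i\<in>UNIV. poly (?c (p i)) (y $ i) * poly (?c (q i)) (y $ i)) * semics y \<partial>(lborel :: (real, 'n) vec measure))
      = (if p = q then (2 * pi) ^ CARD('n) else 0)" for p q
  proof -
    have "(\<integral>y. (\<Prod>i\<in>UNIV. poly (?c (p i)) (y $ i) * poly (?c (q i)) (y $ i)) * semics y \<partial>(lborel :: (real, 'n) vec measure))
        = (\<Prod>i\<in>UNIV. \<integral>t. poly (?c (p i)) t * poly (?c (q i)) t * semic t \<partial>lborel)"
      unfolding semics_def prod.distrib[symmetric]
      by (intro integral_lborel_vec_prod cheb_orthogonal)
    also have "\<dots> = (if p = q then (2 * pi) ^ CARD('n) else 0)"
    proof (cases "p = q")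
      case False
      then obtain i where "p i \<noteq> q i" by blast
      then show ?thesis
        using False by (auto simp: cheb_orthogonal ordrank_inj intro!: prod_zero exI[of _ i])
    qed (simp add: cheb_orthogonal)
    finally show ?thesis .
  qed
  have "(vdm y)\<^sup>2 * semics y = (\<Sum>p\<in>?S. \<Sum>q\<in>?S. of_int (sign p) * of_int (sign q) *
      ((\<Prod>i\<in>UNIV. poly (?c (p i)) (y $ i) * poly (?c (q i)) (y $ i)) * semics y))" for y :: "(real, 'n) vec"
    unfolding vdm power2_eq_square sum_product
    unfolding sum_distrib_right prod.distrib
    by (intro sum.cong refl) (simp add: ac_simps)
  then have "(\<integral>y. (vdm y)\<^sup>2 * semics y \<partial>(lborel :: (real, 'n) vec measure))
      = (\<Sum>p\<in>?S. \<Sum>q\<in>?S. of_int (sign p) * of_int (sign q) * (if p = q then (2 * pi) ^ CARD('n) else 0))"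
    by (simp only:) (subst Bochner_Integration.integral_sum, intro Bochner_Integration.integrable_sum integrable_mult_right int,
        intro sum.cong refl, subst Bochner_Integration.integral_sum, intro integrable_mult_right int,
        simp only: integral_mult_right_zero I)
  also have "\<dots> = (\<Sum>p\<in>?S. (2 * pi) ^ CARD('n))"
  proof (intro sum.cong refl)
    fix p assume p: "p \<in> ?S"
    have "(\<Sum>q\<in>?S. of_int (sign p) * of_int (sign q) * (if p = q then (2 * pi) ^ CARD('n) else 0))
        = (\<Sum>q\<in>?S. if p = q then (of_int (sign p) * of_int (sign p)) * (2 * pi) ^ CARD('n) else 0)"
      by (intro sum.cong refl) simp
    also have "\<dots> = (of_int (sign p) * of_int (sign p)) * (2 * pi) ^ CARD('n)"
      using p by (simp only: sum.delta'[OF finite_permutations[OF finite]] if_True)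
    also have "\<dots> = (2 * pi) ^ CARD('n)" by (simp only: of_int_mult[symmetric] sign_idempotent of_int_1 mult_1_left)
    finally show "(\<Sum>q\<in>?S. of_int (sign p) * of_int (sign q) * (if p = q then (2 * pi) ^ CARD('n) else 0)) = (2 * pi) ^ CARD('n)" .
  qed
  also have "\<dots> = fact CARD('n) * (2 * pi) ^ CARD('n)"
    by (simp add: card_permutations[OF refl])
  finally show ?thesis .
qed

section \<open>The Viete map\<close>

text \<open>The index set is a parameter because the Jacobian of the Viete map involves these
  polynomials with one coordinate left out.\<close>

definition esym :: "nat \<Rightarrow> 'n set \<Rightarrow> real ^ 'n \<Rightarrow> real" where
  "esym k A y = (\<Sum>X | X \<subseteq> A \<and> card X = k. \<Prod>i\<in>X. y $ i)"

lemma esym_0: "finite A \<Longrightarrow> esym 0 A y = 1"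
proof -
  assume "finite A"
  then have "{X. X \<subseteq> A \<and> card X = 0} = {{}}" by (auto dest: finite_subset)
  then show ?thesis by (simp add: esym_def)
qed

lemma continuous_on_esym [continuous_intros]: "continuous_on S (esym k A)"
  unfolding esym_def by (intro continuous_intros)

lemma prod_diff_esym:
  fixes y :: "real ^ 'n"
  shows "(\<Prod>i\<in>A. x - y $ i) = (\<Sum>k\<le>card A. (- 1) ^ k * esym k A y * x ^ (card A - k))"
proof -
  have fin: "finite A" by simp
  have "(\<Prod>i\<in>A. - (y $ i) + x) = (\<Sum>X\<in>Pow A. (\<Prod>i\<in>X. - (y $ i)) * (\<Prod>i\<in>A - X. x))"
    by (rule prod_add[OF fin])
  also have "\<dots> = (\<Sum>X\<in>Pow A. (- 1) ^ card X * (\<Prod>i\<in>X. y $ i) * x ^ (card A - card X))"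
  proof (intro sum.cong refl)
    fix X assume "X \<in> Pow A"
    then have "card (A - X) = card A - card X" by (intro card_Diff_subset) auto
    then show "(\<Prod>i\<in>X. - (y $ i)) * (\<Prod>i\<in>A - X. x) = (- 1) ^ card X * (\<Prod>i\<in>X. y $ i) * x ^ (card A - card X)"
      by (simp add: prod_uminus)
  qed
  also have "\<dots> = (\<Sum>k\<le>card A. \<Sum>X | X \<in> Pow A \<and> card X = k. (- 1) ^ card X * (\<Prod>i\<in>X. y $ i) * x ^ (card A - card X))"
    by (subst sum.group) (auto intro: card_mono)
  also have "\<dots> = (\<Sum>k\<le>card A. (- 1) ^ k * esym k A y * x ^ (card A - k))"
    unfolding esym_def sum_distrib_left sum_distrib_right
    by (intro sum.cong refl) auto
  finally show ?thesis by simp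
qed

text \<open>The partial derivative by the \<open>j\<close>-th coordinate keeps the subsets that
  contain \<open>j\<close> and removes \<open>j\<close> from them.\<close>

lemma esym_has_derivative:
  "(esym (Suc k) UNIV has_derivative (\<lambda>h. \<Sum>j\<in>UNIV. esym k (UNIV - {j}) y * h $ j)) (at (y :: real ^ 'n) within S)"
proof -
  let ?X = "{X :: 'n set. X \<subseteq> UNIV \<and> card X = Suc k}"
  have "(esym (Suc k) UNIV has_derivative (\<lambda>h. \<Sum>X\<in>?X. \<Sum>j\<in>X. h $ j * (\<Prod>i\<in>X - {j}. y $ i))) (at y within S)"
    unfolding esym_def
    by (intro has_derivative_sum has_derivative_prod bounded_linear.has_derivative[OF bounded_linear_vec_nth] has_derivative_ident)
  moreover have "(\<Sum>X\<in>?X. \<Sum>j\<in>X. h $ j * (\<Prod>i\<in>X - {j}. y $ i)) = (\<Sum>j\<in>UNIV. esym k (UNIV - {j}) y * h $ j)" for h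
  proof -
    have "(\<Sum>X\<in>?X. \<Sum>j\<in>X. h $ j * (\<Prod>i\<in>X - {j}. y $ i))
        = (\<Sum>j\<in>UNIV. \<Sum>X | X \<in> ?X \<and> j \<in> X. h $ j * (\<Prod>i\<in>X - {j}. y $ i))"
      using sum.swap_restrict[of ?X UNIV "\<lambda>X j. h $ j * (\<Prod>i\<in>X - {j}. y $ i)" "\<lambda>X j. j \<in> X"] by simp
    also have "\<dots> = (\<Sum>j\<in>UNIV. \<Sum>Y | Y \<subseteq> UNIV - {j} \<and> card Y = k. h $ j * (\<Prod>i\<in>Y. y $ i))"
    proof (rule sum.cong[OF refl])
      fix j :: 'n
      show "(\<Sum>X | X \<in> ?X \<and> j \<in> X. h $ j * (\<Prod>i\<in>X - {j}. y $ i))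
          = (\<Sum>Y | Y \<subseteq> UNIV - {j} \<and> card Y = k. h $ j * (\<Prod>i\<in>Y. y $ i))"
        by (rule sum.reindex_bij_witness[where i = "insert j" and j = "\<lambda>X. X - {j}"])
           (auto simp: card_Diff_singleton card_insert_if subset_Diff_insert)
    qed
    also have "\<dots> = (\<Sum>j\<in>UNIV. esym k (UNIV - {j}) y * h $ j)"
      by (simp add: esym_def sum_distrib_left sum_distrib_right mult.commute)
    finally show ?thesis .
  qed
  ultimately show ?thesis by simp
qed

text \<open>The coordinate with index \<open>i\<close> of the vector form of the Viete map is the elementary
  symmetric polynomial of degree \<open>Suc (ordrank i)\<close>.\<close>

definition vmap :: "real ^ 'n::{finite,linorder} \<Rightarrow> real ^ 'n::{finite,linorder}" where
  "vmap y = (\<chi> i. esym (Suc (ordrank i)) UNIV y)"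

definition vjac :: "real ^ 'n::{finite,linorder} \<Rightarrow> real ^ 'n::{finite,linorder} ^ 'n::{finite,linorder}" where
  "vjac y = (\<chi> i j. esym (ordrank i) (UNIV - {j}) y)"

lemma continuous_on_vmap: "continuous_on S vmap"
  unfolding vmap_def by (intro continuous_intros)

lemma vmap_has_derivative: "(vmap has_derivative (\<lambda>h. vjac y *v h)) (at y within S)"
  by (subst has_derivative_componentwise_within)
     (auto simp: Basis_vec_def inner_axis vmap_def vjac_def matrix_vector_mult_def intro!: esym_has_derivative)

lemma ordrank_less_card: "ordrank (i :: 'n::{finite,linorder}) < CARD('n)"
  unfolding ordrank_def by (intro psubset_card_mono) auto

lemma bij_ordrank: "bij_betw ordrank (UNIV :: 'n::{finite,linorder} set) {..<CARD('n)}"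
proof -
  have inj: "inj (ordrank :: 'n \<Rightarrow> nat)" by (intro injI) (simp add: ordrank_inj)
  have "range (ordrank :: 'n \<Rightarrow> nat) = {..<CARD('n)}"
    by (rule card_subset_eq) (auto simp: ordrank_less_card card_image[OF inj])
  with inj show ?thesis by (simp add: bij_betw_def)
qed

text \<open>Each unordered pair occurs twice on the left. That side does not refer to the order of
  the indices, so invariance under permutations can be read off from it.\<close>

lemma prod_pairs_vdm:
  fixes y :: "(real, 'n::{finite,linorder}) vec"
  shows "(\<Prod>j\<in>UNIV. \<Prod>l\<in>UNIV - {j}. \<bar>y $ j - y $ l\<bar>) = (vdm y)\<^sup>2"
proof -
  let ?P = "{p :: 'n \<times> 'n. fst p < snd p}"
  have "(\<Prod>j\<in>UNIV. \<Prod>l\<in>UNIV - {j}. \<bar>y $ j - y $ l\<bar>) = (\<Prod>p\<in>(SIGMA j:UNIV. UNIV - {j}). \<bar>y $ fst p - y $ snd p\<bar>)"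
    by (simp add: prod.Sigma case_prod_unfold)
  also have "(SIGMA j:(UNIV :: 'n set). UNIV - {j}) = ?P \<union> prod.swap ` ?P"
    by (auto simp: image_iff)
  also have "(\<Prod>p\<in>?P \<union> prod.swap ` ?P. \<bar>y $ fst p - y $ snd p\<bar>)
      = (\<Prod>p\<in>?P. \<bar>y $ fst p - y $ snd p\<bar>) * (\<Prod>p\<in>prod.swap ` ?P. \<bar>y $ fst p - y $ snd p\<bar>)"
    by (rule prod.union_disjoint) auto
  also have "(\<Prod>p\<in>prod.swap ` ?P. \<bar>y $ fst p - y $ snd p\<bar>) = \<bar>vdm y\<bar>"
    by (subst prod.reindex) (auto simp: vdm_def abs_prod intro: inj_onI)
  also have "(\<Prod>p\<in>?P. \<bar>y $ fst p - y $ snd p\<bar>) = \<bar>vdm y\<bar>"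
    by (simp add: vdm_def abs_prod abs_minus_commute)
  finally show ?thesis by (simp add: power2_eq_square)
qed

text \<open>Expanding \<open>\<Prod>\<^sub>l (y\<^sub>k - y\<^sub>l)\<close> (\<open>l \<noteq> j\<close>) shows that the Vandermonde matrix times the Jacobian
  matrix, with rows reversed and suitable signs, is diagonal.\<close>

lemma det_vjac:
  fixes y :: "(real, 'n::{finite,wellorder}) vec"
  assumes "vdm y \<noteq> 0"
  shows "\<bar>det (vjac y)\<bar> = \<bar>vdm y\<bar>"
proof -
  let ?n = "CARD('n)"
  define e where "e = inv_into (UNIV :: 'n set) ordrank"
  have e: "ordrank (e k) = k" if "k < ?n" for k
    using bij_ordrank[where 'n = 'n] that by (auto simp: e_def bij_betw_def f_inv_into_f)
  define \<rho> where "\<rho> i = e (?n - 1 - ordrank i)" for i :: 'n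
  have \<rho>: "ordrank (\<rho> i) = ?n - 1 - ordrank i" for i
    unfolding \<rho>_def by (rule e) (use ordrank_less_card[of i] in simp)
  have "inj \<rho>"
  proof (rule injI)
    fix i j assume "\<rho> i = \<rho> j"
    then have "?n - 1 - ordrank i = ?n - 1 - ordrank j" using \<rho> by metis
    then show "i = j" using ordrank_less_card[of i] ordrank_less_card[of j] by (simp add: ordrank_inj[symmetric])
  qed
  then have "bij \<rho>" by (simp add: bij_def finite_UNIV_inj_surj)
  then have perm: "\<rho> permutes UNIV" by (auto simp: permutes_def bij_iff)
  define B where "B = (\<chi> (k::'n) (i::'n). (y $ k) ^ ordrank i)"
  define M where "M = (\<chi> (i::'n). (- 1) ^ (?n - 1 - ordrank i) *s vjac y $ \<rho> i)"
  have detB: "det B = vdm y"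
    using det_monic_vdm[of "\<lambda>i. monom 1 (ordrank i)" y] by (simp add: B_def poly_monom degree_monom_eq)
  have "det M = (\<Prod>(i::'n)\<in>UNIV. (- 1) ^ (?n - 1 - ordrank i)) * (of_int (sign \<rho>) * det (vjac y))"
    unfolding M_def det_rows_mul using det_permute_rows[OF perm, of "vjac y"] by simp
  then have detM: "\<bar>det M\<bar> = \<bar>det (vjac y)\<bar>"
    by (simp add: abs_mult abs_prod power_abs) (simp add: sign_def)
  have BM: "(B ** M) $ k $ j = (\<Prod>l\<in>UNIV - {j}. y $ k - y $ l)" for k j
  proof -
    have "(B ** M) $ k $ j = (\<Sum>(i::'n)\<in>UNIV. (y $ k) ^ ordrank i * ((- 1) ^ (?n - 1 - ordrank i) * esym (?n - 1 - ordrank i) (UNIV - {j}) y))"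
      by (simp add: B_def M_def matrix_matrix_mult_def vjac_def \<rho>)
    also have "\<dots> = (\<Sum>r<?n. (y $ k) ^ r * ((- 1) ^ (?n - 1 - r) * esym (?n - 1 - r) (UNIV - {j}) y))"
      by (rule sum.reindex_bij_betw[OF bij_ordrank])
    also have "\<dots> = (\<Sum>r<?n. (y $ k) ^ (?n - 1 - r) * ((- 1) ^ r * esym r (UNIV - {j}) y))"
      by (subst sum.nat_diff_reindex[symmetric]) (auto intro!: sum.cong)
    also have "{..<?n} = {..?n - 1}" using ordrank_less_card[of j] by auto
    also have "(\<Sum>r\<le>?n - 1. (y $ k) ^ (?n - 1 - r) * ((- 1) ^ r * esym r (UNIV - {j}) y)) = (\<Prod>l\<in>UNIV - {j}. y $ k - y $ l)"
      by (subst prod_diff_esym) (simp add: card_Diff_singleton ac_simps)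
    finally show ?thesis .
  qed
  have "det (B ** M) = (\<Prod>i\<in>UNIV. (B ** M) $ i $ i)"
    by (rule det_diagonal) (auto simp: BM intro!: prod_zero)
  then have "\<bar>det B\<bar> * \<bar>det M\<bar> = (\<Prod>j\<in>UNIV. \<Prod>l\<in>UNIV - {j}. \<bar>y $ j - y $ l\<bar>)"
    by (simp add: det_mul BM abs_prod flip: abs_mult)
  then have "\<bar>vdm y\<bar> * \<bar>det (vjac y)\<bar> = \<bar>vdm y\<bar> * \<bar>vdm y\<bar>"
    unfolding detB detM prod_pairs_vdm by (simp add: power2_eq_square)
  then show ?thesis using assms by (simp only: mult_cancel_left abs_eq_0 simp_thms)
qed

section \<open>Injectivity of the Viete map on the alcove\<close>

definition valcove :: "(real ^ 'n::{finite,linorder}) set" where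
  "valcove = {y. (\<forall>i. \<bar>y $ i\<bar> < 2) \<and> (\<forall>i j. i < j \<longrightarrow> y $ i < y $ j)}"

lemma open_valcove: "open valcove"
proof -
  have "valcove = (\<Inter>i. {y :: (real, 'a) vec. \<bar>y $ i\<bar> < 2}) \<inter> (\<Inter>p\<in>{p. fst p < snd p}. {y. y $ fst p < y $ snd p})"
    by (auto simp: valcove_def)
  also have "open \<dots>"
    by (intro open_Int open_INT ballI open_Collect_less continuous_intros) auto
  finally show ?thesis .
qed

lemma valcove_vdm: "y \<in> valcove \<Longrightarrow> vdm y \<noteq> 0"
  unfolding vdm_nonzero_iff valcove_def by (auto, metis less_irrefl neq_iff)

lemma valcove_cube: "y \<in> valcove \<Longrightarrow> y \<in> cube"
  by (auto simp: valcove_def cube_def less_imp_le)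

text \<open>At the least index where the two families differ, the smaller of the two values could
  not occur in the other family: its earlier values are the common ones below, and its later values
  are larger still.\<close>

lemma increasing_unique:
  fixes y z :: "'n::wellorder \<Rightarrow> real"
  assumes y: "\<And>i j. i < j \<Longrightarrow> y i < y j" and z: "\<And>i j. i < j \<Longrightarrow> z i < z j"
    and range: "range y = range z"
  shows "y = z"
proof -
  have *: "\<not> y i < z i"
    if min: "\<And>j. j < i \<Longrightarrow> y j = z j" and mono: "\<And>i j. i < j \<Longrightarrow> y i < y j" "\<And>i j. i < j \<Longrightarrow> z i < z j" and ran: "range y = range z"
    for y z :: "'n \<Rightarrow> real" and i
  proof
    assume less: "y i < z i"
    obtain l where l: "y i = z l" using ran by (metis rangeE rangeI)
    consider "l < i" | "l = i" | "i < l" by (rule linorder_cases)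
    then show False
    proof cases
      case 1
      then show False using l min[of l] mono(1)[of l i] by simp
    next
      case 3
      then show False using l less mono(2)[of i l] by simp
    qed (use l less in simp)
  qed
  have "y i = z i" for i
  proof (induction i rule: less_induct)
    case (less i)
    then show ?case using *[of i y z] *[of i z y] y z range by (metis linorder_neqE)
  qed
  then show ?thesis by blast
qed

text \<open>The elementary symmetric functions are the coefficients of the polynomial with roots
  \<open>y $ i\<close>. They determine the set of roots, and an increasing family is determined by
  its range.\<close>

lemma inj_on_vmap: "inj_on vmap (valcove :: (real ^ 'n::{finite,wellorder}) set)"
proof (rule inj_onI)
  fix y z :: "(real, 'n) vec" assume y: "y \<in> valcove" and z: "z \<in> valcove" and eq: "vmap y = vmap z"
  have es: "esym k UNIV y = esym k UNIV z" if "k \<le> CARD('n)" for k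
  proof (cases k)
    case (Suc r)
    with that have "r \<in> ordrank ` (UNIV :: 'n set)"
      using bij_ordrank[where 'n = 'n] by (auto simp: bij_betw_def)
    then show ?thesis using arg_cong[OF eq, of "\<lambda>v. v $ _"] by (auto simp: vmap_def Suc)
  qed (simp add: esym_0)
  then have "(\<Prod>i\<in>UNIV. x - y $ i) = (\<Prod>i\<in>UNIV. x - z $ i)" for x
    unfolding prod_diff_esym by (intro sum.cong) auto
  moreover have "(\<Prod>i\<in>UNIV. x - v $ i) = 0 \<longleftrightarrow> (\<exists>i. x = v $ i)" for x and v :: "(real, 'n) vec"
    by (simp add: prod_zero_iff)
  ultimately have "(\<exists>i. x = y $ i) \<longleftrightarrow> (\<exists>i. x = z $ i)" for x by metis
  then have "range (($) y) = range (($) z)" by (auto simp: image_iff)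
  then have "($) y = ($) z"
    using y z by (intro increasing_unique) (auto simp: valcove_def)
  then show "y = z" by (simp add: vec_eq_iff)
qed

section \<open>Reduction from the cube to the alcove, and the change of variables\<close>

definition pvec :: "('n \<Rightarrow> 'n) \<Rightarrow> real ^ 'n \<Rightarrow> real ^ 'n" where
  "pvec p y = (\<chi> i. y $ p i)"

lemma pvec_component [simp]: "pvec p y $ i = y $ p i"
  by (simp add: pvec_def)

lemma lborel_pvec:
  fixes p :: "'n::finite \<Rightarrow> 'n"
  assumes "bij p"
  shows "distr lborel borel (pvec p) = lborel"
proof -
  have L: "(lborel :: (real^'n) measure) = distr (PiM UNIV (\<lambda>_. lborel :: real measure)) borel (\<lambda>t. \<chi> i. t (r i))"
    if "bij r" for r :: "'n \<Rightarrow> 'n"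
  proof -
    have "inv_into UNIV (inv r) = r" using that by (simp add: inv_inv_eq)
    then show ?thesis
      using lborel_vec_eq_PiM[of "inv r" UNIV] that by (simp add: bij_imp_bij_inv)
  qed
  have m: "(\<lambda>t. \<chi> i. t (r i)) \<in> measurable (PiM UNIV (\<lambda>_. lborel :: real measure)) borel" for r :: "'n \<Rightarrow> 'n"
    by (rule borel_measurable_vec_lambda[where f = "\<lambda>t i. t (r i)"]) auto
  have mp: "pvec p \<in> borel_measurable borel"
    unfolding pvec_def[abs_def] by (intro borel_measurable_continuous_onI continuous_intros)
  have "distr lborel borel (pvec p) = distr (distr (PiM UNIV (\<lambda>_. lborel :: real measure)) borel (\<lambda>t. \<chi> i. t (id i))) borel (pvec p)"
    by (subst L[of id]) simp_all
  also have "\<dots> = distr (PiM UNIV (\<lambda>_. lborel :: real measure)) borel (pvec p \<circ> (\<lambda>t. \<chi> i. t (id i)))"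
    using mp m[of id] by (subst distr_distr) auto
  also have "pvec p \<circ> (\<lambda>t. \<chi> i. t (id i)) = (\<lambda>t. \<chi> i. t (p i))"
    by (auto simp: pvec_def)
  also have "distr (PiM UNIV (\<lambda>_. lborel :: real measure)) borel (\<lambda>t. \<chi> i. t (p i)) = lborel"
    using L[OF assms] by simp
  finally show ?thesis .
qed

lemma integral_pvec:
  fixes H :: "(real, 'n::finite) vec \<Rightarrow> real"
  assumes "bij p" and H: "integrable lborel H"
  shows "(\<integral>y. H (pvec p y) \<partial>lborel) = (\<integral>y. H y \<partial>lborel)" "integrable lborel (\<lambda>y. H (pvec p y))"
proof -
  have mp: "pvec p \<in> measurable lborel borel"
    unfolding pvec_def[abs_def] by (simp, intro borel_measurable_continuous_onI continuous_intros)
  have mH: "H \<in> borel_measurable borel" using H by auto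
  have "(\<integral>y. H y \<partial>lborel) = (\<integral>y. H y \<partial>(distr lborel borel (pvec p)))"
    by (simp add: lborel_pvec[OF assms(1)])
  also have "\<dots> = (\<integral>y. H (pvec p y) \<partial>lborel)"
    by (rule integral_distr[OF mp mH])
  finally show "(\<integral>y. H (pvec p y) \<partial>lborel) = (\<integral>y. H y \<partial>lborel)" ..
  show "integrable lborel (\<lambda>y. H (pvec p y))"
    using integrable_distr_eq[OF mp mH] H by (simp add: lborel_pvec[OF assms(1)])
qed

lemma sorting_permutation:
  fixes y :: "(real, 'n::{finite,wellorder}) vec"
  assumes y: "\<And>i. \<bar>y $ i\<bar> < 2" and dist: "vdm y \<noteq> 0"
  shows "\<exists>!p. p permutes UNIV \<and> pvec p y \<in> valcove"
proof -
  have inj: "y $ i = y $ j \<longleftrightarrow> i = j" for i j using dist by (auto simp: vdm_nonzero_iff)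
  \<comment> \<open>The number of smaller coordinates is the position that index \<open>i\<close>
    takes after sorting, so the sorting permutation is the inverse of \<open>r\<close>.\<close>
  define c where "c i = card {l. y $ l < y $ i}" for i
  have c_less: "c i < c j" if "y $ i < y $ j" for i j
    unfolding c_def using that by (intro psubset_card_mono) (auto dest: less_trans)
  have c_card: "c i < CARD('n)" for i
    unfolding c_def by (intro psubset_card_mono) auto
  define r where "r i = inv_into (UNIV :: 'n set) ordrank (c i)" for i
  have r: "ordrank (r i) = c i" for i
    using bij_ordrank[where 'n = 'n] c_card[of i] by (auto simp: r_def bij_betw_def f_inv_into_f)
  have "inj r"
  proof (rule injI)
    fix i j assume "r i = r j"
    then have "c i = c j" using r by metis
    then show "i = j" using c_less inj by (metis less_irrefl neq_iff)
  qed
  then have "bij r" by (simp add: bij_def finite_UNIV_inj_surj)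
  then have p: "bij (inv r)" "r (inv r i) = i" for i
    by (simp_all add: bij_imp_bij_inv bij_is_surj surj_f_inv_f)
  have mono: "y $ inv r i < y $ inv r j" if "i < j" for i j
  proof (rule ccontr)
    assume "\<not> y $ inv r i < y $ inv r j"
    then have "c (inv r j) \<le> c (inv r i)" using c_less inj by (metis le_less linorder_not_less order_refl not_le_imp_less)
    moreover have "c (inv r i) < c (inv r j)"
      using ordrank_less[OF that] r p(2) by metis
    ultimately show False by simp
  qed
  have perm: "q permutes UNIV \<longleftrightarrow> bij q" for q :: "'n \<Rightarrow> 'n" by (auto simp: permutes_def bij_iff)
  show ?thesis
  proof (rule ex1I[of _ "inv r"])
    show "inv r permutes UNIV \<and> pvec (inv r) y \<in> valcove"
      using p y mono by (auto simp: perm valcove_def)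
    fix q assume q: "q permutes UNIV \<and> pvec q y \<in> valcove"
    then have bq: "bij q" by (simp add: perm)
    have ran: "range (\<lambda>i. y $ s i) = range (($) y)" if "bij s" for s :: "'n \<Rightarrow> 'n"
      using bij_is_surj[OF that] by (metis (no_types, lifting) image_comp comp_def image_cong)
    have "(\<lambda>i. y $ q i) = (\<lambda>i. y $ inv r i)"
      using q mono ran[OF bq] ran[OF p(1)] by (intro increasing_unique) (auto simp: valcove_def)
    then show "q = inv r" using inj by (auto simp: fun_eq_iff)
  qed
qed

lemma vdm_pvec:
  fixes y :: "(real, 'n::{finite,linorder}) vec"
  assumes "bij p"
  shows "(vdm (pvec p y))\<^sup>2 = (vdm y)\<^sup>2"
proof -
  have bb: "bij_betw p (UNIV - {j}) (UNIV - {p j})" for j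
    using bij_betw_DiffI[OF assms, of "{j}" "{p j}"] by simp
  have "(\<Prod>j\<in>UNIV. \<Prod>l\<in>UNIV - {j}. \<bar>y $ p j - y $ p l\<bar>) = (\<Prod>j\<in>UNIV. \<Prod>l\<in>UNIV - {p j}. \<bar>y $ p j - y $ l\<bar>)"
    by (intro prod.cong refl prod.reindex_bij_betw[OF bb])
  also have "\<dots> = (\<Prod>j\<in>UNIV. \<Prod>l\<in>UNIV - {j}. \<bar>y $ j - y $ l\<bar>)"
    by (rule prod.reindex_bij_betw[OF assms])
  finally show ?thesis unfolding prod_pairs_vdm[symmetric] by simp
qed

lemma semics_pvec: "bij p \<Longrightarrow> semics (pvec p y) = semics y"
  unfolding semics_def pvec_component by (rule prod.reindex_bij_betw)

lemma psum_pvec: "bij p \<Longrightarrow> psum k (pvec p y) = psum k y"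
  unfolding psum_def pvec_component by (rule sum.reindex_bij_betw)

text \<open>The permuted copies of the alcove are disjoint and cover every point where the weight is
  nonzero. Thus the integrand is pointwise a sum of g! rearranged copies of its restriction, each
  with the same integral.\<close>

lemma integral_symmetric_valcove:
  fixes F :: "(real, 'n::{finite,wellorder}) vec \<Rightarrow> real"
  assumes F: "continuous_on UNIV F" and sym: "\<And>p y. bij p \<Longrightarrow> F (pvec p y) = F y"
  shows "(\<integral>y. F y * (vdm y)\<^sup>2 * semics y \<partial>lborel)
     = fact CARD('n) * (\<integral>y. indicator valcove y * (F y * (vdm y)\<^sup>2 * semics y) \<partial>lborel)"
proof -
  let ?S = "{p. p permutes (UNIV :: 'n set)}"
  let ?H = "\<lambda>y. F y * (vdm y)\<^sup>2 * semics y"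
  let ?A = "\<lambda>y. indicator valcove y * ?H y"
  have bij: "bij p" if "p \<in> ?S" for p using that permutes_bij by auto
  have Hint: "integrable lborel ?H" by (intro integrable_semics continuous_intros F)
  have Aint: "integrable lborel ?A"
    using integrable_mult_indicator[OF _ Hint, of valcove] borel_open[OF open_valcove] by simp
  have H: "?H y = (\<Sum>p\<in>?S. ?A (pvec p y))" for y
  proof (cases "(\<forall>i. \<bar>y $ i\<bar> < 2) \<and> vdm y \<noteq> 0")
    case True
    then have ex1: "\<exists>!p. p permutes UNIV \<and> pvec p y \<in> valcove"
      by (intro sorting_permutation) simp_all
    then obtain p where p0: "p permutes UNIV \<and> pvec p y \<in> valcove"
      and uniq0: "\<forall>q. q permutes UNIV \<and> pvec q y \<in> valcove \<longrightarrow> q = p"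
      by (rule ex1E)
    have p: "p permutes UNIV" "pvec p y \<in> valcove" using p0 by simp_all
    have uniq: "q = p" if "q permutes UNIV" "pvec q y \<in> valcove" for q
      using uniq0[rule_format, of q] that by simp
    have "(\<Sum>q\<in>?S. ?A (pvec q y)) = (\<Sum>q\<in>?S. if q = p then ?H y else 0)"
    proof (intro sum.cong refl)
      fix q assume q: "q \<in> ?S"
      have H: "?H (pvec q y) = ?H y"
        using bij[OF q] by (simp add: sym vdm_pvec semics_pvec)
      show "?A (pvec q y) = (if q = p then ?H y else 0)"
      proof (cases "q = p")
        case True
        then show ?thesis using p(2) H by simp
      next
        case False
        then have "pvec q y \<notin> valcove" using uniq[of q] q by blast
        with False show ?thesis by simp
      qed
    qed
    also have "\<dots> = ?H y"
      using p(1) by (subst sum.delta) (auto simp: finite_permutations)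
    finally show ?thesis ..
  next
    case outside: False
    have "?H y = 0"
    proof (cases "vdm y = 0")
      case False
      with outside obtain i where "\<bar>y $ i\<bar> \<ge> 2" by (auto simp: not_less)
      then have "semics y = 0" unfolding semics_def by (intro prod_zero) (auto simp: semic_eq_0_iff)
      then show ?thesis by simp
    qed simp
    moreover from this have "?A (pvec q y) = 0" if "q \<in> ?S" for q
    proof -
      have "?H (pvec q y) = ?H y"
        using bij[OF that] by (simp add: sym vdm_pvec semics_pvec)
      with \<open>?H y = 0\<close> show ?thesis by simp
    qed
    then have "(\<Sum>q\<in>?S. ?A (pvec q y)) = 0" by (intro sum.neutral ballI)
    ultimately show ?thesis by (simp only:)
  qed
  have "(\<integral>y. ?H y \<partial>lborel) = (\<integral>y. (\<Sum>p\<in>?S. ?A (pvec p y)) \<partial>lborel)"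
    by (intro Bochner_Integration.integral_cong refl H)
  also have "\<dots> = (\<Sum>p\<in>?S. \<integral>y. ?A (pvec p y) \<partial>lborel)"
    by (intro Bochner_Integration.integral_sum integral_pvec(2) bij Aint)
  also have "\<dots> = (\<Sum>p\<in>?S. \<integral>y. ?A y \<partial>lborel)"
    by (intro sum.cong refl integral_pvec(1) bij Aint)
  also have "\<dots> = fact CARD('n) * (\<integral>y. ?A y \<partial>lborel)"
    by (simp add: card_permutations[OF refl])
  finally show ?thesis .
qed

lemma open_vmap_valcove: "open (vmap ` (valcove :: (real ^ 'n::{finite,wellorder}) set))"
  by (intro invariance_of_domain continuous_on_vmap open_valcove inj_on_vmap)

lemma integral_vmap_valcove:
  fixes G :: "(real, 'n::{finite,wellorder}) vec \<Rightarrow> real"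
  assumes G: "continuous_on UNIV G"
  shows "(\<integral>y. indicator valcove y * (G (vmap y) * \<bar>vdm y\<bar>) \<partial>lborel)
       = (\<integral>s. indicator (vmap ` valcove) s * G s \<partial>lborel)"
proof -
  \<comment> \<open>Values in \<open>real^1\<close> fit the change of variables theorem, which is
    stated for maps into a Cartesian space.\<close>
  let ?f = "\<lambda>s. vec (G s) :: real^1"
  let ?U = "vmap ` valcove :: (real, 'n) vec set"
  have int: "set_integrable lborel S f"
    if "S \<in> sets borel" "S \<subseteq> K" "compact K" "continuous_on K f"
    for S K :: "(real, 'n) vec set" and f :: "(real, 'n) vec \<Rightarrow> 'b::euclidean_space"
  proof -
    have "set_integrable lborel K f"
      unfolding set_integrable_def by (rule borel_integrable_compact[OF that(3,4)])
    then show ?thesis by (rule set_integrable_subset) (use that in auto)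
  qed
  have vo: "valcove \<in> sets (borel :: (real, 'n) vec measure)" and Uo: "?U \<in> sets borel"
    by (rule borel_open[OF open_valcove], rule borel_open[OF open_vmap_valcove])
  have sub: "(valcove :: (real, 'n) vec set) \<subseteq> cube" using valcove_cube by auto
  have Uc: "?U \<subseteq> vmap ` cube" "compact (vmap ` (cube :: (real, 'n) vec set))"
    using sub by (auto intro!: compact_continuous_image continuous_on_vmap compact_cube)
  have i1: "set_integrable lborel valcove (\<lambda>y. G (vmap y) * \<bar>vdm y\<bar>)"
    by (rule int[OF vo sub compact_cube])
       (intro continuous_intros continuous_on_compose2[OF G continuous_on_vmap], auto)
  have i2: "set_integrable lborel ?U G"
    by (rule int[OF Uo Uc]) (rule continuous_on_subset[OF G], simp)
  have i3: "set_integrable lborel ?U ?f"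
    by (rule int[OF Uo Uc]) (unfold vec_def, intro continuous_intros continuous_on_subset[OF G], simp)
  have i4: "set_integrable lborel valcove (\<lambda>y. vec (G (vmap y) * \<bar>vdm y\<bar>) :: real^1)"
    by (rule int[OF vo sub compact_cube])
       (unfold vec_def, intro continuous_intros continuous_on_compose2[OF G continuous_on_vmap], auto)
  have abs3: "?f absolutely_integrable_on ?U"
    using i3 unfolding set_integrable_def by (rule integrable_completion[THEN iffD2, rotated]) (use i3 in \<open>simp add: set_integrable_def\<close>)
  have "integral valcove (\<lambda>y. \<bar>det (matrix (\<lambda>h. vjac y *v h))\<bar> *\<^sub>R ?f (vmap y)) = integral ?U ?f"
    using has_absolute_integral_change_of_variables[of valcove vmap "\<lambda>y h. vjac y *v h" ?f "integral ?U ?f",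
        OF _ vmap_has_derivative inj_on_vmap] abs3 vo by (auto intro: sets_completionI_sets)
  then have "integral valcove (\<lambda>y. \<bar>det (vjac y)\<bar> *\<^sub>R ?f (vmap y)) = integral ?U ?f"
    by simp
  moreover have "integral valcove (\<lambda>y. \<bar>det (vjac y)\<bar> *\<^sub>R ?f (vmap y)) = integral valcove (\<lambda>y. vec (G (vmap y) * \<bar>vdm y\<bar>) :: real^1)"
    by (intro Henstock_Kurzweil_Integration.integral_cong) (simp add: det_vjac valcove_vdm vec_eq_iff)
  ultimately have "integral valcove (\<lambda>y. vec (G (vmap y) * \<bar>vdm y\<bar>) :: real^1) $ 1 = integral ?U ?f $ (1 :: 1)" by simp
  moreover have "integral S (\<lambda>y. vec (f y) :: real^1) $ 1 = (LINT y:S|lborel. f y)"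
    if "set_integrable lborel S f" "set_integrable lborel S (\<lambda>y. vec (f y) :: real^1)"
    for S and f :: "(real, 'n) vec \<Rightarrow> real"
    using integral_component_eq_cart[OF set_borel_integral_eq_integral(1)[OF that(2)], of 1]
      set_borel_integral_eq_integral(2)[OF that(1)] by simp
  ultimately have "(LINT y:valcove|lborel. G (vmap y) * \<bar>vdm y\<bar>) = (LINT s:?U|lborel. G s)"
    using i1 i2 i3 i4 by simp
  then show ?thesis by (simp add: set_lebesgue_integral_def)
qed

text \<open>The change of variables theorem needs a well-ordered index type, hence this copy of a finite
  type with an arbitrary linear order.\<close>

typedef 'a wo = "UNIV :: 'a set" morphisms unwo Wo by auto

instance wo :: (finite) finite
proof
  have "(UNIV :: 'a wo set) = range Wo" by (metis Wo_cases surj_def UNIV_I)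
  then show "finite (UNIV :: 'a wo set)" by (metis finite finite_imageI)
qed

instantiation wo :: (finite) wellorder
begin

definition wo_index :: "'a wo \<Rightarrow> nat" where
  "wo_index = to_nat_on UNIV"

definition less_eq_wo :: "'a wo \<Rightarrow> 'a wo \<Rightarrow> bool" where
  "less_eq_wo a b \<longleftrightarrow> wo_index a \<le> wo_index b"

definition less_wo :: "'a wo \<Rightarrow> 'a wo \<Rightarrow> bool" where
  "less_wo a b \<longleftrightarrow> wo_index a < wo_index b"

instance
proof
  have inj: "wo_index a = wo_index b \<longleftrightarrow> a = b" for a b :: "'a wo"
    by (simp add: wo_index_def countable_finite)
  fix a b c :: "'a wo"
  show "a < b \<longleftrightarrow> a \<le> b \<and> \<not> b \<le> a" by (auto simp: less_eq_wo_def less_wo_def)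
  show "a \<le> a" by (simp add: less_eq_wo_def)
  show "a \<le> b \<Longrightarrow> b \<le> c \<Longrightarrow> a \<le> c" by (simp add: less_eq_wo_def)
  show "a \<le> b \<Longrightarrow> b \<le> a \<Longrightarrow> a = b" using inj by (simp add: less_eq_wo_def)
  show "a \<le> b \<or> b \<le> a" by (auto simp: less_eq_wo_def)
next
  fix P :: "'a wo \<Rightarrow> bool" and a
  assume step: "\<And>x. (\<And>y. y < x \<Longrightarrow> P y) \<Longrightarrow> P x"
  show "P a"
    by (induction "wo_index a" arbitrary: a rule: less_induct) (auto intro: step simp: less_wo_def)
qed

end

lemma bij_unwo: "bij unwo"
  by (metis Wo_inverse bijI' UNIV_I unwo_inject)

lemma card_wo: "CARD('a wo) = CARD('a::finite)"
  using bij_betw_same_card[OF bij_unwo] by simp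

section \<open>Translation between functions on {1..g} and vectors\<close>

definition tpos :: "'n::{finite,linorder} \<Rightarrow> nat" where
  "tpos i = Suc (ordrank i)"

definition tovec :: "(nat \<Rightarrow> real) \<Rightarrow> real ^ 'n::{finite,linorder}" where
  "tovec t = (\<chi> i. t (tpos i))"

definition unvec :: "real ^ 'n::{finite,linorder} \<Rightarrow> nat \<Rightarrow> real" where
  "unvec y = (\<lambda>j\<in>{1..CARD('n)}. y $ inv_into UNIV tpos j)"

lemma bij_tpos: "bij_betw tpos (UNIV :: 'n::{finite,linorder} set) {1..CARD('n)}"
proof -
  have "bij_betw Suc {..<CARD('n)} {1..CARD('n)}"
    by (rule bij_betwI[where g = "\<lambda>k. k - 1"]) auto
  from bij_betw_trans[OF bij_ordrank this] show ?thesis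
    by (simp add: tpos_def[abs_def] comp_def)
qed

lemma tpos_range: "tpos (i :: 'n::{finite,linorder}) \<in> {1..CARD('n)}"
  using bij_tpos[where 'n = 'n] by (auto simp: bij_betw_def)

lemma tpos_bounds [simp]: "Suc 0 \<le> tpos i" "tpos (i :: 'n::{finite,linorder}) \<le> CARD('n)"
  using tpos_range[of i] by auto

lemma inj_tpos [simp]: "inj tpos"
  using bij_tpos by (auto simp: bij_betw_def)

lemma inv_tpos [simp]: "inv_into UNIV tpos (tpos i) = i"
  by simp

lemma tpos_inv:
  assumes "j \<in> {1..CARD('n::{finite,linorder})}"
  shows "tpos (inv_into UNIV tpos j :: 'n) = j"
  using bij_tpos[where 'n = 'n] assms by (simp add: bij_betw_def f_inv_into_f)

lemma tpos_less: "tpos i < tpos j \<longleftrightarrow> i < j"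
  unfolding tpos_def using ordrank_less by (metis Suc_less_eq linorder_less_linear not_less_iff_gr_or_eq)

lemma tovec_unvec [simp]: "tovec (unvec y) = y"
  by (simp add: tovec_def unvec_def vec_eq_iff)

lemma unvec_tovec:
  assumes "t \<in> extensional {1..CARD('n::{finite,linorder})}"
  shows "unvec (tovec t :: (real, 'n) vec) = t"
  using assms by (auto simp: fun_eq_iff unvec_def tovec_def tpos_inv extensional_def)

lemma unvec_ext: "unvec (y :: real ^ 'n::{finite,linorder}) \<in> extensional {1..CARD('n)}"
  by (simp add: unvec_def)

lemma elem_sym_tovec:
  "elem_sym CARD('n) k t = esym k UNIV (tovec t :: (real, 'n::{finite,linorder}) vec)"
proof -
  have inj: "inj_on tpos X" for X :: "'n set"
    by (rule inj_on_subset[OF inj_tpos]) simp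
  have "elem_sym CARD('n) k t = (\<Sum>X | X \<subseteq> (UNIV :: 'n set) \<and> card X = k. \<Prod>i\<in>tpos ` X. t i)"
    unfolding elem_sym_def
  proof (rule sum.reindex_bij_witness[where i = "\<lambda>X. tpos ` X" and j = "\<lambda>Y. inv_into UNIV tpos ` Y"])
    fix Y assume Y: "Y \<in> {X. X \<subseteq> {1..CARD('n)} \<and> card X = k}"
    show e: "tpos ` inv_into (UNIV :: 'n set) tpos ` Y = Y"
      using Y tpos_inv[where 'n = 'n] by (force simp: image_image)
    show "inv_into (UNIV :: 'n set) tpos ` Y \<in> {X. X \<subseteq> UNIV \<and> card X = k}"
      using Y e card_image[OF inj] by (metis (mono_tags, lifting) mem_Collect_eq subset_UNIV)
    show "prod t (tpos ` inv_into (UNIV :: 'n set) tpos ` Y) = prod t Y" by (simp only: e)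
  next
    fix X :: "'n set" assume X: "X \<in> {X. X \<subseteq> UNIV \<and> card X = k}"
    show "inv_into UNIV tpos ` tpos ` X = X" by (simp add: image_image)
    show "tpos ` X \<in> {X. X \<subseteq> {1..CARD('n)} \<and> card X = k}"
      using X tpos_range[where 'n = 'n] by (auto simp: card_image[OF inj])
  qed
  also have "\<dots> = esym k UNIV (tovec t :: (real, 'n) vec)"
    unfolding esym_def tovec_def by (simp add: prod.reindex[OF inj])
  finally show ?thesis .
qed

lemma tovec_viete: "tovec (viete CARD('n) t) = vmap (tovec t :: (real, 'n::{finite,linorder}) vec)"
  using tpos_range[where 'n = 'n] elem_sym_tovec[where 'n = 'n]
  by (simp add: vec_eq_iff vmap_def viete_def tovec_def[of "restrict _ _"] tpos_def)

lemma tovec_alcove: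
  assumes "t \<in> extensional {1..CARD('n::{finite,linorder})}"
  shows "t \<in> alcove CARD('n) \<longleftrightarrow> (tovec t :: (real, 'n) vec) \<in> valcove"
proof
  assume t: "t \<in> alcove CARD('n)"
  show "(tovec t :: (real, 'n) vec) \<in> valcove"
  proof -
    have "t (tpos i) \<in> {-2<..<2}" for i :: 'n
      using t by (auto simp: alcove_def)
    moreover have "t (tpos i) < t (tpos j)" if "i < j" for i j :: 'n
      using t that tpos_range[of i] tpos_range[of j] by (auto simp: alcove_def tpos_less)
    ultimately show ?thesis by (auto simp: valcove_def tovec_def abs_less_iff minus_less_iff)
  qed
next
  assume v: "(tovec t :: (real, 'n) vec) \<in> valcove"
  have "t j = (tovec t :: (real, 'n) vec) $ inv_into UNIV tpos j" if "j \<in> {1..CARD('n)}" for j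
    using that by (simp add: tovec_def tpos_inv)
  moreover have "(inv_into UNIV tpos j :: 'n) < inv_into UNIV tpos k"
    if "j \<in> {1..CARD('n)}" "k \<in> {1..CARD('n)}" "j < k" for j k
    using that by (simp add: tpos_less[symmetric] tpos_inv)
  ultimately show "t \<in> alcove CARD('n)"
    using v assms by (auto simp: alcove_def valcove_def PiE_iff abs_less_iff minus_less_iff)
qed

lemma tovec_viete_domain:
  assumes "s \<in> extensional {1..CARD('n::{finite,linorder})}"
  shows "s \<in> viete_domain CARD('n) \<longleftrightarrow> (tovec s :: (real, 'n) vec) \<in> vmap ` valcove"
proof
  assume "s \<in> viete_domain CARD('n)"
  then obtain t where t: "t \<in> alcove CARD('n)" "s = viete CARD('n) t" by (auto simp: viete_domain_def)
  then have "t \<in> extensional {1..CARD('n)}" by (auto simp: alcove_def PiE_def)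
  with t show "(tovec s :: (real, 'n) vec) \<in> vmap ` valcove"
    using tovec_alcove tovec_viete by blast
next
  assume "(tovec s :: (real, 'n) vec) \<in> vmap ` valcove"
  then obtain y :: "(real, 'n) vec" where y: "y \<in> valcove" "tovec s = vmap y" by blast
  have "unvec y \<in> alcove CARD('n)" using y(1) tovec_alcove[OF unvec_ext, of y] by simp
  moreover have "tovec (viete CARD('n) (unvec y)) = (tovec s :: (real, 'n) vec)"
    using y(2) by (simp add: tovec_viete)
  then have "viete CARD('n) (unvec y) = s"
    using unvec_tovec[OF assms] unvec_tovec[of "viete CARD('n) (unvec y)"]
    by (metis viete_def restrict_extensional)
  ultimately show "s \<in> viete_domain CARD('n)" by (auto simp: viete_domain_def)
qed

lemma tovec_borel:
  "(tovec :: (nat \<Rightarrow> real) \<Rightarrow> (real, 'n::{finite,linorder}) vec) \<in> measurable (PiM {1..CARD('n)} (\<lambda>_. lborel :: real measure)) borel"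
  unfolding tovec_def[abs_def]
  by (rule borel_measurable_vec_lambda[where f = "\<lambda>t i. t (tpos i)"]) auto

lemma lborel_tovec:
  "(lborel :: (real, 'n::{finite,linorder}) vec measure) = distr (PiM {1..CARD('n)} (\<lambda>_. lborel :: real measure)) borel tovec"
proof -
  let ?e = "inv_into (UNIV :: 'n set) tpos"
  have e: "bij_betw ?e {1..CARD('n)} UNIV" by (rule bij_betw_inv_into[OF bij_tpos])
  have "inv_into {1..CARD('n)} ?e i = tpos i" for i
    using e tpos_range[of i] by (intro inv_into_f_eq) (auto simp: bij_betw_def)
  then show ?thesis using lborel_vec_eq_PiM[OF e] by (simp add: tovec_def[abs_def])
qed

lemma vdm_tovec:
  "(\<Prod>(j, k)\<in>{(j, k). j \<in> {1..CARD('n)} \<and> k \<in> {1..CARD('n)} \<and> j < k}. (t k - t j)\<^sup>2)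
    = (vdm (tovec t :: (real, 'n::{finite,linorder}) vec))\<^sup>2"
proof -
  have "(\<Prod>p | fst p < snd p. ((tovec t :: (real, 'n) vec) $ snd p - tovec t $ fst p)\<^sup>2)
     = (\<Prod>(j, k)\<in>{(j, k). j \<in> {1..CARD('n)} \<and> k \<in> {1..CARD('n)} \<and> j < k}. (t k - t j)\<^sup>2)"
  proof (rule prod.reindex_bij_witness[where j = "map_prod tpos tpos" and i = "map_prod (inv_into UNIV tpos) (inv_into UNIV tpos)"])
    fix b assume b: "b \<in> {(j, k). j \<in> {1..CARD('n)} \<and> k \<in> {1..CARD('n)} \<and> j < k}"
    then obtain j k where jk: "b = (j, k)" "j < k" "j \<in> {1..CARD('n)}" "k \<in> {1..CARD('n)}"
      by auto
    show "map_prod (inv_into (UNIV :: 'n set) tpos) (inv_into (UNIV :: 'n set) tpos) b \<in> {p. fst p < snd p}"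
      "map_prod tpos tpos (map_prod (inv_into (UNIV :: 'n set) tpos) (inv_into (UNIV :: 'n set) tpos) b) = b"
      using jk(1,2) tpos_inv[OF jk(3)] tpos_inv[OF jk(4)] by (auto simp: tpos_less[symmetric])
  next
    fix a :: "'n \<times> 'n" assume "a \<in> {p. fst p < snd p}"
    then show "map_prod tpos tpos a \<in> {(j, k). j \<in> {1..CARD('n)} \<and> k \<in> {1..CARD('n)} \<and> j < k}"
      using tpos_range[of "fst a"] tpos_range[of "snd a"] by (cases a) (auto simp: tpos_less)
  qed (auto simp: tovec_def case_prod_unfold)
  then show ?thesis unfolding vdm_def prod_power_distrib[symmetric] ..
qed

lemma prod_tovec: "(\<Prod>j\<in>{1..CARD('n)}. f (t j)) = (\<Prod>i\<in>UNIV. f ((tovec t :: (real, 'n::{finite,linorder}) vec) $ i))"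
  using prod.reindex_bij_betw[OF bij_tpos[where 'n = 'n], of "\<lambda>j. f (t j)"] by (simp add: tovec_def)

lemma sqrt_prod: "sqrt (\<Prod>i\<in>A. f i) = (\<Prod>i\<in>A. sqrt (f i))"
  by (induction A rule: infinite_finite_induct) (simp_all add: real_sqrt_mult)

text \<open>The bounds on \<open>y\<close> are not strict, so that the formula also reaches the
  boundary of the alcove, where the right side vanishes.\<close>

lemma nu_vmap:
  fixes y :: "(real, 'n::{finite,linorder}) vec"
  assumes "is_d0 CARD('n) d0" "is_d1 CARD('n) d1" and y: "\<And>i. \<bar>y $ i\<bar> \<le> 2"
  shows "nu CARD('n) d0 d1 (unvec (vmap y)) = 1 / (2 * pi) ^ CARD('n) * (\<bar>vdm y\<bar> * semics y)"
proof -
  have v: "unvec (vmap y) = viete CARD('n) (unvec y)"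
    using unvec_tovec[of "viete CARD('n) (unvec y)", where 'n = 'n] tovec_viete[of "unvec y", where 'n = 'n]
    by (simp add: viete_def[of _ "unvec y"])
  have "eval_ipoly d0 (viete CARD('n) (unvec y)) = (vdm y)\<^sup>2"
    using assms(1) vdm_tovec[of "unvec y", where 'n = 'n] by (simp add: is_d0_def)
  moreover have "eval_ipoly d1 (viete CARD('n) (unvec y)) = (\<Prod>i\<in>UNIV. 4 - (y $ i)\<^sup>2)"
    using assms(2) prod_tovec[of "\<lambda>x. 4 - x\<^sup>2" "unvec y", where 'n = 'n] by (simp add: is_d1_def)
  moreover have "sqrt (\<Prod>i\<in>UNIV. 4 - (y $ i)\<^sup>2) = semics y"
    unfolding semics_def using semic_eq[OF y] by (simp add: sqrt_prod)
  ultimately show ?thesis by (simp add: nu_def v real_sqrt_mult)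
qed

section \<open>Integration over slices\<close>

definition closed_valcove :: "(real ^ 'n::{finite,linorder}) set" where
  "closed_valcove = {y. (\<forall>i. \<bar>y $ i\<bar> \<le> 2) \<and> (\<forall>i j. i < j \<longrightarrow> y $ i \<le> y $ j)}"

lemma compact_closed_valcove: "compact (closed_valcove :: (real ^ 'n::{finite,linorder}) set)"
proof -
  have "closed_valcove = cube \<inter> (\<Inter>p\<in>{p. fst p < snd p}. {y :: (real, 'n) vec. y $ fst p \<le> y $ snd p})"
    by (auto simp: closed_valcove_def cube_def)
  also have "compact \<dots>"
    by (intro compact_Int_closed compact_cube closed_INT ballI closed_Collect_le continuous_intros)
  finally show ?thesis .
qed

lemma valcove_subset: "valcove \<subseteq> closed_valcove"
  by (auto simp: valcove_def closed_valcove_def less_imp_le)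

text \<open>On the boundary a coordinate has modulus 2, which kills \<open>semics\<close>, or two
  coordinates coincide, which kills \<open>vdm\<close>.\<close>

lemma closed_valcove_boundary:
  assumes "y \<in> closed_valcove" "y \<notin> valcove"
  shows "\<bar>vdm y\<bar> * semics y = 0"
proof (cases "\<exists>i. \<bar>y $ i\<bar> = 2")
  case True
  then obtain i where "\<bar>y $ i\<bar> = 2" by blast
  then have "semics y = 0" unfolding semics_def by (intro prod_zero) (auto simp: semic_eq_0_iff intro!: exI[of _ i])
  then show ?thesis by simp
next
  case False
  then have "\<bar>y $ i\<bar> < 2" for i using assms(1) by (auto simp: closed_valcove_def order_less_le)
  then obtain i j where "i < j" "\<not> y $ i < y $ j" using assms(2) by (auto simp: valcove_def)
  then have "i \<noteq> j" "y $ i = y $ j" using assms(1) by (auto simp: closed_valcove_def order_less_le)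
  then have "vdm y = 0" using vdm_nonzero_iff by blast
  then show ?thesis by simp
qed

lemma continuous_on_eval_ipoly:
  assumes "\<And>i. continuous_on S (\<lambda>x. s x i)"
  shows "continuous_on S (\<lambda>x. eval_ipoly p (s x))"
  unfolding eval_ipoly_def by (intro continuous_intros assms)

lemma continuous_on_unvec: "continuous_on S (\<lambda>y. unvec y i)"
  unfolding unvec_def by (cases "i \<in> {1..CARD('a)}") (auto intro!: continuous_intros)

text \<open>Extension by zero, so that the varying slice domains disappear from the
  integrals.\<close>

definition nuvec :: "ipoly \<Rightarrow> ipoly \<Rightarrow> real ^ 'n::{finite,wellorder} \<Rightarrow> real" where
  "nuvec d0 d1 s = (if s \<in> vmap ` valcove then nu CARD('n) d0 d1 (unvec s) else 0)"

context
  fixes d0 d1 :: ipoly and ty :: "'n::{finite,wellorder} itself"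
  assumes d0: "is_d0 CARD('n) d0" and d1: "is_d1 CARD('n) d1"
begin

text \<open>Gluing on two closed sets: the image of the closed alcove and the complement of the open
  image. A point in both is the image of a boundary point, where \<open>nu\<close> vanishes.\<close>

lemma continuous_on_nuvec: "continuous_on UNIV (nuvec d0 d1 :: (real, 'n) vec \<Rightarrow> real)"
proof -
  let ?U = "vmap ` (valcove :: (real, 'n) vec set)" and ?K = "vmap ` (closed_valcove :: (real, 'n) vec set)"
  have K: "closed ?K"
    by (intro compact_imp_closed compact_continuous_image continuous_on_vmap compact_closed_valcove)
  have U: "closed (- ?U)" by (rule closed_Compl[OF open_vmap_valcove])
  have "?U \<subseteq> ?K" using valcove_subset by blast
  then have un: "?K \<union> - ?U = UNIV" by blast
  have c: "continuous_on S (\<lambda>s :: (real, 'n) vec. nu CARD('n) d0 d1 (unvec s))" for S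
    unfolding nu_def by (intro continuous_intros continuous_on_eval_ipoly continuous_on_unvec)
  have zero: "nu CARD('n) d0 d1 (unvec s) = 0" if s: "s \<in> ?K" "s \<notin> ?U" for s
  proof -
    from s obtain y where y: "y \<in> closed_valcove" "s = vmap y" "y \<notin> valcove" by blast
    then show ?thesis
      using nu_vmap[OF d0 d1, of y] closed_valcove_boundary[of y] by (auto simp: closed_valcove_def)
  qed
  have "continuous_on (?K \<union> - ?U) (\<lambda>s. if s \<in> ?U then nu CARD('n) d0 d1 (unvec s) else 0)"
    by (rule continuous_on_cases[OF K U c continuous_on_const]) (use zero in auto)
  then show ?thesis unfolding un nuvec_def[abs_def] .
qed

lemma nuvec_bounds:
  obtains R C where "R \<ge> 0" "\<And>s. \<bar>nuvec d0 d1 (s :: (real, 'n) vec)\<bar> \<le> C"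
    "\<And>s i. \<bar>(s :: (real, 'n) vec) $ i\<bar> > R \<Longrightarrow> nuvec d0 d1 s = 0"
proof -
  let ?K = "vmap ` (cube :: (real, 'n) vec set)"
  have K: "compact ?K" by (intro compact_continuous_image continuous_on_vmap compact_cube)
  have sub: "vmap ` (valcove :: (real, 'n) vec set) \<subseteq> ?K" using valcove_cube by blast
  from compact_imp_bounded[OF K] obtain R where R: "\<And>s. s \<in> ?K \<Longrightarrow> norm s \<le> R"
    unfolding bounded_iff by blast
  have "compact ((nuvec d0 d1 :: (real, 'n) vec \<Rightarrow> real) ` ?K)"
    by (rule compact_continuous_image[OF continuous_on_subset[OF continuous_on_nuvec] K]) simp
  from compact_imp_bounded[OF this] obtain C where C: "\<And>s. s \<in> ?K \<Longrightarrow> \<bar>nuvec d0 d1 s\<bar> \<le> C"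
    unfolding bounded_iff by fastforce
  have out: "nuvec d0 d1 s = 0" if "s \<notin> ?K" for s :: "(real, 'n) vec"
    using that sub by (auto simp: nuvec_def)
  show ?thesis
  proof (rule that[of "max 0 R" "max 0 C"])
    show "\<bar>nuvec d0 d1 s\<bar> \<le> max 0 C" for s :: "(real, 'n) vec"
      using C[of s] out[of s] by (cases "s \<in> ?K") auto
    show "nuvec d0 d1 s = 0" if "\<bar>s $ i\<bar> > max 0 R" for s :: "(real, 'n) vec" and i
      using out[of s] R[of s] that component_le_norm_cart[of s i] by (cases "s \<in> ?K") auto
  qed simp
qed

lemma slice_integral_nuvec:
  "slice_integral CARD('n) (nu CARD('n) d0 d1) x
     = (\<integral>v. nuvec d0 d1 (tovec (v(1 := x)) :: (real, 'n) vec) \<partial>PiM {2..CARD('n)} (\<lambda>_. lborel))"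
  unfolding slice_integral_def set_lebesgue_integral_def
proof (intro Bochner_Integration.integral_cong refl)
  let ?n = "CARD('n)"
  fix v assume "v \<in> space (PiM {2..?n} (\<lambda>_. lborel :: real measure))"
  then have v: "v \<in> extensional {2..?n}" by (auto simp: space_PiM PiE_def)
  have n: "1 \<le> ?n" by (simp add: Suc_leI)
  have ext: "v(1 := x) \<in> extensional {1..?n}" using v n by (auto simp: extensional_def)
  have "v \<in> (\<lambda>s. restrict s {2..?n}) ` viete_slice ?n x \<longleftrightarrow> v(1 := x) \<in> viete_domain ?n"
  proof
    assume "v \<in> (\<lambda>s. restrict s {2..?n}) ` viete_slice ?n x"
    then obtain s where s: "s \<in> viete_domain ?n" "s 1 = x" "v = restrict s {2..?n}"
      by (auto simp: viete_slice_def)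
    have "s \<in> extensional {1..?n}" using s(1) by (auto simp: viete_domain_def viete_def)
    then have "v(1 := x) = s" using s n by (auto simp: fun_eq_iff extensional_def)
    with s show "v(1 := x) \<in> viete_domain ?n" by simp
  next
    assume d: "v(1 := x) \<in> viete_domain ?n"
    have "restrict (v(1 := x)) {2..?n} = v" using v by (auto simp: fun_eq_iff extensional_def)
    then show "v \<in> (\<lambda>s. restrict s {2..?n}) ` viete_slice ?n x"
      using d by (intro image_eqI[of _ _ "v(1 := x)"]) (auto simp: viete_slice_def)
  qed
  also have "\<dots> \<longleftrightarrow> (tovec (v(1 := x)) :: (real, 'n) vec) \<in> vmap ` valcove"
    by (rule tovec_viete_domain[OF ext])
  finally show "indicat_real ((\<lambda>s. restrict s {2..?n}) ` viete_slice ?n x) v *\<^sub>R nu ?n d0 d1 (v(1 := x))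
      = nuvec d0 d1 (tovec (v(1 := x)) :: (real, 'n) vec)"
    using unvec_tovec[OF ext] by (simp add: nuvec_def indicator_def)
qed

lemma tovec_upd_measurable:
  "(\<lambda>v. tovec (v(1 := x)) :: (real, 'n) vec) \<in> measurable (PiM {2..CARD('n)} (\<lambda>_. lborel :: real measure)) borel"
proof -
  have "(\<lambda>v. (v(1 := x)) (tpos i)) \<in> borel_measurable (PiM {2..CARD('n)} (\<lambda>_. lborel :: real measure))" for i :: 'n
  proof (cases "tpos i = 1")
    case False
    then have "2 \<le> tpos i" by (simp add: tpos_def)
    then have "tpos i \<in> {2..CARD('n)}" by simp
    then show ?thesis using False by simp
  qed simp
  then show ?thesis
    unfolding tovec_def by (rule borel_measurable_vec_lambda[where f = "\<lambda>v i. (v(1 := x)) (tpos i)"])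
qed

text \<open>Dominated convergence: \<open>nuvec\<close> is continuous and bounded, and all slices of
  its support lie in one box \<open>?B\<close>.\<close>

lemma continuous_slice_integral:
  "continuous_on UNIV (slice_integral CARD('n) (nu CARD('n) d0 d1))"
proof -
  let ?n = "CARD('n)" and ?P = "PiM {2..CARD('n)} (\<lambda>_. lborel :: real measure)"
  interpret product_sigma_finite "\<lambda>_ :: nat. lborel :: real measure" by standard
  obtain R C where R: "R \<ge> 0" and C: "\<And>s. \<bar>nuvec d0 d1 (s :: (real, 'n) vec)\<bar> \<le> C"
    and out: "\<And>s i. \<bar>(s :: (real, 'n) vec) $ i\<bar> > R \<Longrightarrow> nuvec d0 d1 s = 0"
    using nuvec_bounds by blast
  let ?h = "\<lambda>x v. nuvec d0 d1 (tovec (v(1 := x)) :: (real, 'n) vec)"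
  let ?B = "PiE {2..?n} (\<lambda>_. {-R..R})"
  have meas: "?h x \<in> borel_measurable ?P" for x
    using measurable_compose[OF tovec_upd_measurable borel_measurable_continuous_onI[OF continuous_on_nuvec]] .
  have B: "?B \<in> sets ?P" by (intro sets_PiM_I_finite) auto
  have "emeasure ?P ?B = (\<Prod>i\<in>{2..?n}. emeasure lborel {-R..R})"
    by (rule emeasure_PiM) auto
  then have Bf: "emeasure ?P ?B < \<infinity>" using R by (simp add: ennreal_power ennreal_less_top)
  have bound: "norm (?h x v) \<le> C * indicator ?B v" if "v \<in> space ?P" for x v
  proof (cases "v \<in> ?B")
    case False
    have "v \<in> extensional {2..?n}" using that by (auto simp: space_PiM PiE_def)
    with False obtain j where j: "j \<in> {2..?n}" "v j \<notin> {-R..R}" by (auto simp: PiE_iff)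
    define i where "i = (inv_into UNIV tpos j :: 'n)"
    have "tpos i = j" unfolding i_def using j by (intro tpos_inv) auto
    then have "(tovec (v(1 := x)) :: (real, 'n) vec) $ i = v j" using j by (simp add: tovec_def)
    then have "\<bar>(tovec (v(1 := x)) :: (real, 'n) vec) $ i\<bar> > R" using j by auto
    from out[OF this] False show ?thesis by simp
  qed (use C in auto)
  have "(\<lambda>k. \<integral>v. ?h (X k) v \<partial>?P) \<longlonglongrightarrow> (\<integral>v. ?h x v \<partial>?P)" if X: "X \<longlonglongrightarrow> x" for X x
  proof (rule integral_dominated_convergence[where w = "\<lambda>v. C * indicator ?B v"])
    show "integrable ?P (\<lambda>v. C * indicator ?B v)"
      using B Bf by (intro integrable_mult_right integrable_real_indicator)
    show "AE v in ?P. norm (?h (X k) v) \<le> C * indicator ?B v" for k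
      using bound by (intro AE_I2)
    show "AE v in ?P. (\<lambda>k. ?h (X k) v) \<longlonglongrightarrow> ?h x v"
    proof (intro AE_I2)
      fix v
      have "continuous_on UNIV (\<lambda>x. tovec (v(1 := x)) :: (real, 'n) vec)"
        unfolding tovec_def
      proof (intro continuous_on_vec_lambda)
        show "continuous_on UNIV (\<lambda>x. (v(1 := x)) (tpos i))" for i :: 'n
          by (cases "tpos i = 1") (auto intro: continuous_intros)
      qed
      then have c: "continuous_on UNIV (\<lambda>x. ?h x v)"
        by (rule continuous_on_compose2[OF continuous_on_nuvec]) simp
      show "(\<lambda>k. ?h (X k) v) \<longlonglongrightarrow> ?h x v"
        using continuous_on_tendsto_compose[OF c X] by simp
    qed
  qed (use meas in auto)
  then show ?thesis
    unfolding continuous_on_sequentially slice_integral_nuvec comp_def by auto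
qed

text \<open>The index set {1..g} is split into {1} and {2..g}. For g = 1 the second set is empty and
  the inner integral is evaluation at the only point.\<close>

lemma fubini_slice:
  fixes \<phi> :: "real \<Rightarrow> real"
  assumes \<phi>: "continuous_on UNIV \<phi>"
  shows "(\<integral>s. \<phi> (s $ inv_into UNIV tpos 1) * nuvec d0 d1 s \<partial>(lborel :: (real, 'n) vec measure))
      = (\<integral>x. \<phi> x * slice_integral CARD('n) (nu CARD('n) d0 d1) x \<partial>lborel)" (is ?eq)
    "integrable lborel (\<lambda>x. \<phi> x * slice_integral CARD('n) (nu CARD('n) d0 d1) x)"
proof -
  let ?n = "CARD('n)" and ?F = "slice_integral CARD('n) (nu CARD('n) d0 d1)"
  let ?P = "\<lambda>I. PiM I (\<lambda>_ :: nat. lborel :: real measure)"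
  interpret product_sigma_finite "\<lambda>_ :: nat. lborel :: real measure" by standard
  define i1 where "i1 = (inv_into UNIV tpos 1 :: 'n)"
  have i1: "tpos i1 = 1" unfolding i1_def by (rule tpos_inv) (simp add: Suc_leI)
  define \<Psi> where "\<Psi> s = \<phi> (s $ i1) * nuvec d0 d1 s" for s :: "(real, 'n) vec"
  obtain R C where R: "R \<ge> 0" and C: "\<And>s. \<bar>nuvec d0 d1 (s :: (real, 'n) vec)\<bar> \<le> C"
    and out: "\<And>s i. \<bar>(s :: (real, 'n) vec) $ i\<bar> > R \<Longrightarrow> nuvec d0 d1 s = 0"
    using nuvec_bounds by blast
  have \<Psi>c: "continuous_on UNIV \<Psi>"
    unfolding \<Psi>_def by (intro continuous_intros continuous_on_nuvec continuous_on_compose2[OF \<phi>]) auto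
  have \<Psi>i: "integrable lborel \<Psi>"
  proof -
    let ?K = "cbox (- vec R) (vec R) :: (real, 'n) vec set"
    have "integrable lborel (\<lambda>s. indicator ?K s *\<^sub>R \<Psi> s)"
      by (intro borel_integrable_compact continuous_on_subset[OF \<Psi>c]) auto
    moreover have "indicator ?K s *\<^sub>R \<Psi> s = \<Psi> s" for s
    proof (cases "s \<in> ?K")
      case False
      then obtain i where "\<not> (- R \<le> s $ i \<and> s $ i \<le> R)" by (auto simp: mem_box_cart)
      then have "\<bar>s $ i\<bar> > R" by linarith
      then show ?thesis by (simp add: \<Psi>_def out)
    qed simp
    ultimately show ?thesis by (simp only:)
  qed
  have F0: "?F x = 0" if "x \<notin> {-R..R}" for x
  proof -
    have "nuvec d0 d1 (tovec (v(1 := x)) :: (real, 'n) vec) = 0" for v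
    proof (rule out)
      show "R < \<bar>(tovec (v(1 := x)) :: (real, 'n) vec) $ i1\<bar>"
        using that i1 by (auto simp: tovec_def)
    qed
    then show ?thesis unfolding slice_integral_nuvec by simp
  qed
  have Fc: "continuous_on UNIV (\<lambda>x. \<phi> x * ?F x)"
    by (intro continuous_on_mult \<phi> continuous_slice_integral)
  show "integrable lborel (\<lambda>x. \<phi> x * ?F x)"
  proof -
    have "integrable lborel (\<lambda>x. indicator {-R..R} x *\<^sub>R (\<phi> x * ?F x))"
      by (intro borel_integrable_compact continuous_on_subset[OF Fc]) auto
    moreover have "indicator {-R..R} x *\<^sub>R (\<phi> x * ?F x) = \<phi> x * ?F x" for x
      using F0[of x] by (cases "x \<in> {-R..R}") auto
    ultimately show ?thesis by (simp only:)
  qed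
  have un: "{1..?n} = {1} \<union> {2..?n}" using Suc_leI[of 0 ?n] by auto
  have m: "\<Psi> \<in> borel_measurable borel" by (rule borel_measurable_continuous_onI[OF \<Psi>c])
  have "(\<integral>s. \<Psi> s \<partial>lborel) = (\<integral>t. \<Psi> (tovec t) \<partial>?P {1..?n})"
    by (subst lborel_tovec, rule integral_distr[OF tovec_borel m])
  also have "\<dots> = (\<integral>x. (\<integral>v. \<Psi> (tovec (merge {1} {2..?n} (x, v))) \<partial>?P {2..?n}) \<partial>?P {1})"
    unfolding un
  proof (rule product_integral_fold)
    have "integrable (?P {1..?n}) (\<lambda>t. \<Psi> (tovec t))"
      using \<Psi>i unfolding lborel_tovec[where 'n = 'n] integrable_distr_eq[OF tovec_borel m] .
    then show "integrable (?P ({1} \<union> {2..?n})) (\<lambda>t. \<Psi> (tovec t))" unfolding un .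
  qed auto
  also have "\<dots> = (\<integral>x. \<phi> (x 1) * ?F (x 1) \<partial>?P {1})"
  proof (intro Bochner_Integration.integral_cong refl)
    fix x :: "nat \<Rightarrow> real"
    have "\<Psi> (tovec (merge {1} {2..?n} (x, v))) = \<phi> (x 1) * nuvec d0 d1 (tovec (v(1 := x 1)) :: (real, 'n) vec)" for v
    proof -
      have "merge {1} {2..?n} (x, v) (tpos i) = (v(1 := x 1)) (tpos i)" for i :: 'n
        by (auto simp: merge_def tpos_def Suc_le_eq ordrank_less_card)
      then have "tovec (merge {1} {2..?n} (x, v)) = (tovec (v(1 := x 1)) :: (real, 'n) vec)"
        by (simp add: tovec_def)
      then show ?thesis by (simp add: \<Psi>_def) (simp add: tovec_def i1)
    qed
    then show "(\<integral>v. \<Psi> (tovec (merge {1} {2..?n} (x, v))) \<partial>?P {2..?n}) = \<phi> (x 1) * ?F (x 1)"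
      unfolding slice_integral_nuvec by simp
  qed
  also have "\<dots> = (\<integral>x. \<phi> x * ?F x \<partial>lborel)"
    by (rule product_integral_singleton) (use borel_measurable_continuous_onI[OF Fc] in simp)
  finally show ?eq unfolding \<Psi>_def i1_def .
qed

end

section \<open>The trace density\<close>

text \<open>If \<open>p\<close> approximates \<open>D\<close> uniformly within \<open>e\<close>,
  orthogonality gives that the integral of D^2 equals that of (D - p) D and is at most
  \<open>e\<close> times the integral of the modulus of \<open>D\<close>.\<close>

lemma polynomial_orthogonal_zero:
  fixes D :: "real \<Rightarrow> real"
  assumes ab: "a < b" and D: "continuous_on {a..b} D"
    and orth: "\<And>p. real_polynomial_function p \<Longrightarrow> (LBINT x:{a..b}. p x * D x) = 0"
    and x: "x \<in> {a..b}"
  shows "D x = 0"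
proof -
  have int: "set_integrable lborel {a..b} f" if "continuous_on {a..b} f" for f :: "real \<Rightarrow> real"
    unfolding set_integrable_def by (rule borel_integrable_compact[OF compact_Icc that])
  define I where "I = (LBINT x:{a..b}. (D x)\<^sup>2)"
  define A where "A = (LBINT x:{a..b}. \<bar>D x\<bar>)"
  have A0: "A \<ge> 0" unfolding A_def set_lebesgue_integral_def by (intro integral_nonneg_AE AE_I2) auto
  have small: "I \<le> e * A" if e: "e > 0" for e
  proof -
    obtain p where p: "real_polynomial_function p" and close: "\<And>x. x \<in> {a..b} \<Longrightarrow> \<bar>D x - p x\<bar> < e"
      using Stone_Weierstrass_real_polynomial_function[OF compact_Icc D e] by blast
    have pc: "continuous_on {a..b} p"
      using p by (simp add: continuous_on_polymonial_function real_polynomial_function_eq)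
    have "I = (LBINT x:{a..b}. (D x - p x) * D x + p x * D x)"
      by (simp add: I_def power2_eq_square algebra_simps)
    also have "\<dots> = (LBINT x:{a..b}. (D x - p x) * D x)"
      using orth[OF p] by (subst set_integral_add(2)) (auto intro!: int continuous_intros D pc)
    also have "\<dots> \<le> (LBINT x:{a..b}. e * \<bar>D x\<bar>)"
    proof (rule set_integral_mono)
      fix x assume "x \<in> {a..b}"
      then have "\<bar>D x - p x\<bar> * \<bar>D x\<bar> \<le> e * \<bar>D x\<bar>"
        using close[of x] by (intro mult_right_mono) auto
      then show "(D x - p x) * D x \<le> e * \<bar>D x\<bar>"
        by (metis abs_ge_self abs_mult order_trans)
    qed (auto intro!: int continuous_intros D pc)
    also have "\<dots> = e * A" by (simp add: A_def)
    finally show ?thesis .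
  qed
  have "I \<le> 0"
  proof (rule field_le_epsilon)
    fix e :: real assume "e > 0"
    \<comment> \<open>Dividing by \<open>A + 1\<close> avoids the case \<open>A = 0\<close>.\<close>
    then have "I \<le> e / (A + 1) * A" using A0 by (intro small) auto
    also have "\<dots> \<le> e" using A0 \<open>e > 0\<close> by (simp add: field_simps)
    finally show "I \<le> 0 + e" by simp
  qed
  moreover have "I \<ge> 0" unfolding I_def set_lebesgue_integral_def by (intro integral_nonneg_AE AE_I2) auto
  ultimately have "I = 0" by simp
  then have "integral (cbox a b) (\<lambda>x. (D x)\<^sup>2) = 0"
    using set_borel_integral_eq_integral(2)[OF int, of "\<lambda>x. (D x)\<^sup>2"] D
    by (simp add: I_def continuous_on_power)
  moreover have "continuous_on (cbox a b) (\<lambda>x. (D x)\<^sup>2)" using D by (simp add: continuous_on_power)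
  ultimately have "\<forall>x\<in>cbox a b. (D x)\<^sup>2 = 0"
    using ab by (subst (asm) integral_cbox_eq_0_iff) auto
  then show ?thesis using x by simp
qed

text \<open>The factor g! comes from the reduction to the alcove and (2 pi)^g from the normalisation
  of \<open>nu\<close>. Of the two Vandermonde factors one is the Jacobian and the other belongs to
  \<open>nu\<close>.\<close>

lemma weyl_to_slice:
  fixes \<phi> :: "real \<Rightarrow> real"
  assumes d0: "is_d0 CARD('n::{finite,wellorder}) d0" and d1: "is_d1 CARD('n) d1"
    and \<phi>: "continuous_on UNIV \<phi>"
  shows "(\<integral>y. \<phi> (psum 1 y) * (vdm y)\<^sup>2 * semics y \<partial>(lborel :: (real, 'n) vec measure))
     = fact CARD('n) * (2 * pi) ^ CARD('n) * (\<integral>x. \<phi> x * slice_integral CARD('n) (nu CARD('n) d0 d1) x \<partial>lborel)"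
proof -
  define i1 where "i1 = (inv_into UNIV tpos 1 :: 'n)"
  have "tpos i1 = 1" unfolding i1_def by (rule tpos_inv) (simp add: Suc_leI)
  then have i1: "ordrank i1 = 0" by (simp add: tpos_def)
  \<comment> \<open>The first elementary symmetric function is the sum of the coordinates, which is
    how the trace becomes the slicing variable.\<close>
  have s1: "vmap y $ i1 = psum 1 y" for y :: "(real, 'n) vec"
  proof -
    have "{X :: 'n set. card X = 1} = (\<lambda>i. {i}) ` UNIV" by (auto simp: card_1_singleton_iff)
    then show ?thesis by (simp add: vmap_def i1 esym_def psum_def sum.reindex)
  qed
  define G where "G s = \<phi> (s $ i1) * nuvec d0 d1 s" for s :: "(real, 'n) vec"
  have Gc: "continuous_on UNIV G"
    unfolding G_def by (intro continuous_intros continuous_on_nuvec[OF d0 d1] continuous_on_compose2[OF \<phi>]) auto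
  have "(\<integral>y. \<phi> (psum 1 y) * (vdm y)\<^sup>2 * semics y \<partial>(lborel :: (real, 'n) vec measure))
     = fact CARD('n) * (\<integral>y. indicator valcove y * (\<phi> (psum 1 y) * (vdm y)\<^sup>2 * semics y) \<partial>(lborel :: (real, 'n) vec measure))"
    by (rule integral_symmetric_valcove)
       (auto intro!: continuous_on_compose2[OF \<phi>] continuous_intros simp: psum_pvec)
  also have "(\<integral>y. indicator valcove y * (\<phi> (psum 1 y) * (vdm y)\<^sup>2 * semics y) \<partial>(lborel :: (real, 'n) vec measure))
     = (\<integral>y. (2 * pi) ^ CARD('n) * (indicator valcove y * (G (vmap y) * \<bar>vdm y\<bar>)) \<partial>lborel)"
  proof (intro Bochner_Integration.integral_cong refl)
    fix y :: "(real, 'n) vec"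
    show "indicator valcove y * (\<phi> (psum 1 y) * (vdm y)\<^sup>2 * semics y)
        = (2 * pi) ^ CARD('n) * (indicator valcove y * (G (vmap y) * \<bar>vdm y\<bar>))"
    proof (cases "y \<in> valcove")
      case True
      then have "nuvec d0 d1 (vmap y) = 1 / (2 * pi) ^ CARD('n) * (\<bar>vdm y\<bar> * semics y)"
        using nu_vmap[OF d0 d1, of y] by (auto simp: nuvec_def valcove_def less_imp_le)
      moreover have "\<bar>vdm y\<bar> * \<bar>vdm y\<bar> = (vdm y)\<^sup>2" by (simp add: power2_eq_square)
      ultimately show ?thesis using True by (simp add: G_def s1)
    qed simp
  qed
  also have "\<dots> = (2 * pi) ^ CARD('n) * (\<integral>s. indicator (vmap ` valcove) s * G s \<partial>lborel)"
    using integral_vmap_valcove[OF Gc] by simp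
  also have "(\<integral>s. indicator (vmap ` valcove) s * G s \<partial>lborel) = (\<integral>s. G s \<partial>lborel)"
    by (intro Bochner_Integration.integral_cong refl) (simp add: G_def nuvec_def indicator_def)
  also have "\<dots> = (\<integral>x. \<phi> x * slice_integral CARD('n) (nu CARD('n) d0 d1) x \<partial>lborel)"
    unfolding G_def i1_def by (rule fubini_slice(1)[OF d0 d1 \<phi>])
  finally show ?thesis by simp
qed

text \<open>The coordinates on the alcove have modulus below 2, so the slice is empty. This turns
  integrals over the line into integrals over [-2g, 2g].\<close>

lemma slice_integral_outside:
  assumes d0: "is_d0 CARD('n::{finite,wellorder}) d0" and d1: "is_d1 CARD('n) d1"
    and x: "\<bar>x\<bar> \<ge> 2 * real CARD('n)"
  shows "slice_integral CARD('n) (nu CARD('n) d0 d1) x = 0"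
proof -
  have "viete_slice CARD('n) x = {}"
  proof -
    have "\<bar>elem_sym CARD('n) 1 t\<bar> < 2 * real CARD('n)" if "t \<in> alcove CARD('n)" for t
    proof -
      have "{X. X \<subseteq> {1..CARD('n)} \<and> card X = 1} = (\<lambda>i. {i}) ` {1..CARD('n)}"
        by (auto simp: card_1_singleton_iff)
      then have "elem_sym CARD('n) 1 t = (\<Sum>i\<in>{1..CARD('n)}. t i)"
        by (simp add: elem_sym_def sum.reindex)
      also have "\<bar>\<dots>\<bar> \<le> (\<Sum>i\<in>{1..CARD('n)}. \<bar>t i\<bar>)" by (rule sum_abs)
      also have "\<dots> < (\<Sum>i\<in>{1..CARD('n)}. 2)"
        using that by (intro sum_strict_mono) (auto simp: alcove_def PiE_iff abs_less_iff minus_less_iff)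
      finally show ?thesis by simp
    qed
    then show ?thesis
      using x by (fastforce simp: viete_slice_def viete_domain_def viete_def)
  qed
  then show ?thesis by (simp add: slice_integral_def set_lebesgue_integral_def)
qed

text \<open>The powers of the trace are the monomials in q_1 alone. The eigenvalues are relabelled
  by the well-ordered copy of the index type, which does not affect power sums.\<close>

lemma haar_trace_moments:
  fixes \<mu> :: "('g::finite) cmat2 measure"
  assumes \<mu>: "is_normalized_Haar \<mu>"
  shows "(\<integral>m. trace_USp m ^ k \<partial>\<mu>) * (fact CARD('g) * (2 * pi) ^ CARD('g))
    = (\<integral>y. psum 1 y ^ k * (vdm y)\<^sup>2 * semics y \<partial>(lborel :: (real, 'g wo) vec measure))"
proof -
  have mon: "mon q (replicate k 1) = q 1 ^ k" for q by (induction k) auto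
  have "(\<integral>m. mon (htrace m) (replicate k 1) \<partial>\<mu>) * (\<integral>y. (vdm y)\<^sup>2 * semics y \<partial>(lborel :: (real, 'g wo) vec measure))
      = (\<integral>y. mon (psums y) (replicate k 1) * (vdm y)\<^sup>2 * semics y \<partial>(lborel :: (real, 'g wo) vec measure))"
  proof (rule loop_equations_unique)
    show "prob_space \<mu>" by (rule haar_prob[OF \<mu>])
    show "(\<lambda>m. htrace m k) \<in> borel_measurable \<mu>" for k
      by (intro haar_measurable[OF \<mu>] continuous_intros)
    show "(\<integral>m. loop k ks (htrace m) \<partial>\<mu>) = 0" if "1 \<le> k" for k ks
      by (rule haar_loop[OF \<mu> that])
    fix m :: "'g cmat2" assume "m \<in> space \<mu>"
    then obtain y :: "real^'g" where y: "y \<in> cube" "htrace m = psums y"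
      using USp_eigenvalues by (auto simp: haar_space[OF \<mu>])
    define y' where "y' = (\<chi> i :: 'g wo. y $ unwo i)"
    have "psums y' = psums y"
      unfolding y'_def psum_def by (rule ext) (simp add: sum.reindex_bij_betw[OF bij_unwo, of "\<lambda>i. (y $ i) ^ _"])
    moreover have "y' \<in> cube" using y(1) by (simp add: y'_def cube_def)
    ultimately show "\<exists>y\<in>(cube :: (real, 'g wo) vec set). htrace m = psums y" using y(2) by metis
  qed
  moreover have "htrace m 1 = trace_USp m" for m :: "'g cmat2"
    by (simp add: htrace_def herm_def trace_USp_def trace_add trace_ct)
  ultimately show ?thesis unfolding mon weyl_mass card_wo by simp
qed

lemma trace_density_slice:
  fixes \<mu> :: "('g::finite) cmat2 measure"
  assumes \<mu>: "is_normalized_Haar \<mu>" and d0: "is_d0 CARD('g) d0" and d1: "is_d1 CARD('g) d1"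
    and \<phi>: "real_polynomial_function \<phi>"
  shows "(\<integral>m. \<phi> (trace_USp m) \<partial>\<mu>) = (\<integral>x. \<phi> x * slice_integral CARD('g) (nu CARD('g) d0 d1) x \<partial>lborel)"
proof -
  let ?c = "fact CARD('g) * (2 * pi) ^ CARD('g)"
  obtain a n where a: "\<phi> = (\<lambda>x. \<Sum>i\<le>n. a i * x ^ i)"
    using \<phi> by (auto simp: real_polynomial_function_iff_sum)
  have ci: "integrable \<mu> (\<lambda>m. trace_USp m ^ i)" for i
    unfolding trace_USp_def by (intro haar_integrable[OF \<mu>] continuous_intros)
  have "(\<integral>m. \<phi> (trace_USp m) \<partial>\<mu>) * ?c = (\<Sum>i\<le>n. a i * ((\<integral>m. trace_USp m ^ i \<partial>\<mu>) * ?c))"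
    unfolding a using ci by (simp add: sum_distrib_right mult.assoc)
  also have "\<dots> = (\<Sum>i\<le>n. a i * (\<integral>y. psum 1 y ^ i * (vdm y)\<^sup>2 * semics y \<partial>(lborel :: (real, 'g wo) vec measure)))"
    unfolding haar_trace_moments[OF \<mu>] ..
  also have "\<dots> = (\<integral>y. \<phi> (psum 1 y) * (vdm y)\<^sup>2 * semics y \<partial>(lborel :: (real, 'g wo) vec measure))"
  proof -
    have "integrable lborel (\<lambda>y :: (real, 'g wo) vec. psum 1 y ^ i * (vdm y)\<^sup>2 * semics y)" for i
      by (intro integrable_semics continuous_intros)
    then show ?thesis unfolding a sum_distrib_right mult.assoc
      by (subst Bochner_Integration.integral_sum) (auto simp: mult.assoc)
  qed
  also have "\<dots> = ?c * (\<integral>x. \<phi> x * slice_integral CARD('g) (nu CARD('g) d0 d1) x \<partial>lborel)"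
    using weyl_to_slice[where 'n = "'g wo", of d0 d1 \<phi>] d0 d1 \<phi>
    by (simp add: card_wo continuous_on_polymonial_function real_polynomial_function_eq)
  finally show ?thesis by simp
qed

theorem proposition8p2:
  fixes \<mu> :: "('g::finite) cmat2 measure"
    and f :: "real \<Rightarrow> real" and d0 d1 :: ipoly and g :: nat and x :: real
  assumes "g = CARD('g)"
    and "is_normalized_Haar \<mu>"
    and "is_trace_density \<mu> f"
    and "is_d0 g d0" and "is_d1 g d1"
    and "\<bar>x\<bar> < 2 * real g"
  shows "f x = slice_integral g (nu g d0 d1) x"
proof -
  let ?F = "slice_integral CARD('g) (nu CARD('g) d0 d1)"
  define r where "r = 2 * real CARD('g)"
  have d: "is_d0 CARD('g) d0" "is_d1 CARD('g) d1" using assms by simp_all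
  have dw: "is_d0 CARD('g wo) d0" "is_d1 CARD('g wo) d1" using d by (simp_all add: card_wo)
  have Fc: "continuous_on UNIV ?F"
    using continuous_slice_integral[OF dw] by (simp add: card_wo)
  have F0: "?F x = 0" if "x \<notin> {-r..r}" for x
    using slice_integral_outside[OF dw, of x] that by (auto simp: card_wo r_def)
  have fc: "continuous_on {-r..r} f"
    and f: "\<And>\<phi> :: real \<Rightarrow> real. continuous_on UNIV \<phi> \<Longrightarrow> (\<integral>m. \<phi> (trace_USp m) \<partial>\<mu>) = (LBINT x:{-r..r}. \<phi> x * f x)"
    using assms(3) by (auto simp: is_trace_density_def r_def Let_def)
  have int: "set_integrable lborel {-r..r} h" if "continuous_on {-r..r} h" for h :: "real \<Rightarrow> real"
    unfolding set_integrable_def by (rule borel_integrable_compact[OF compact_Icc that])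
  have "f x - ?F x = 0"
  proof (rule polynomial_orthogonal_zero[where D = "\<lambda>x. f x - ?F x" and a = "- r" and b = r])
    show "- r < r" by (simp add: r_def)
    show "continuous_on {-r..r} (\<lambda>x. f x - ?F x)"
      by (intro continuous_on_diff fc continuous_on_subset[OF Fc]) simp
    show "x \<in> {-r..r}" using assms(1,6) by (auto simp: r_def)
    fix p :: "real \<Rightarrow> real" assume p: "real_polynomial_function p"
    have pc: "continuous_on S p" for S
      using p by (simp add: continuous_on_polymonial_function real_polynomial_function_eq)
    have "(LBINT x:{-r..r}. p x * f x) = (\<integral>x. p x * ?F x \<partial>lborel)"
      using f[OF pc] trace_density_slice[OF assms(2) d p] by simp
    also have "\<dots> = (LBINT x:{-r..r}. p x * ?F x)"
      unfolding set_lebesgue_integral_def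
    proof (intro Bochner_Integration.integral_cong refl)
      fix x show "p x * ?F x = indicat_real {- r..r} x *\<^sub>R (p x * ?F x)"
        using F0[of x] by (cases "x \<in> {-r..r}") auto
    qed
    finally show "(LBINT x:{-r..r}. p x * (f x - ?F x)) = 0"
      by (simp add: right_diff_distrib set_integral_diff(2) int continuous_on_mult pc fc continuous_on_subset[OF Fc])
  qed
  then show ?thesis using assms(1) by simp
qed

end
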